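(* Let $r > d/2$ be an integer and let $f \ge 0$, $f \in H^r_p([-\pi,\pi]^d)$. Assume: (H1) the component functions $m_j(x)$, $1 \le j \le M$, of $\boldsymbol{m}(x)$ are linearly independent; (H2) there exists a function $g > 0$ such that $\boldsymbol{\rho}(g) = \boldsymbol{\rho}(f)$; (H3) for every sufficiently large $N$ there exists $g \in \mathbb{S}^N$ such that $g(x_k) > 0$ for all $k \in \mathcal{N}^d$ and $$\frac{(2\pi)^d}{(2N+1)^d}\sum_{k \in \mathcal{N}^d} g(x_k)\, \mathcal{P}^N \boldsymbol{m}(x_k) = \boldsymbol{\rho}(f).$$ Then for all sufficiently large $N$, $$\| f - \Pi_+^N f \|_2 \lesssim \frac{1}{N^r} \| f \|_{H^r_p} .$$
   Context: Fix a dimension $d \ge 1$. $\|\cdot\|_2$ is the $L^2([-\pi,\pi]^d)$ norm; $H^r_p([-\pi,\pi]^d)$ is the Sobolev space of real-valued $2\pi$-periodic (in each variable) functions with weak derivatives up to order $r$ in $L^2([-\pi,\pi]^d)$, with its usual norm $\|\cdot\|_{H^r_p}$. For $N \in \mathbb{N}$ let $\mathcal{N} = \{-N,\dots,N\}$, let $\mathbb{S}^N$ be the space of real-valued functions in $\mathrm{span}\{e^{ik\cdot x} : k \in \mathcal{N}^d\}$, let $x_k = 2\pi k/(2N+1)$ for $k \in \mathcal{N}^d$ (collocation points), and let $\mathbb{S}^N_+ = \{ g \in \mathbb{S}^N : g(x_k) \ge 0 \ \forall k \in \mathcal{N}^d \}$. $\boldsymbol{m}(x) = (m_1(x),\dots,m_M(x))^{\intercal}$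 is a fixed vector of real polynomials in $x \in \mathbb{R}^d$, one of whose components is a (nonzero) constant. $\langle \varphi \rangle = \int_{[-\pi,\pi]^d} \varphi(x)\,\mathrm{d}x$, and the moments of a function $g$ on $[-\pi,\pi]^d$ are $\boldsymbol{\rho}(g) = \langle \boldsymbol{m}\, g\rangle \in \mathbb{R}^M$. The projection operator $\mathcal{P}^N : L^2((-\pi,\pi)^d) \to \mathbb{S}^N$ is $\mathcal{P}^N g = \sum_{k \in \mathcal{N}^d} \hat g_k e^{ik\cdot x}$ with $\hat g_k = (2\pi)^{-d}\int_{[-\pi,\pi]^d} g(x) e^{-ik\cdot x}\,\mathrm{d}x$; it is applied componentwise to $\boldsymbol{m}$. The positive moment-preserving projection is $$\Pi_+^N f = \operatorname*{argmin}_{g \in \mathbb{S}^N_+,\ \boldsymbol{\rho}(g) = \boldsymbol{\rho}(f)} \|g - f\|_2^2 .$$ $A \lesssim B$ means $A \le CB$ for a constant $C$ that may depend only on the dimension $d$, the size of the domain $(2\pi)^d$, and the polynomials $\boldsymbol{m}$. *)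

theory Defs
  imports "HOL-Analysis.Analysis"
begin

text \<open>
  The dimension is d = CARD('n) and points of d-space are vectors of type real^'n.
  The vector of polynomials is m : real^'n => real^'m, with M = CARD('m).
  Elements of function spaces on the cube are represented by functions on the whole of real^'n;
  only their values on the cube enter into norms, moments and Fourier coefficients.
\<close>

definition cube :: "(real^'n) set" where
  "cube = cbox (\<chi> i. - pi) (\<chi> i. pi)"

definition periodic :: "(real^'n \<Rightarrow> real) \<Rightarrow> bool" where
  "periodic f \<longleftrightarrow> (\<forall>x i. f (x + axis i (2 * pi)) = f x)"

definition L2 :: "(real^'n \<Rightarrow> real) set" where
  "L2 = {f. f \<in> borel_measurable (lebesgue_on cube) \<and>
            integrable (lebesgue_on cube) (\<lambda>x. (f x)\<^sup>2)}"

definition L2_norm :: "(real^'n \<Rightarrow> real) \<Rightarrow> real" where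
  "L2_norm f = sqrt (LINT x|lebesgue_on cube. (f x)\<^sup>2)"


subsection \<open>Periodic Sobolev spaces\<close>

definition partial :: "'n \<Rightarrow> (real^'n \<Rightarrow> real) \<Rightarrow> real^'n \<Rightarrow> real" where
  "partial i \<phi> x = frechet_derivative \<phi> (at x) (axis i 1)"

definition partials :: "'n list \<Rightarrow> (real^'n \<Rightarrow> real) \<Rightarrow> real^'n \<Rightarrow> real" where
  "partials js \<phi> = foldr partial js \<phi>"

text \<open>All iterated partial derivatives are differentiable everywhere, i.e. the function is
  infinitely often continuously differentiable.\<close>

definition smooth :: "(real^'n \<Rightarrow> real) \<Rightarrow> bool" where
  "smooth \<phi> \<longleftrightarrow> (\<forall>js x. partials js \<phi> differentiable (at x))"

definition mi_order :: "nat^'n \<Rightarrow> nat" where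
  "mi_order \<alpha> = (\<Sum>i\<in>UNIV. \<alpha> $ i)"

text \<open>
  Weak derivatives of periodic functions, that is, derivatives in the sense of periodic
  distributions: the test functions are the smooth functions on the torus. (Testing only with
  functions supported inside the open cube would miss jumps across its boundary.)
  The index type carries no order, so the derivative of a test function for the multi-index
  \<open>\<alpha>\<close> is written as \<open>partials js\<close> for an arbitrary list \<open>js\<close> that contains each
  \<open>i\<close> exactly \<open>\<alpha> $ i\<close> times; by symmetry of derivatives all these lists give the same function.
\<close>

definition weak_deriv_of ::
  "nat^'n \<Rightarrow> (real^'n \<Rightarrow> real) \<Rightarrow> (real^'n \<Rightarrow> real) \<Rightarrow> bool" where
  "weak_deriv_of \<alpha> f g \<longleftrightarrow> g \<in> L2 \<and>
     (\<forall>\<phi> js. smooth \<phi> \<longrightarrow> periodic \<phi> \<longrightarrow> (\<forall>i. count_list js i = \<alpha> $ i) \<longrightarrow>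
        (LINT x|lebesgue_on cube. f x * partials js \<phi> x)
          = (- 1) ^ mi_order \<alpha> * (LINT x|lebesgue_on cube. g x * \<phi> x))"

definition Hp :: "nat \<Rightarrow> (real^'n \<Rightarrow> real) set" where
  "Hp r = {f. periodic f \<and> f \<in> L2 \<and> (\<forall>\<alpha>. mi_order \<alpha> \<le> r \<longrightarrow> (\<exists>g. weak_deriv_of \<alpha> f g))}"

text \<open>A weak derivative is unique up to null sets, so the norm does not depend on the choice.\<close>

definition weak_deriv :: "nat^'n \<Rightarrow> (real^'n \<Rightarrow> real) \<Rightarrow> real^'n \<Rightarrow> real" where
  "weak_deriv \<alpha> f = (SOME g. weak_deriv_of \<alpha> f g)"

definition Hp_norm :: "nat \<Rightarrow> (real^'n \<Rightarrow> real) \<Rightarrow> real" where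
  "Hp_norm r f = sqrt (\<Sum>\<alpha> | mi_order \<alpha> \<le> r. (L2_norm (weak_deriv \<alpha> f))\<^sup>2)"

lemma finite_mi_order_le: "finite {\<alpha> :: nat^'n. mi_order \<alpha> \<le> r}"
proof (rule finite_subset)
  show "{\<alpha> :: nat^'n. mi_order \<alpha> \<le> r} \<subseteq> vec_lambda ` (UNIV \<rightarrow>\<^sub>E {..r})"
  proof
    fix \<alpha> :: "nat^'n" assume "\<alpha> \<in> {\<alpha>. mi_order \<alpha> \<le> r}"
    then have "\<alpha> $ i \<le> r" for i
      unfolding mi_order_def
      by (metis (no_types, lifting) UNIV_I finite_class.finite_UNIV le_trans
          member_le_sum mem_Collect_eq zero_le)
    then have "vec_nth \<alpha> \<in> UNIV \<rightarrow>\<^sub>E {..r}" by auto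
    then show "\<alpha> \<in> vec_lambda ` (UNIV \<rightarrow>\<^sub>E {..r})"
      by (metis image_eqI vec_nth_inverse)
  qed
  show "finite (vec_lambda ` (UNIV \<rightarrow>\<^sub>E {..r}) :: (nat^'n) set)"
    by (intro finite_imageI finite_PiE) auto
qed


subsection \<open>Trigonometric polynomials\<close>

definition freqs :: "nat \<Rightarrow> (int^'n) set" where
  "freqs N = {k. \<forall>i. k $ i \<in> {- int N..int N}}"

definition wave :: "int^'n \<Rightarrow> real^'n \<Rightarrow> complex" where
  "wave k x = exp (\<i> * complex_of_real (\<Sum>i\<in>UNIV. real_of_int (k $ i) * x $ i))"

definition colloc :: "nat \<Rightarrow> int^'n \<Rightarrow> real^'n" where
  "colloc N k = (\<chi> i. 2 * pi * real_of_int (k $ i) / (2 * real N + 1))"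

definition trig_space :: "nat \<Rightarrow> (real^'n \<Rightarrow> real) set" where
  "trig_space N =
     {g. \<exists>c. \<forall>x. complex_of_real (g x) = (\<Sum>k\<in>freqs N. c k * wave k x)}"

definition trig_space_nonneg :: "nat \<Rightarrow> (real^'n \<Rightarrow> real) set" where
  "trig_space_nonneg N = {g \<in> trig_space N. \<forall>k\<in>freqs N. g (colloc N k) \<ge> 0}"

definition fourier_coeff :: "(real^'n \<Rightarrow> real) \<Rightarrow> int^'n \<Rightarrow> complex" where
  "fourier_coeff g k =
     (LINT x|lebesgue_on cube. complex_of_real (g x) * wave (- k) x) / (2 * pi) ^ CARD('n)"

text \<open>For real functions the sum is real, so taking the real part only changes the type; see
  \<open>trig_proj_eq\<close>.\<close>

definition trig_proj :: "nat \<Rightarrow> (real^'n \<Rightarrow> real) \<Rightarrow> real^'n \<Rightarrow> real" where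
  "trig_proj N g x = Re (\<Sum>k\<in>freqs N. fourier_coeff g k * wave k x)"

lemma finite_freqs: "finite (freqs N :: (int^'n) set)"
proof (rule finite_subset)
  show "(freqs N :: (int^'n) set) \<subseteq> vec_lambda ` (UNIV \<rightarrow>\<^sub>E {- int N..int N})"
  proof
    fix k :: "int^'n" assume "k \<in> freqs N"
    then have "vec_nth k \<in> UNIV \<rightarrow>\<^sub>E {- int N..int N}" by (auto simp: freqs_def)
    then show "k \<in> vec_lambda ` (UNIV \<rightarrow>\<^sub>E {- int N..int N})"
      by (metis image_eqI vec_nth_inverse)
  qed
  show "finite (vec_lambda ` (UNIV \<rightarrow>\<^sub>E {- int N..int N}) :: (int^'n) set)"
    by (intro finite_imageI finite_PiE) auto
qed

lemma cnj_wave: "cnj (wave k x) = wave (- k) x"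
  by (simp add: wave_def exp_cnj sum_negf)

lemma cnj_fourier_coeff: "cnj (fourier_coeff g k) = fourier_coeff g (- k)"
proof -
  have "cnj (LINT x|lebesgue_on cube. complex_of_real (g x) * wave (- k) x)
        = (LINT x|lebesgue_on cube. cnj (complex_of_real (g x) * wave (- k) x))"
    by (rule Bochner_Integration.integral_cnj [symmetric])
  then show ?thesis by (simp add: fourier_coeff_def cnj_wave)
qed

lemma neg_freqs: "- k \<in> freqs N" if "k \<in> freqs N"
proof -
  have "(- k) $ i \<in> {- int N..int N}" for i
  proof -
    have "k $ i \<in> {- int N..int N}" using that by (simp add: freqs_def)
    then show ?thesis by auto
  qed
  then show ?thesis by (simp add: freqs_def)
qed

lemma trig_proj_eq:
  "complex_of_real (trig_proj N g x) = (\<Sum>k\<in>freqs N. fourier_coeff g k * wave k x)"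
proof -
  let ?s = "\<Sum>k\<in>freqs N. fourier_coeff g k * wave k x"
  have "cnj ?s = (\<Sum>k\<in>freqs N. fourier_coeff g (- k) * wave (- k) x)"
    by (simp add: cnj_fourier_coeff cnj_wave)
  also have "\<dots> = ?s"
    by (rule sum.reindex_bij_witness [where i = uminus and j = uminus])
       (auto simp: neg_freqs)
  finally have "?s \<in> \<real>" by (simp add: Reals_cnj_iff)
  then show ?thesis unfolding trig_proj_def by (rule of_real_Re)
qed

lemma trig_proj_in_trig_space: "trig_proj N g \<in> trig_space N"
  unfolding trig_space_def using trig_proj_eq by blast


subsection \<open>Moments and the positive moment-preserving projection\<close>

definition moments :: "(real^'n \<Rightarrow> real^'m) \<Rightarrow> (real^'n \<Rightarrow> real) \<Rightarrow> real^'m" where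
  "moments m g = (\<chi> j. LINT x|lebesgue_on cube. m x $ j * g x)"

definition lin_indep_components :: "(real^'n \<Rightarrow> real^'m) \<Rightarrow> bool" where
  "lin_indep_components m \<longleftrightarrow>
     (\<forall>c. (\<forall>x. (\<Sum>j\<in>UNIV. c j * m x $ j) = 0) \<longrightarrow> (\<forall>j. c j = 0))"

definition is_pos_proj ::
  "(real^'n \<Rightarrow> real^'m) \<Rightarrow> nat \<Rightarrow> (real^'n \<Rightarrow> real) \<Rightarrow> (real^'n \<Rightarrow> real) \<Rightarrow> bool" where
  "is_pos_proj m N f =
     is_arg_min (\<lambda>g. (L2_norm (\<lambda>x. g x - f x))\<^sup>2)
       (\<lambda>g. g \<in> trig_space_nonneg N \<and> moments m g = moments m f)"

definition pos_proj ::
  "(real^'n \<Rightarrow> real^'m) \<Rightarrow> nat \<Rightarrow> (real^'n \<Rightarrow> real) \<Rightarrow> real^'n \<Rightarrow> real" where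
  "pos_proj m N f = (THE g. is_pos_proj m N f g)"

end

theory Submission
  imports Defs
begin

text \<open>
  The projection is at least as close to f as any admissible competitor, so it suffices to find,
  for all large N, a competitor at distance o(N^-r); as the threshold for N may depend on f, the
  constant C = 1 works. Write a for the Fourier coefficients of f, let e_k be the exponentials, and
  let [k] be the representative of k modulo 2N+1 in the frequency cube. The interpolant
  I_N f = sum_k a_k e_[k] has the values of f at the collocation points, hence is nonnegative there,
  and a weighted Cauchy-Schwarz estimate of the aliased coefficients gives |f - I_N f| = o(N^-r) in L2.

  Its moments are off by o(N^-r). They are repaired by adding sum_j l_j I_N(p_j f) with fixed real
  trigonometric polynomials p_j such that the moments of p_j f are the unit vectors: at the
  collocation points this turns f into f (1 + sum_j l_j p_j), which stays nonnegative since l is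
  small. Such p_j exist: otherwise some nonzero combination c.m would make all Fourier coefficients
  of (c.m) f vanish, so (c.m) f = 0 by completeness, although f > 0 on an open set and c.m is a
  nonzero polynomial.
\<close>


text \<open>The truncated Fourier series of f may be negative at collocation points; the interpolant
  is not, since it inherits the values of f there. The price is aliasing, and this is where r > d/2
  enters: the numbers 1 / \<open>wgt r l\<close> over nonzero l are then summable. This makes the
  Fourier series converge absolutely, so that f has a continuous representative F with meaningful
  point values, and it bounds the aliasing by a constant Z.

  The obstacle in the moment repair is the zero set of f: there is no positive lower bound for f, so
  adding a fixed function could destroy nonnegativity at a collocation point. Multiplying f by 1 +
  sum_j l_j p_j instead keeps its zeros and, for small l, its sign.

  The error is little o because it is governed by the tail of one convergent weighted series. It
  beats \<open>Hp_norm r f\<close> / N^r because this norm is positive: as m has a nonzero constant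
  component, (H2) gives f the same total mass as a positive function, so f is not almost everywhere
  zero.\<close>

abbreviation cubeM :: "(real^'n) measure" where
  "cubeM \<equiv> lebesgue_on cube"

section \<open>Measure and integration on the cube\<close>

lemma mem_cube: "x \<in> cube \<longleftrightarrow> (\<forall>i. -pi \<le> x $ i \<and> x $ i \<le> pi)"
  by (auto simp: cube_def mem_box_cart)

lemma cube_sets [simp, measurable]: "cube \<in> sets lebesgue" "cube \<in> sets borel"
  by (auto simp: cube_def)

lemma compact_cube: "compact cube"
  by (auto simp: cube_def)

lemma finite_measure_cubeM: "finite_measure cubeM"
  by (rule finite_measure_lebesgue_on) (simp add: cube_def)

interpretation cubeM: finite_measure cubeM
  by (rule finite_measure_cubeM)

lemma meas_cubeM: "continuous_on UNIV f \<Longrightarrow> f \<in> borel_measurable cubeM"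
  for f :: "real^'n \<Rightarrow> 'b::euclidean_space"
  by (rule continuous_imp_measurable_on_sets_lebesgue) (auto intro: continuous_on_subset)

lemma bounded_cube:
  fixes f :: "real^'n \<Rightarrow> 'b::euclidean_space"
  assumes "continuous_on UNIV f"
  obtains B where "B > 0" "\<And>x. x \<in> cube \<Longrightarrow> norm (f x) \<le> B"
proof -
  have "bounded (f ` cube)"
    by (meson assms compact_continuous_image compact_cube compact_imp_bounded
        continuous_on_subset subset_UNIV)
  then show ?thesis using that by (auto simp: bounded_pos)
qed

lemma integrable_cube_mult_bounded:
  fixes f g :: "real^'n \<Rightarrow> 'b::{euclidean_space,real_normed_field}"
  assumes "integrable cubeM g" "f \<in> borel_measurable cubeM" "\<And>x. x \<in> cube \<Longrightarrow> norm (f x) \<le> B"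
  shows "integrable cubeM (\<lambda>x. f x * g x)"
proof (rule Bochner_Integration.integrable_bound)
  show "integrable cubeM (\<lambda>x. B *\<^sub>R norm (g x))"
    using assms(1) by (intro integrable_scaleR_right integrable_norm)
  show "(\<lambda>x. f x * g x) \<in> borel_measurable cubeM"
    using assms borel_measurable_integrable by (intro borel_measurable_times) auto
  show "AE x in cubeM. norm (f x * g x) \<le> norm (B *\<^sub>R norm (g x))"
  proof (rule AE_I2)
    fix x :: "real^'n" assume "x \<in> space cubeM"
    then have "norm (f x) \<le> B" using assms(3) by simp
    then have "norm (f x) * norm (g x) \<le> \<bar>B\<bar> * norm (g x)" by (intro mult_right_mono) auto
    then show "norm (f x * g x) \<le> norm (B *\<^sub>R norm (g x))" by (simp add: norm_mult abs_mult)
  qed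
qed

lemma integrable_cube_bounded:
  fixes f :: "real^'n \<Rightarrow> 'b::euclidean_space"
  assumes "f \<in> borel_measurable cubeM" "\<And>x. x \<in> cube \<Longrightarrow> norm (f x) \<le> B"
  shows "integrable cubeM f"
  by (rule cubeM.integrable_const_bound[where B = B]) (use assms in auto)

lemma integrable_cube_continuous:
  fixes f :: "real^'n \<Rightarrow> 'b::euclidean_space"
  assumes "continuous_on UNIV f"
  shows "integrable cubeM f"
  using bounded_cube[OF assms] meas_cubeM[OF assms] integrable_cube_bounded by metis

text \<open>Fubini for a product of functions of single coordinates. The measure
  \<open>lborel\<close> on vectors is the image of a product measure indexed by
  \<open>Basis\<close>, not by coordinates, so the factors are re-indexed: \<open>h\<close> attaches
  to the basis vector \<open>axis i 1\<close> the factor \<open>f i\<close>.\<close>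

lemma lebesgue_integral_prod_vec:
  fixes f :: "'n::finite \<Rightarrow> real \<Rightarrow> complex"
  assumes "\<And>i. integrable lborel (f i)"
  shows "(LINT x|(lborel :: (real^'n) measure). (\<Prod>i\<in>UNIV. f i (x $ i))) = (\<Prod>i\<in>UNIV. LINT t|lborel. f i t)"
proof -
  have [measurable]: "f i \<in> borel_measurable borel" for i
    using borel_measurable_integrable[OF assms] by simp
  interpret P: product_sigma_finite "\<lambda>_ :: real^'n. lborel :: real measure" ..
  define h where "h b = f (THE i. b = axis i 1)" for b :: "real^'n"
  have hax: "h (axis i 1) = f i" for i
    by (simp add: h_def axis_eq_axis)
  have B: "(Basis :: (real^'n) set) = range (\<lambda>i. axis i 1)"
    by (auto simp: Basis_vec_def)
  have inj: "inj (\<lambda>i::'n. axis i (1::real))"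
    by (auto simp: inj_on_def axis_eq_axis)
  have comp: "(\<Sum>b\<in>Basis. g b *\<^sub>R b) $ i = g (axis i 1)" for g :: "real^'n \<Rightarrow> real" and i
  proof -
    have "(\<Sum>b\<in>Basis. g b *\<^sub>R b) $ i = (\<Sum>b\<in>Basis. g b *\<^sub>R b) \<bullet> axis i 1"
      by (simp add: inner_axis)
    also have "\<dots> = g (axis i 1)"
      by (subst inner_sum_left_Basis) (auto simp: B)
    finally show ?thesis .
  qed
  have "(LINT x|(lborel :: (real^'n) measure). (\<Prod>i\<in>UNIV. f i (x $ i)))
      = (LINT g|(\<Pi>\<^sub>M b\<in>(Basis::(real^'n) set). lborel). (\<Prod>i\<in>UNIV. f i ((\<Sum>b\<in>Basis. g b *\<^sub>R b :: real^'n) $ i)))"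
    by (subst lborel_eq, subst integral_distr) auto
  also have "\<dots> = (LINT g|(\<Pi>\<^sub>M b\<in>(Basis::(real^'n) set). lborel). (\<Prod>b\<in>(Basis::(real^'n) set). h b (g b)))"
    unfolding comp by (simp add: B prod.reindex[OF inj] hax)
  also have "\<dots> = (\<Prod>b\<in>(Basis::(real^'n) set). LINT t|lborel. h b t)"
    by (rule P.product_integral_prod) (auto simp: B hax assms)
  also have "\<dots> = (\<Prod>i\<in>UNIV. LINT t|lborel. f i t)"
    unfolding B by (subst prod.reindex[OF inj]) (simp add: hax)
  finally show ?thesis .
qed

subsection \<open>Exponentials\<close>

lemma wave_add: "wave (k + l) x = wave k x * wave l x"
  by (simp add: wave_def exp_add[symmetric] algebra_simps sum.distrib)

lemma wave_0 [simp]: "wave 0 x = 1"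
  by (simp add: wave_def)

lemma wave_cis: "wave k x = cis (\<Sum>i\<in>UNIV. real_of_int (k $ i) * x $ i)"
  by (simp add: wave_def cis_conv_exp)

lemma wave_prod: "wave k x = (\<Prod>i\<in>UNIV. cis (real_of_int (k $ i) * x $ i))"
  unfolding wave_def by (simp add: cis_conv_exp exp_sum sum_distrib_left)

lemma norm_wave [simp]: "norm (wave k x) = 1"
  by (simp add: wave_cis)

lemma continuous_wave [continuous_intros]: "continuous_on S (wave k)"
  unfolding wave_def by (intro continuous_intros)

lemma wave_measurable [measurable]: "wave k \<in> borel_measurable cubeM"
  by (rule meas_cubeM) (rule continuous_wave)

lemma wave_borel_measurable [measurable]: "wave k \<in> borel_measurable borel"
  by (rule borel_measurable_continuous_onI) (rule continuous_wave)

lemma integral_cis_period: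
  "(LINT t|lborel. indicator {-pi..pi} t *\<^sub>R cis (real_of_int j * t)) = (if j = 0 then 2 * pi else 0)"
proof (cases "j = 0")
  case True
  have "(LINT t|lborel. indicator {-pi..pi} t *\<^sub>R (1::complex)) = measure lborel {-pi..pi} *\<^sub>R 1"
    by (subst integral_scaleR_left) simp_all
  then show ?thesis using True by (simp add: scaleR_conv_of_real)
next
  case False
  define F where "F t = cis (real_of_int j * t) / (\<i> * real_of_int j)" for t
  have "(LINT t|lborel. indicator {-pi..pi} t *\<^sub>R cis (real_of_int j * t)) = F pi - F (-pi)"
  proof (rule integral_FTC_atLeastAtMost)
    fix x
    show "(F has_vector_derivative cis (real_of_int j * x)) (at x within {-pi..pi})"
    proof -
      have "((\<lambda>z. exp (\<i> * of_int j * z) / (\<i> * of_int j)) has_field_derivative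
          exp (\<i> * of_int j * of_real x)) (at (of_real x))"
        by (rule derivative_eq_intros refl | simp add: False)+
      then have "((\<lambda>t. exp (\<i> * of_int j * of_real t) / (\<i> * of_int j)) has_vector_derivative
          exp (\<i> * of_int j * of_real x)) (at x within {-pi..pi})"
        by (rule has_vector_derivative_real_field)
      then show ?thesis by (simp add: F_def[abs_def] cis_conv_exp mult.assoc)
    qed
  qed (auto intro!: continuous_intros)
  also have "F (-pi) = F pi"
  proof -
    have "cis (real_of_int j * pi) = cis (real_of_int j * (-pi)) * cis (2 * pi * real_of_int j)"
      unfolding cis_mult by (rule arg_cong[of _ _ cis]) (simp add: algebra_simps)
    also have "cis (2 * pi * real_of_int j) = 1" by (rule cis_multiple_2pi) auto
    finally show ?thesis unfolding F_def by simp
  qed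
  finally show ?thesis using False by simp
qed

text \<open>The indicator of the cube and the exponential both factor over the coordinates. Since a
  product of waves is a wave of the summed frequencies, this is the orthogonality relation behind
  all coefficient computations below.\<close>

lemma integral_wave:
  "(LINT x|cubeM. wave k x) = (if k = 0 then (2 * pi) ^ CARD('n) else 0)" for k :: "int^'n"
proof -
  have ind: "indicator cube x *\<^sub>R wave k x
      = (\<Prod>i\<in>UNIV. indicator {-pi..pi} (x $ i) *\<^sub>R cis (real_of_int (k $ i) * x $ i))" for x :: "real^'n"
    by (cases "x \<in> cube") (auto simp: mem_cube wave_prod indicator_def prod_zero_iff)
  have "(LINT x|cubeM. wave k x) = (LINT x|lebesgue. indicator cube x *\<^sub>R wave k x)"
    by (rule integral_restrict_space) simp
  also have "\<dots> = (LINT x|lborel. indicator cube x *\<^sub>R wave k x)"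
    by (rule integral_completion) simp
  also have "\<dots> = (\<Prod>i\<in>UNIV. LINT t|lborel. indicator {-pi..pi} t *\<^sub>R cis (real_of_int (k $ i) * t))"
    unfolding ind
  proof (rule lebesgue_integral_prod_vec)
    fix i
    show "integrable lborel (\<lambda>t. indicator {-pi..pi} t *\<^sub>R cis (real_of_int (k $ i) * t))"
      by (rule borel_integrable_compact) (auto intro!: continuous_intros)
  qed
  also have "\<dots> = (if k = 0 then (2 * pi) ^ CARD('n) else 0)"
    unfolding integral_cis_period
    by (auto simp: vec_eq_iff prod_zero_iff)
  finally show ?thesis .
qed


subsection \<open>Trigonometric polynomials\<close>

text \<open>The complex span behind \<open>trig_space\<close>. Single exponentials and complex
  multiples live here, so the algebra is done in this space and then transferred to real
  functions.\<close>

definition ctrig :: "nat \<Rightarrow> (real^'n \<Rightarrow> complex) set" where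
  "ctrig N = {h. \<exists>c. \<forall>x. h x = (\<Sum>k\<in>freqs N. c k * wave k x)}"

lemma ctrigI: "(\<And>x. h x = (\<Sum>k\<in>freqs N. c k * wave k x)) \<Longrightarrow> h \<in> ctrig N"
  by (auto simp: ctrig_def)

lemma ctrig_cmult: "h \<in> ctrig N \<Longrightarrow> (\<lambda>x. a * h x) \<in> ctrig N"
proof -
  assume "h \<in> ctrig N"
  then obtain c where "\<And>x. h x = (\<Sum>k\<in>freqs N. c k * wave k x)" by (auto simp: ctrig_def)
  then show ?thesis
    by (intro ctrigI[where c = "\<lambda>k. a * c k"]) (simp add: sum_distrib_left mult.assoc)
qed

lemma ctrig_add: "h \<in> ctrig N \<Longrightarrow> h' \<in> ctrig N \<Longrightarrow> (\<lambda>x. h x + h' x) \<in> ctrig N"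
proof -
  assume "h \<in> ctrig N" "h' \<in> ctrig N"
  then obtain c c' where "\<And>x. h x = (\<Sum>k\<in>freqs N. c k * wave k x)"
    "\<And>x. h' x = (\<Sum>k\<in>freqs N. c' k * wave k x)" by (auto simp: ctrig_def)
  then show ?thesis
    by (intro ctrigI[where c = "\<lambda>k. c k + c' k"]) (simp add: sum.distrib algebra_simps)
qed

lemma ctrig_sum: "(\<And>i. i \<in> I \<Longrightarrow> h i \<in> ctrig N) \<Longrightarrow> (\<lambda>x. \<Sum>i\<in>I. h i x) \<in> ctrig N"
proof (induction I rule: infinite_finite_induct)
  case (insert i I)
  then show ?case using ctrig_add[of "h i" N "\<lambda>x. \<Sum>i\<in>I. h i x"] by simp
qed (auto intro!: ctrigI[where c = "\<lambda>_. 0"])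

lemma wave_ctrig: "k \<in> freqs N \<Longrightarrow> wave k \<in> ctrig N"
  by (rule ctrigI[where c = "\<lambda>l. if l = k then 1 else 0"])
     (simp add: if_distrib[of "\<lambda>a. a * _"] finite_freqs cong: if_cong)

lemma freqs_mono: "N \<le> N' \<Longrightarrow> freqs N \<subseteq> freqs N'"
proof
  fix k assume "N \<le> N'" "k \<in> freqs N"
  then have "k $ i \<in> {- int N'..int N'}" for i
    by (auto simp: freqs_def) (smt (verit) atLeastAtMost_iff of_nat_mono)+
  then show "k \<in> freqs N'" by (simp add: freqs_def)
qed

lemma freqs_add: "k \<in> freqs N \<Longrightarrow> l \<in> freqs N' \<Longrightarrow> k + l \<in> freqs (N + N')"
proof -
  assume "k \<in> freqs N" "l \<in> freqs N'"
  then have "(k + l) $ i \<in> {- int (N + N')..int (N + N')}" for i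
    by (simp add: freqs_def) (smt (verit))
  then show ?thesis by (simp add: freqs_def)
qed

lemma zero_freqs [simp]: "0 \<in> freqs N"
  by (simp add: freqs_def)

lemma freqs_exists: "\<exists>N. k \<in> freqs N"
proof -
  have "\<bar>k $ i\<bar> \<le> (\<Sum>i\<in>UNIV. \<bar>k $ i\<bar>)" for i
    by (rule member_le_sum) auto
  then have "k $ i \<in> {- int (nat (\<Sum>i\<in>UNIV. \<bar>k $ i\<bar>))..int (nat (\<Sum>i\<in>UNIV. \<bar>k $ i\<bar>))}" for i
    by (smt (verit, best) atLeastAtMost_iff int_nat_eq)
  then show ?thesis unfolding freqs_def by blast
qed

lemma ctrig_mono: "N \<le> N' \<Longrightarrow> h \<in> ctrig N \<Longrightarrow> h \<in> ctrig N'"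
proof -
  assume "N \<le> N'" "h \<in> ctrig N"
  then obtain c where c: "h = (\<lambda>x. \<Sum>k\<in>freqs N. c k * wave k x)" by (auto simp: ctrig_def)
  show ?thesis unfolding c
    using freqs_mono[OF \<open>N \<le> N'\<close>] by (intro ctrig_sum ctrig_cmult wave_ctrig) auto
qed

lemma ctrig_mult: "h \<in> ctrig N \<Longrightarrow> h' \<in> ctrig N' \<Longrightarrow> (\<lambda>x. h x * h' x) \<in> ctrig (N + N')"
proof -
  assume "h \<in> ctrig N" "h' \<in> ctrig N'"
  then obtain c c' where c: "\<And>x. h x = (\<Sum>k\<in>freqs N. c k * wave k x)"
    "\<And>x. h' x = (\<Sum>k\<in>freqs N'. c' k * wave k x)" by (auto simp: ctrig_def)
  have "(\<lambda>x. h x * h' x) = (\<lambda>x. \<Sum>k\<in>freqs N. \<Sum>l\<in>freqs N'. (c k * c' l) * wave (k + l) x)"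
    unfolding c sum_product wave_add by (intro ext sum.cong refl) (simp add: mult_ac)
  also have "\<dots> \<in> ctrig (N + N')"
    by (intro ctrig_sum ctrig_cmult wave_ctrig freqs_add)
  finally show ?thesis .
qed

lemma trig_space_iff_ctrig: "g \<in> trig_space N \<longleftrightarrow> (\<lambda>x. complex_of_real (g x)) \<in> ctrig N"
  by (auto simp: trig_space_def ctrig_def)

text \<open>The real part is the average of the function and its conjugate, and conjugation only
  reflects the frequency cube, which is symmetric.\<close>

lemma Re_ctrig: assumes "h \<in> ctrig N" shows "(\<lambda>x. Re (h x)) \<in> trig_space N"
proof -
  obtain c where c: "h = (\<lambda>x. \<Sum>k\<in>freqs N. c k * wave k x)" using assms by (auto simp: ctrig_def)
  have cn: "(\<lambda>x. cnj (h x)) = (\<lambda>x. \<Sum>k\<in>freqs N. cnj (c k) * wave (- k) x)"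
    by (simp add: c cnj_wave)
  have "(\<lambda>x. cnj (h x)) \<in> ctrig N"
    unfolding cn by (intro ctrig_sum ctrig_cmult wave_ctrig neg_freqs)
  then have "(\<lambda>x. (1/2) * (h x + cnj (h x))) \<in> ctrig N"
    using assms by (intro ctrig_cmult ctrig_add)
  also have "(\<lambda>x. (1/2) * (h x + cnj (h x))) = (\<lambda>x. complex_of_real (Re (h x)))"
    by (auto simp: complex_eq_iff)
  finally show ?thesis by (simp add: trig_space_iff_ctrig)
qed

lemma trig_space_add: "g \<in> trig_space N \<Longrightarrow> h \<in> trig_space N \<Longrightarrow> (\<lambda>x. g x + h x) \<in> trig_space N"
  using ctrig_add[of "\<lambda>x. complex_of_real (g x)" N "\<lambda>x. complex_of_real (h x)"]
  by (simp add: trig_space_iff_ctrig)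

lemma trig_space_cmult: "g \<in> trig_space N \<Longrightarrow> (\<lambda>x. a * g x) \<in> trig_space N"
  using ctrig_cmult[of "\<lambda>x. complex_of_real (g x)" N "of_real a"]
  by (simp add: trig_space_iff_ctrig)

lemma trig_space_sum: "(\<And>i. i \<in> I \<Longrightarrow> h i \<in> trig_space N) \<Longrightarrow> (\<lambda>x. \<Sum>i\<in>I. h i x) \<in> trig_space N"
  using ctrig_sum[of I "\<lambda>i x. complex_of_real (h i x)" N]
  by (simp add: trig_space_iff_ctrig)

lemma trig_space_mono: "N \<le> N' \<Longrightarrow> g \<in> trig_space N \<Longrightarrow> g \<in> trig_space N'"
  using ctrig_mono by (auto simp: trig_space_iff_ctrig)

lemma trig_space_mult: "g \<in> trig_space N \<Longrightarrow> h \<in> trig_space N' \<Longrightarrow> (\<lambda>x. g x * h x) \<in> trig_space (N + N')"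
  using ctrig_mult[of "\<lambda>x. complex_of_real (g x)" N "\<lambda>x. complex_of_real (h x)" N']
  by (simp add: trig_space_iff_ctrig)

lemma trig_space_const: "(\<lambda>x. a) \<in> trig_space N"
proof -
  have "(\<lambda>x :: real^'n. complex_of_real a * wave 0 x) \<in> ctrig N"
    by (intro ctrig_cmult wave_ctrig) simp
  then show ?thesis by (simp add: trig_space_iff_ctrig)
qed

lemma continuous_ctrig: "h \<in> ctrig N \<Longrightarrow> continuous_on S h"
proof -
  assume "h \<in> ctrig N"
  then obtain c where c: "h = (\<lambda>x. \<Sum>k\<in>freqs N. c k * wave k x)" by (auto simp: ctrig_def)
  show ?thesis unfolding c by (intro continuous_intros)
qed

lemma continuous_trig_space: "g \<in> trig_space N \<Longrightarrow> continuous_on S g"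
  unfolding trig_space_iff_ctrig
  by (drule continuous_ctrig[where S = S]) (drule continuous_on_Re, simp)

lemma trig_space_measurable: "g \<in> trig_space N \<Longrightarrow> g \<in> borel_measurable cubeM"
  by (intro meas_cubeM continuous_trig_space)

text \<open>Allows the polynomials that approximate a step function to be composed with a
  trigonometric polynomial. The degree may grow arbitrarily, hence only the existence of some
  N.\<close>

lemma trig_polys_real_polynomial:
  assumes "real_polynomial_function q" "\<exists>N. u \<in> trig_space N"
  shows "\<exists>N. (\<lambda>x. q (u x)) \<in> trig_space N"
  using assms(1)
proof induction
  case (linear f)
  then obtain c where "f = (\<lambda>t. t * c)" using real_bounded_linear by metis
  then show ?case using assms(2) trig_space_cmult[of u _ c] by (auto simp: mult.commute)
next
  case (const c)
  then show ?case using trig_space_const by blast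
next
  case (add f g)
  then obtain N N' where "(\<lambda>x. f (u x)) \<in> trig_space N" "(\<lambda>x. g (u x)) \<in> trig_space N'" by blast
  then have "(\<lambda>x. f (u x)) \<in> trig_space (N + N')" "(\<lambda>x. g (u x)) \<in> trig_space (N + N')"
    using trig_space_mono by (metis le_add1, metis le_add2)
  then show ?case using trig_space_add by blast
next
  case (mult f g)
  then show ?case using trig_space_mult by blast
qed

lemma trig_polys_prod:
  assumes "\<And>i. i \<in> I \<Longrightarrow> \<exists>N. h i \<in> trig_space N" "finite I"
  shows "\<exists>N. (\<lambda>x. \<Prod>i\<in>I. h i x) \<in> trig_space N"
  using assms(2,1)
proof (induction I)
  case empty
  then show ?case using trig_space_const[of 1] by auto
next
  case (insert i I)
  then obtain N N' where "h i \<in> trig_space N" "(\<lambda>x. \<Prod>i\<in>I. h i x) \<in> trig_space N'" by blast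
  from trig_space_mult[OF this] show ?case using insert by auto
qed

lemma cos_wave: "cos ((\<Sum>i\<in>UNIV. real_of_int (k $ i) * x $ i) + a) = Re (cis a * wave k x)"
  by (simp add: wave_cis cos_add algebra_simps)

lemma trig_space_cos:
  "\<exists>N. (\<lambda>x. cos ((\<Sum>i\<in>UNIV. real_of_int (k $ i) * x $ i) + a)) \<in> trig_space N"
proof -
  obtain N where "k \<in> freqs N" using freqs_exists by blast
  then have "(\<lambda>x. cis a * wave k x) \<in> ctrig N" by (intro ctrig_cmult wave_ctrig)
  from Re_ctrig[OF this] show ?thesis unfolding cos_wave by blast
qed

lemma trig_space_cos_coord: "\<exists>N. (\<lambda>x. cos (x $ i - a)) \<in> trig_space N"
proof -
  have "(\<Sum>j\<in>UNIV. real_of_int (axis i 1 $ j) * x $ j) = x $ i" for x :: "real^'a"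
    by (simp add: axis_def if_distrib[of real_of_int] if_distrib[of "\<lambda>a. a * _"] cong: if_cong)
  then show ?thesis using trig_space_cos[of "axis i 1" "- a"] by simp
qed

subsection \<open>Completeness\<close>

text \<open>Let \<open>y\<close> be the distance from x to the midpoint. For y up to pi the claim is
  the monotonicity of cosine on [0, pi]. For larger y, reflection to 2 pi - y leaves the cosine
  unchanged, and 2 pi - y is still at least half the length of the interval because a, b and x all
  lie in [-pi, pi].\<close>

lemma cos_gt_iff:
  fixes a b x :: real
  assumes "- pi \<le> a" "a < b" "b \<le> pi" "- pi \<le> x" "x \<le> pi"
  shows "cos (x - (a + b) / 2) > cos ((b - a) / 2) \<longleftrightarrow> a < x \<and> x < b"
proof -
  define y where "y = \<bar>x - (a + b) / 2\<bar>"
  have cy: "cos (x - (a + b) / 2) = cos y" by (simp add: y_def)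
  have w: "0 \<le> (b - a) / 2" "(b - a) / 2 \<le> pi" using assms by (auto simp: field_simps)
  have iff: "a < x \<and> x < b \<longleftrightarrow> y < (b - a) / 2" unfolding y_def by (auto simp: abs_if field_simps)
  show ?thesis
  proof (cases "y \<le> pi")
    case True
    then show ?thesis unfolding cy iff using w by (subst cos_mono_less_eq) (auto simp: y_def)
  next
    case False
    have "cos y = cos (2 * pi - y)" by (simp add: cos_diff)
    moreover have "2 * pi - y \<ge> (b - a) / 2" using assms unfolding y_def by (auto simp: abs_if field_simps)
    moreover have "2 * pi - y \<le> pi" using False by simp
    ultimately have "cos y \<le> cos ((b - a) / 2)"
      using w by (metis cos_monotone_0_pi_le)
    then show ?thesis unfolding cy iff using False w by auto
  qed
qed

text \<open>On the cube the trigonometric polynomial cos (x - (a + b) / 2) - cos ((b - a) / 2) is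
  positive precisely for a < x < b, so polynomials approximating a step function turn it into
  trigonometric approximations of the indicator of a box.\<close>

lemma approx_step_polynomial:
  obtains q :: "nat \<Rightarrow> real \<Rightarrow> real"
  where "\<And>n. real_polynomial_function (q n)"
    and "\<And>n t. t \<in> {-2..2} \<Longrightarrow> \<bar>q n t\<bar> \<le> 2"
    and "\<And>t. t \<in> {-2..2} \<Longrightarrow> (\<lambda>n. q n t) \<longlonglongrightarrow> (if t > 0 then 1 else 0)"
proof -
  \<comment> \<open>A continuous ramp from 0 to 1 of slope n, tending pointwise to the step. The
    range [-2, 2] accommodates any difference of two cosines, and an approximation error below 1 /
    (n + 1), hence below 1 in absolute value, gives the uniform bound 2.\<close>
  define \<psi> where "\<psi> n t = min 1 (real n * max 0 t)" for n :: nat and t :: real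
  have "\<exists>q. real_polynomial_function q \<and> (\<forall>t\<in>{-2..2}. \<bar>\<psi> n t - q t\<bar> < 1 / (real n + 1))" for n
  proof -
    have cont: "continuous_on {-2..2} (\<psi> n)" unfolding \<psi>_def by (intro continuous_intros)
    have pos: "0 < 1 / (real n + 1)" by simp
    show ?thesis
    proof (rule Stone_Weierstrass_real_polynomial_function[OF compact_Icc cont pos])
      fix q assume "real_polynomial_function q" "\<And>t. t \<in> {-2..2} \<Longrightarrow> \<bar>\<psi> n t - q t\<bar> < 1 / (real n + 1)"
      then show ?thesis by blast
    qed
  qed
  then obtain q where q: "\<And>n. real_polynomial_function (q n)"
    "\<And>n t. t \<in> {-2..2} \<Longrightarrow> \<bar>\<psi> n t - q n t\<bar> < 1 / (real n + 1)" by metis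
  show ?thesis
  proof (rule that[of q])
    fix n and t :: real assume t: "t \<in> {-2..2}"
    have "0 \<le> \<psi> n t" "\<psi> n t \<le> 1" by (auto simp: \<psi>_def)
    moreover have "1 / (real n + 1) \<le> 1" by simp
    ultimately show "\<bar>q n t\<bar> \<le> 2" using q(2)[OF t, of n] by linarith
  next
    fix t :: real assume t: "t \<in> {-2..2}"
    have 1: "(\<lambda>n. \<psi> n t) \<longlonglongrightarrow> (if t > 0 then 1 else 0)"
    proof (cases "t > 0")
      case True
      obtain n0 :: nat where n0: "1 / t < real n0" using reals_Archimedean2 by blast
      have "\<forall>\<^sub>F n in sequentially. \<psi> n t = 1"
        using eventually_ge_at_top[of n0]
      proof eventually_elim
        case (elim n)
        then have "1 / t < real n" using n0 by linarith
        then show ?case using True by (simp add: \<psi>_def field_simps)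
      qed
      then show ?thesis using True by (auto intro: tendsto_eventually)
    qed (simp add: \<psi>_def)
    have "(\<lambda>n. 1 / (real n + 1)) \<longlonglongrightarrow> 0" by real_asymp
    then have "(\<lambda>n. \<psi> n t - q n t) \<longlonglongrightarrow> 0"
      by (rule Lim_null_comparison[rotated]) (use q(2)[OF t] in \<open>auto intro!: always_eventually less_imp_le\<close>)
    from tendsto_diff[OF 1 this] show "(\<lambda>n. q n t) \<longlonglongrightarrow> (if t > 0 then 1 else 0)" by simp
  qed (rule q(1))
qed

lemma indicator_measurable_cubeM:
  "A \<in> sets lebesgue \<Longrightarrow> (indicator A :: real^'n \<Rightarrow> real) \<in> borel_measurable cubeM"
  by (intro measurable_restrict_space1 borel_measurable_indicator)

lemma AE_interior_cube: "AE x in (cubeM :: (real^'n) measure). \<forall>i. - pi < x $ i \<and> x $ i < pi"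
proof -
  have "negligible (cube - box (\<chi> i. - pi) (\<chi> i. pi) :: (real^'n) set)"
    unfolding cube_def by (rule negligible_frontier_interval)
  then have "AE x in lebesgue. x \<notin> cube - box (\<chi> i. - pi) (\<chi> i. pi) \<or> (x::real^'n) \<notin> cube"
    by (auto simp: negligible_iff_null_sets dest!: AE_not_in elim: eventually_mono)
  then have "AE x in lebesgue. (x::real^'n) \<in> cube \<longrightarrow> (\<forall>i. - pi < x $ i \<and> x $ i < pi)"
    by eventually_elim (auto simp: mem_box_cart)
  then show ?thesis by (simp add: AE_restrict_space_iff)
qed

section \<open>Integrable functions all of whose Fourier coefficients vanish\<close>

context
  fixes g :: "real^'n \<Rightarrow> real"
  assumes int: "integrable cubeM g"
    and zero: "\<And>k. (LINT x|cubeM. complex_of_real (g x) * wave k x) = 0"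
begin

lemma integral_trig_zero: "T \<in> trig_space N \<Longrightarrow> (LINT x|cubeM. T x * g x) = 0"
proof -
  assume "T \<in> trig_space N"
  then obtain c where c: "\<And>x. complex_of_real (T x) = (\<Sum>k\<in>freqs N. c k * wave k x)"
    by (auto simp: trig_space_def)
  have i: "integrable cubeM (\<lambda>x. complex_of_real (g x) * wave k x)" for k
    using integrable_cube_mult_bounded[of "\<lambda>x. complex_of_real (g x)" "wave k" 1] int
    by (simp add: mult.commute)
  have "complex_of_real (LINT x|cubeM. T x * g x) = (LINT x|cubeM. complex_of_real (T x * g x))"
    by (rule integral_complex_of_real[symmetric])
  also have "\<dots> = (LINT x|cubeM. (\<Sum>k\<in>freqs N. c k * (complex_of_real (g x) * wave k x)))"
    by (simp add: c sum_distrib_left sum_distrib_right mult_ac)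
  also have "\<dots> = 0"
    by (subst Bochner_Integration.integral_sum) (auto simp: zero i intro!: integrable_mult_right)
  finally show ?thesis by simp
qed

text \<open>The functions \<open>T n\<close> are trigonometric polynomials, bounded on the cube by
  2^d, and tend there to the indicator of the open box. Each integrates to zero against g, and
  dominated convergence carries this to the limit.\<close>

lemma integral_box_zero_aux:
  assumes ab: "\<And>i. - pi \<le> a $ i \<and> a $ i < b $ i \<and> b $ i \<le> pi"
  shows "(LINT x|cubeM. indicator (box a b) x * g x) = 0"
proof -
  obtain q :: "nat \<Rightarrow> real \<Rightarrow> real" where q: "\<And>n. real_polynomial_function (q n)"
    "\<And>n t. t \<in> {-2..2} \<Longrightarrow> \<bar>q n t\<bar> \<le> 2"
    "\<And>t. t \<in> {-2..2} \<Longrightarrow> (\<lambda>n. q n t) \<longlonglongrightarrow> (if t > 0 then 1 else 0)"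
    using approx_step_polynomial by metis
  define u where "u i x = cos (x $ i - (a $ i + b $ i) / 2) - cos ((b $ i - a $ i) / 2)"
    for i and x :: "real^'n"
  define T where "T n x = (\<Prod>i\<in>UNIV. q n (u i x))" for n x
  have u2: "u i x \<in> {-2..2}" for i x
  proof -
    have "\<bar>cos t - cos s\<bar> \<le> 2" for t s :: real
      using abs_triangle_ineq4[of "cos t" "cos s"] abs_cos_le_one[of t] abs_cos_le_one[of s] by linarith
    from this[of "x $ i - (a $ i + b $ i) / 2" "(b $ i - a $ i) / 2"]
    show ?thesis unfolding u_def by (auto simp: abs_le_iff)
  qed
  have "\<exists>N. u i \<in> trig_space N" for i
  proof -
    obtain N where "(\<lambda>x. cos (x $ i - (a $ i + b $ i) / 2)) \<in> trig_space N"
      using trig_space_cos_coord by blast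
    from trig_space_add[OF this trig_space_const, of "- cos ((b $ i - a $ i) / 2)"]
    show ?thesis by (auto simp: u_def[abs_def])
  qed
  then have "\<exists>N. (\<lambda>x. q n (u i x)) \<in> trig_space N" for n i
    by (rule trig_polys_real_polynomial[OF q(1)])
  then have "\<exists>N. T n \<in> trig_space N" for n
    using trig_polys_prod[of UNIV "\<lambda>i x. q n (u i x)"] by (simp add: T_def[abs_def])
  then have T0: "(LINT x|cubeM. T n x * g x) = 0" and Tm: "T n \<in> borel_measurable cubeM" for n
    using integral_trig_zero trig_space_measurable by blast+
  have "(\<lambda>n. LINT x|cubeM. T n x * g x) \<longlonglongrightarrow> (LINT x|cubeM. indicator (box a b) x * g x)"
  proof (rule integral_dominated_convergence[where w = "\<lambda>x. 2 ^ CARD('n) * norm (g x)"])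
    show "AE x in cubeM. (\<lambda>n. T n x * g x) \<longlonglongrightarrow> indicator (box a b) x * g x"
    proof (rule AE_I2)
      fix x :: "real^'n" assume "x \<in> space cubeM"
      then have x: "x \<in> cube" by simp
      have "u i x > 0 \<longleftrightarrow> a $ i < x $ i \<and> x $ i < b $ i" for i
        using cos_gt_iff[of "a $ i" "b $ i" "x $ i"] ab[of i] x by (simp add: u_def mem_cube)
      then have "indicator (box a b) x = (\<Prod>i\<in>UNIV. if u i x > 0 then 1 else 0 :: real)"
        by (auto simp: indicator_def mem_box_cart prod_zero_iff)
      moreover have "(\<lambda>n. T n x) \<longlonglongrightarrow> (\<Prod>i\<in>UNIV. if u i x > 0 then 1 else 0 :: real)"
        unfolding T_def by (intro tendsto_prod q u2)
      ultimately show "(\<lambda>n. T n x * g x) \<longlonglongrightarrow> indicator (box a b) x * g x"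
        by (intro tendsto_mult) auto
    qed
    show "AE x in cubeM. norm (T n x * g x) \<le> 2 ^ CARD('n) * norm (g x)" for n
    proof (rule AE_I2)
      fix x :: "real^'n"
      have "\<bar>T n x\<bar> \<le> (\<Prod>i\<in>(UNIV::'n set). 2)"
        unfolding T_def abs_prod by (intro prod_mono) (auto intro!: q u2)
      then show "norm (T n x * g x) \<le> 2 ^ CARD('n) * norm (g x)"
        by (simp add: abs_mult mult_right_mono)
    qed
    show "(\<lambda>x. indicator (box a b) x * g x) \<in> borel_measurable cubeM"
      using int by (intro borel_measurable_times indicator_measurable_cubeM) auto
  qed (use int Tm in \<open>auto intro!: borel_measurable_times\<close>)
  then show ?thesis by (simp add: T0 LIMSEQ_const_iff)
qed

text \<open>An arbitrary box is clipped to the cube. Clipping an open box may lose points on the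
  boundary of the cube, so the two indicators agree only almost everywhere.\<close>

lemma integral_box_zero: "(LINT x|cubeM. indicator (box a b) x * g x) = 0"
proof -
  define a' where "a' = (\<chi> i. max (- pi) (a $ i))"
  define b' where "b' = (\<chi> i. min pi (b $ i))"
  have "(LINT x|cubeM. indicator (box a b) x * g x) = (LINT x|cubeM. indicator (box a' b') x * g x)"
  proof (rule integral_cong_AE)
    show "AE x in cubeM. indicator (box a b) x * g x = indicator (box a' b') x * g x"
      using AE_interior_cube
      by eventually_elim (auto simp: indicator_def mem_box_cart a'_def b'_def)
  qed (use int in \<open>auto intro!: borel_measurable_times indicator_measurable_cubeM\<close>)
  also have "\<dots> = 0"
  proof (cases "\<forall>i. a' $ i < b' $ i")
    case True
    then show ?thesis by (intro integral_box_zero_aux) (auto simp: a'_def b'_def)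
  next
    case False
    then obtain i where "\<not> a' $ i < b' $ i" by blast
    then have "x \<notin> box a' b'" for x unfolding mem_box_cart by (metis less_trans)
    then have "box a' b' = {}" by blast
    then show ?thesis by simp
  qed
  finally show ?thesis .
qed

text \<open>Open boxes form an intersection-stable generator of the Borel sets, and the sets over
  which g integrates to zero are closed under complements and countable disjoint unions.\<close>

lemma integral_borel_zero:
  assumes "A \<in> sets borel"
  shows "(LINT x|cubeM. indicator A x * g x) = 0"
proof -
  have eq: "sets borel = sigma_sets UNIV (range (\<lambda>(a, b). box a b :: (real^'n) set))"
    by (subst borel_eq_box) simp
  have im: "integrable cubeM (\<lambda>x. indicator A x * g x)" if "A \<in> sets borel" for A
    by (rule integrable_cube_mult_bounded[where B = 1])
       (use int that in \<open>auto intro!: indicator_measurable_cubeM\<close>)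
  have A: "A \<in> sigma_sets UNIV (range (\<lambda>(a, b). box a b :: (real^'n) set))" using assms eq by simp
  have I: "Int_stable (range (\<lambda>(a, b). box a b :: (real^'n) set))"
    by (auto simp: Int_stable_def box_Int_box)
  have P: "range (\<lambda>(a, b). box a b :: (real^'n) set) \<subseteq> Pow UNIV" by simp
  from I P A show ?thesis
  proof (induction rule: sigma_sets_induct_disjoint)
    case (basic A)
    then show ?case using integral_box_zero by auto
  next
    case (compl A)
    then have "A \<in> sets borel" using eq by simp
    then have "(LINT x|cubeM. indicator UNIV x * g x - indicator A x * g x)
        = (LINT x|cubeM. indicator UNIV x * g x) - (LINT x|cubeM. indicator A x * g x)"
      by (intro Bochner_Integration.integral_diff im) auto
    moreover have "(LINT x|cubeM. indicator UNIV x * g x) = 0"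
      using integral_trig_zero[OF trig_space_const[of 1 0]] by simp
    moreover have "indicator (UNIV - A) x * g x = indicator UNIV x * g x - indicator A x * g x" for x
      by (auto simp: indicator_def)
    ultimately show ?case using compl by simp
  next
    case (union A)
    have Ab: "A i \<in> sets borel" for i using union eq by auto
    then have UA: "\<Union>(range A) \<in> sets borel" by auto
    have "(\<lambda>n. LINT x|cubeM. indicator (\<Union>i<n. A i) x * g x) \<longlonglongrightarrow> (LINT x|cubeM. indicator (\<Union>(range A)) x * g x)"
    proof (rule integral_dominated_convergence[where w = "\<lambda>x. norm (g x)"])
      show "AE x in cubeM. (\<lambda>n. indicator (\<Union>i<n. A i) x * g x) \<longlonglongrightarrow> indicator (\<Union> (range A)) x * g x"
        by (intro AE_I2 tendsto_mult LIMSEQ_indicator_UN tendsto_const)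
      show "AE x in cubeM. norm (indicator (\<Union>i<n. A i) x * g x) \<le> norm (g x)" for n
        by (auto simp: indicator_def)
      show "(\<lambda>x. indicator (\<Union>(range A)) x * g x) \<in> borel_measurable cubeM"
        using im[OF UA] by auto
      show "(\<lambda>x. indicator (\<Union>i<n. A i) x * g x) \<in> borel_measurable cubeM" for n
        using im[of "\<Union>i<n. A i"] Ab by auto
    qed (use int in auto)
    moreover have "(LINT x|cubeM. indicator (\<Union>i<n. A i) x * g x) = 0" for n
    proof -
      have "indicator (\<Union>i<n. A i) x * g x = (\<Sum>i<n. indicator (A i) x * g x)" for x
        using union(1) by (subst indicator_UN_disjoint)
          (auto simp: sum_distrib_right disjoint_family_on_def)
      then have "(LINT x|cubeM. indicator (\<Union>i<n. A i) x * g x)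
          = (LINT x|cubeM. (\<Sum>i<n. indicator (A i) x * g x))"
        by presburger
      also have "\<dots> = 0"
        by (subst Bochner_Integration.integral_sum) (use union(3) im[OF Ab] in auto)
      finally show ?thesis .
    qed
    ultimately show ?case by (simp add: LIMSEQ_const_iff)
  qed (simp_all)
qed

lemma integral_lebesgue_zero:
  assumes "A \<in> sets lebesgue"
  shows "(LINT x|cubeM. indicator A x * g x) = 0"
proof -
  obtain C T T' where CT: "C \<in> sets borel" "T' \<in> null_sets lborel" "T \<subseteq> T'" "A = C \<union> T"
    using assms by (elim sets_completionE) auto
  have "(LINT x|cubeM. indicator A x * g x) = (LINT x|cubeM. indicator C x * g x)"
  proof (rule integral_cong_AE)
    have "AE x in lebesgue. x \<notin> T'"
      by (intro AE_completion AE_not_in CT(2))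
    then have "AE x in cubeM. x \<notin> T'"
      by (subst AE_restrict_space_iff) (auto elim: eventually_mono)
    then show "AE x in cubeM. indicator A x * g x = indicator C x * g x"
      by eventually_elim (use CT in \<open>auto simp: indicator_def\<close>)
  qed (use int CT assms in \<open>auto intro!: borel_measurable_times indicator_measurable_cubeM\<close>)
  then show ?thesis using integral_borel_zero[OF CT(1)] by simp
qed

text \<open>The integral over every measurable set vanishes, which forces the function to vanish
  almost everywhere. This completeness holds for integrable functions and is used twice: to identify
  f with its Fourier series, and to show that the correctors reach every moment vector.\<close>

lemma AE_zero_if_fourier_zero: "AE x in cubeM. g x = 0"
proof -
  have "(LINT x:A|cubeM. g x) = 0" if "A \<in> sets cubeM" for A
  proof -
    have "A \<in> sets lebesgue" using that by (simp add: sets_restrict_space_iff)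
    from integral_lebesgue_zero[OF this] show ?thesis by (simp add: set_lebesgue_integral_def)
  qed
  then show ?thesis
    by (intro cubeM.density_zero int)
qed

end


subsection \<open>Parseval and Bessel\<close>

lemma L2_integrable: "f \<in> L2 \<Longrightarrow> integrable cubeM f"
proof (rule Bochner_Integration.integrable_bound)
  assume "f \<in> L2"
  then show "integrable cubeM (\<lambda>x. 1 + (f x)\<^sup>2)" "f \<in> borel_measurable cubeM"
    by (auto simp: L2_def)
  show "AE x in cubeM. norm (f x) \<le> norm (1 + (f x)\<^sup>2)"
  proof (rule AE_I2)
    fix x
    have "0 \<le> (\<bar>f x\<bar> - 1)\<^sup>2" by simp
    then have "2 * \<bar>f x\<bar> \<le> 1 + (f x)\<^sup>2" by (simp add: power2_diff)
    then show "norm (f x) \<le> norm (1 + (f x)\<^sup>2)" by simp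
  qed
qed

lemma L2I_continuous: "continuous_on UNIV f \<Longrightarrow> f \<in> L2"
  unfolding L2_def
  by (auto intro!: meas_cubeM integrable_cube_continuous continuous_intros)

lemma integrable_mult_wave:
  "integrable cubeM f \<Longrightarrow> integrable cubeM (\<lambda>x. complex_of_real (f x) * wave k x)"
  using integrable_cube_mult_bounded[of "\<lambda>x. complex_of_real (f x)" "wave k" 1]
  by (simp add: mult.commute)

lemma integral_wave_coeff:
  "(LINT x|cubeM. complex_of_real (f x) * wave (- k) x) = (2 * pi) ^ CARD('n) * fourier_coeff f k"
  for k :: "int^'n"
  by (simp add: fourier_coeff_def)

lemma parseval_finite:
  fixes c :: "int^'n \<Rightarrow> complex"
  assumes "finite S"
  shows "(LINT x|cubeM. (cmod (\<Sum>k\<in>S. c k * wave k x))\<^sup>2) = (2 * pi) ^ CARD('n) * (\<Sum>k\<in>S. (cmod (c k))\<^sup>2)"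
proof -
  have e: "complex_of_real ((cmod (\<Sum>k\<in>S. c k * wave k x))\<^sup>2)
      = (\<Sum>k\<in>S. \<Sum>l\<in>S. (c k * cnj (c l)) * wave (k - l) x)" for x
  proof -
    have "complex_of_real ((cmod (\<Sum>k\<in>S. c k * wave k x))\<^sup>2)
        = (\<Sum>k\<in>S. c k * wave k x) * (\<Sum>l\<in>S. cnj (c l) * wave (- l) x)"
      by (simp only: complex_norm_square) (simp add: cnj_wave)
    also have "\<dots> = (\<Sum>k\<in>S. \<Sum>l\<in>S. (c k * cnj (c l)) * wave (k - l) x)"
      unfolding sum_product
      by (intro sum.cong refl) (simp add: wave_add[of _ "- _", simplified] mult_ac)
    finally show ?thesis .
  qed
  have i: "integrable cubeM (\<lambda>x. a * wave k x)" for a and k :: "int^'n"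
    by (intro integrable_cube_continuous continuous_intros)
  have "complex_of_real (LINT x|cubeM. (cmod (\<Sum>k\<in>S. c k * wave k x))\<^sup>2)
      = (LINT x|cubeM. (\<Sum>k\<in>S. \<Sum>l\<in>S. (c k * cnj (c l)) * wave (k - l) x))"
    unfolding e[symmetric] by (rule integral_complex_of_real[symmetric])
  also have "\<dots> = (\<Sum>k\<in>S. \<Sum>l\<in>S. (c k * cnj (c l)) * (LINT x|cubeM. wave (k - l) x))"
    by (simp add: Bochner_Integration.integral_sum i)
  also have "\<dots> = (\<Sum>k\<in>S. \<Sum>l\<in>S. if l = k then (c k * cnj (c l)) * (2 * pi) ^ CARD('n) else 0)"
    by (intro sum.cong refl) (auto simp: integral_wave)
  also have "\<dots> = complex_of_real ((2 * pi) ^ CARD('n) * (\<Sum>k\<in>S. (cmod (c k))\<^sup>2))"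
    using assms by (simp add: sum_distrib_left complex_norm_square[symmetric] mult_ac)
  finally show ?thesis using of_real_eq_iff by blast
qed

lemma bessel:
  fixes f :: "real^'n \<Rightarrow> real"
  assumes f: "f \<in> L2" and S: "finite S"
  shows "(2 * pi) ^ CARD('n) * (\<Sum>k\<in>S. (cmod (fourier_coeff f k))\<^sup>2) \<le> (LINT x|cubeM. (f x)\<^sup>2)"
proof -
  let ?c = "fourier_coeff f"
  let ?p = "(2 * pi) ^ CARD('n)"
  let ?s = "\<lambda>x. \<Sum>k\<in>S. ?c k * wave k x"
  have fi: "integrable cubeM f" by (rule L2_integrable[OF f])
  have i1: "integrable cubeM (\<lambda>x. (f x)\<^sup>2)" using f by (simp add: L2_def)
  have i2: "integrable cubeM (\<lambda>x. (cmod (?s x))\<^sup>2)"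
    by (intro integrable_cube_continuous continuous_intros)
  have e3: "complex_of_real (f x) * cnj (?s x) = (\<Sum>k\<in>S. cnj (?c k) * (complex_of_real (f x) * wave (- k) x))" for x
    by (simp add: sum_distrib_left cnj_wave mult_ac)
  have i3: "integrable cubeM (\<lambda>x. complex_of_real (f x) * cnj (?s x))"
    unfolding e3 by (intro Bochner_Integration.integrable_sum integrable_mult_right integrable_mult_wave fi)
  have "(LINT x|cubeM. complex_of_real (f x) * cnj (?s x)) = (\<Sum>k\<in>S. cnj (?c k) * (?p * ?c k))"
    unfolding e3 by (simp add: Bochner_Integration.integral_sum integrable_mult_wave fi integral_wave_coeff)
  also have "\<dots> = complex_of_real (?p * (\<Sum>k\<in>S. (cmod (?c k))\<^sup>2))"
  proof -
    have "cnj z * (?p * z) = complex_of_real (?p * (cmod z)\<^sup>2)" for z :: complex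
      using complex_norm_square[of z] by (simp add: mult_ac)
    then show ?thesis by (simp only: sum_distrib_left of_real_sum)
  qed
  finally have I3: "(LINT x|cubeM. Re (complex_of_real (f x) * cnj (?s x))) = ?p * (\<Sum>k\<in>S. (cmod (?c k))\<^sup>2)"
    using integral_Re[OF i3] by (metis Re_complex_of_real)
  have "0 \<le> (LINT x|cubeM. (cmod (complex_of_real (f x) - ?s x))\<^sup>2)" by simp
  also have "\<dots> = (LINT x|cubeM. (f x)\<^sup>2 + (cmod (?s x))\<^sup>2 - 2 * Re (complex_of_real (f x) * cnj (?s x)))"
  proof (rule Bochner_Integration.integral_cong[OF refl])
    fix x
    have "(cmod (complex_of_real a - z))\<^sup>2 = a\<^sup>2 + (cmod z)\<^sup>2 - 2 * Re (complex_of_real a * cnj z)" for a z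
      unfolding cmod_power2 by (simp add: power2_eq_square algebra_simps)
    then show "(cmod (complex_of_real (f x) - ?s x))\<^sup>2 = (f x)\<^sup>2 + (cmod (?s x))\<^sup>2 - 2 * Re (complex_of_real (f x) * cnj (?s x))"
      by blast
  qed
  also have "\<dots> = (LINT x|cubeM. (f x)\<^sup>2) + (LINT x|cubeM. (cmod (?s x))\<^sup>2)
      - 2 * (LINT x|cubeM. Re (complex_of_real (f x) * cnj (?s x)))"
  proof -
    have "integrable cubeM (\<lambda>x. Re (complex_of_real (f x) * cnj (?s x)))"
      using i3 by (rule integrable_Re)
    then show ?thesis using i1 i2 by simp
  qed
  also have "\<dots> = (LINT x|cubeM. (f x)\<^sup>2) - ?p * (\<Sum>k\<in>S. (cmod (?c k))\<^sup>2)"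
    unfolding I3 parseval_finite[OF S] by simp
  finally show ?thesis by simp
qed

subsection \<open>Fourier coefficients of weak derivatives\<close>

text \<open>Weak derivatives are tested with real functions only, so the real and imaginary parts of
  an exponential are both written as shifted cosines. A partial derivative then merely multiplies by
  a component of k and shifts the phase by pi / 2, which keeps iterated derivatives in closed
  form.\<close>

definition phase :: "int^'n \<Rightarrow> real \<Rightarrow> real^'n \<Rightarrow> real" where
  "phase k a x = cos ((\<Sum>i\<in>UNIV. real_of_int (k $ i) * x $ i) + a)"

lemma phase_wave: "phase k a x = Re (cis a * wave k x)"
  unfolding phase_def by (rule cos_wave)

lemma has_derivative_phase:
  fixes k :: "int^'n"
  shows "((\<lambda>x. C * phase k a x) has_derivative
     (\<lambda>h. C * phase k (a + pi / 2) x * (\<Sum>i\<in>UNIV. real_of_int (k $ i) * h $ i))) (at x)"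
proof -
  have l: "bounded_linear (\<lambda>h :: real^'n. \<Sum>i\<in>UNIV. real_of_int (k $ i) * h $ i)"
    by (intro bounded_linear_sum bounded_linear_const_mult bounded_linear_vec_nth)
  have s: "cos (t + (a + pi / 2)) = - sin (t + a)" for t
    by (simp add: add.assoc[symmetric] cos_add)
  show ?thesis
    unfolding phase_def s
    by (rule derivative_eq_intros refl bounded_linear.has_derivative[OF l] has_derivative_ident)+
       (simp add: mult_ac)
qed

lemma partials_phase:
  "partials js (phase k a) = (\<lambda>x. prod_list (map (\<lambda>j. real_of_int (k $ j)) js) * phase k (a + real (length js) * (pi / 2)) x)"
proof (induction js)
  case Nil
  then show ?case by (simp add: partials_def)
next
  case (Cons j js)
  let ?P = "prod_list (map (\<lambda>j. real_of_int (k $ j)) js)"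
  let ?b = "a + real (length js) * (pi / 2)"
  have "partials (j # js) (phase k a) = partial j (\<lambda>x. ?P * phase k ?b x)"
    using Cons by (simp add: partials_def)
  also have "\<dots> = (\<lambda>x. real_of_int (k $ j) * ?P * phase k (?b + pi / 2) x)"
  proof
    fix x
    have "(\<Sum>i\<in>UNIV. real_of_int (k $ i) * (axis j (1::real)) $ i) = real_of_int (k $ j)"
      by (simp add: axis_def if_distrib[of "\<lambda>a. _ * a"] cong: if_cong)
    then show "partial j (\<lambda>x. ?P * phase k ?b x) x = real_of_int (k $ j) * ?P * phase k (?b + pi / 2) x"
      unfolding partial_def
      by (subst frechet_derivative_at[OF has_derivative_phase, symmetric]) (simp add: mult_ac)
  qed
  also have "?b + pi / 2 = a + real (length (j # js)) * (pi / 2)" by (simp add: algebra_simps add_divide_distrib)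
  finally show ?case by simp
qed

lemma smooth_phase: "smooth (phase k a)"
  unfolding smooth_def partials_phase using has_derivative_phase differentiableI by blast

lemma periodic_phase: "periodic (phase k a)"
  unfolding periodic_def
proof (intro allI)
  fix x i
  have "(\<Sum>j\<in>UNIV. real_of_int (k $ j) * (x + axis i (2 * pi)) $ j) + a
      = ((\<Sum>j\<in>UNIV. real_of_int (k $ j) * x $ j) + a) + 2 * pi * real_of_int (k $ i)"
    by (simp add: axis_def algebra_simps sum.distrib if_distrib[of "\<lambda>a. _ * a"] cong: if_cong)
  then show "phase k a (x + axis i (2 * pi)) = phase k a x"
    unfolding phase_def by (simp only: cos_add sin_int_2pin cos_int_2pin) simp
qed

lemma integral_phase:
  assumes "integrable cubeM f"
  shows "(LINT x|cubeM. f x * phase k a x) = Re (cis a * (LINT x|cubeM. complex_of_real (f x) * wave k x))"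
proof -
  have i: "integrable cubeM (\<lambda>x. cis a * (complex_of_real (f x) * wave k x))"
    using integrable_mult_wave[OF assms] by (rule integrable_mult_right)
  have "(LINT x|cubeM. f x * phase k a x) = (LINT x|cubeM. Re (cis a * (complex_of_real (f x) * wave k x)))"
    by (rule Bochner_Integration.integral_cong[OF refl]) (simp add: phase_wave algebra_simps)
  also have "\<dots> = Re (LINT x|cubeM. cis a * (complex_of_real (f x) * wave k x))"
    by (rule integral_Re[OF i])
  finally show ?thesis by simp
qed

text \<open>Testing with \<open>phase (- k) a\<close> gives the identity \<open>key\<close> between
  real parts for every shift a. The shifts 0 and - pi / 2 recover the real and the imaginary part of
  a complex identity, in which the r-fold phase shift is a unimodular factor that disappears under
  the modulus. The test list for the multi-index \<open>axis i r\<close> is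
  \<open>replicate r i\<close>.\<close>

lemma weak_deriv_fourier:
  fixes f :: "real^'n \<Rightarrow> real"
  assumes f: "f \<in> L2" and w: "weak_deriv_of (axis i r) f g"
  shows "cmod (fourier_coeff g k) = \<bar>real_of_int (k $ i)\<bar> ^ r * cmod (fourier_coeff f k)"
proof -
  have fi: "integrable cubeM f" by (rule L2_integrable[OF f])
  have gi: "integrable cubeM g" using w by (intro L2_integrable) (simp add: weak_deriv_of_def)
  have ord: "mi_order (axis i r) = r"
    by (simp add: mi_order_def axis_def)
  have cnt: "count_list (replicate n i) j = (axis i n) $ j" for n j
    by (induction n) (auto simp: axis_def)
  define J where "J h = (LINT x|cubeM. complex_of_real (h x) * wave (- k) x)" for h
  define R where "R = real_of_int ((- k) $ i) ^ r"
  have key: "R * Re (cis (a + real r * (pi / 2)) * J f) = (- 1) ^ r * Re (cis a * J g)" for a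
  proof -
    have "(LINT x|cubeM. f x * partials (replicate r i) (phase (- k) a) x)
        = (- 1) ^ r * (LINT x|cubeM. g x * phase (- k) a x)"
      using w smooth_phase periodic_phase cnt unfolding weak_deriv_of_def ord by blast
    moreover have "(LINT x|cubeM. f x * partials (replicate r i) (phase (- k) a) x)
        = R * (LINT x|cubeM. f x * phase (- k) (a + real r * (pi / 2)) x)"
      unfolding partials_phase R_def
      by (subst integral_mult_right_zero[symmetric]) (simp add: mult_ac prod_list_replicate)
    ultimately show ?thesis
      unfolding integral_phase[OF fi] integral_phase[OF gi] J_def by simp
  qed
  have "complex_of_real R * (cis (real r * (pi / 2)) * J f) = (- 1) ^ r * J g" (is "?z = ?w")
  proof (rule complex_eqI)
    show "Re ?z = Re ?w"
      using key[of 0] by (cases "even r") simp_all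
    have "cis (- pi / 2 + real r * (pi / 2)) = - \<i> * cis (real r * (pi / 2))"
      by (simp add: complex_eq_iff cos_diff sin_diff)
    moreover have "cis (- pi / 2) = - \<i>" by (simp add: complex_eq_iff)
    ultimately have "R * Re (- \<i> * cis (real r * (pi / 2)) * J f) = (- 1) ^ r * Re (- \<i> * J g)"
      using key[of "- pi / 2"] by simp
    then show "Im ?z = Im ?w"
      by (cases "even r") simp_all
  qed
  then have "cmod ?z = cmod ?w" by simp
  then have "\<bar>R\<bar> * cmod (J f) = cmod (J g)" by (simp add: norm_mult norm_power)
  then show ?thesis
    by (simp add: fourier_coeff_def J_def[symmetric] norm_divide R_def power_abs)
qed

text \<open>Only the pure derivatives of order r enter the estimates.\<close>

definition wgt :: "nat \<Rightarrow> int^'n \<Rightarrow> real" where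
  "wgt r k = (\<Sum>i\<in>UNIV. real_of_int (k $ i) ^ (2 * r))"

lemma wgt_ge: "real_of_int (k $ i) ^ (2 * r) \<le> wgt r k"
  unfolding wgt_def by (rule member_le_sum) auto

lemma wgt_nonneg: "0 \<le> wgt r k"
  unfolding wgt_def by (intro sum_nonneg) simp

lemma wgt_ge_1: "k \<noteq> 0 \<Longrightarrow> 1 \<le> wgt r k"
proof -
  assume "k \<noteq> 0"
  then obtain i where "k $ i \<noteq> 0" by (auto simp: vec_eq_iff)
  then have "1 \<le> \<bar>real_of_int (k $ i)\<bar>" by linarith
  then have "1 \<le> \<bar>real_of_int (k $ i)\<bar> ^ (2 * r)" by (rule one_le_power)
  then show ?thesis using wgt_ge[of k i r] by (simp add: power_even_abs)
qed

text \<open>The weight is a sum over directions, and each direction contributes the squared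
  coefficients of one pure derivative of order r, to which Bessel's inequality applies.\<close>

lemma Hp_weighted_bound:
  fixes f :: "real^'n \<Rightarrow> real"
  assumes "f \<in> Hp r"
  obtains B where "\<And>S. finite S \<Longrightarrow> (\<Sum>k\<in>S. wgt r k * (cmod (fourier_coeff f k))\<^sup>2) \<le> B"
proof -
  have f: "f \<in> L2" using assms by (simp add: Hp_def)
  have "\<exists>g. weak_deriv_of (axis i r) f g" for i
    using assms by (simp add: Hp_def mi_order_def axis_def)
  then obtain g where g: "\<And>i. weak_deriv_of (axis i r) f (g i)" by metis
  define B where "B = (\<Sum>i\<in>UNIV. (LINT x|cubeM. (g i x)\<^sup>2) / (2 * pi) ^ CARD('n))"
  show ?thesis
  proof (rule that[of B])
    fix S :: "(int^'n) set" assume S: "finite S"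
    have "(\<Sum>k\<in>S. wgt r k * (cmod (fourier_coeff f k))\<^sup>2)
        = (\<Sum>i\<in>UNIV. \<Sum>k\<in>S. (cmod (fourier_coeff (g i) k))\<^sup>2)"
      unfolding wgt_def sum_distrib_right weak_deriv_fourier[OF f g]
      by (subst sum.swap) (simp add: power_mult_distrib power_mult[symmetric] mult.commute[of r] power_even_abs)
    also have "\<dots> \<le> B"
      unfolding B_def
    proof (rule sum_mono)
      fix i
      have "g i \<in> L2" using g by (simp add: weak_deriv_of_def)
      from bessel[OF this S]
      show "(\<Sum>k\<in>S. (cmod (fourier_coeff (g i) k))\<^sup>2) \<le> (LINT x|cubeM. (g i x)\<^sup>2) / (2 * pi) ^ CARD('n)"
        by (simp add: field_simps)
    qed
    finally show "(\<Sum>k\<in>S. wgt r k * (cmod (fourier_coeff f k))\<^sup>2) \<le> B" .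
  qed
qed

section \<open>Summability of the inverse weights and of the coefficients\<close>

lemma finite_subset_freqs: "finite S \<Longrightarrow> \<exists>N. S \<subseteq> freqs N"
proof (induction S rule: finite_induct)
  case (insert k S)
  then obtain N N' where "S \<subseteq> freqs N" "k \<in> freqs N'" using freqs_exists by blast
  then have "insert k S \<subseteq> freqs (max N N')"
    using freqs_mono[of N "max N N'"] freqs_mono[of N' "max N N'"] by auto
  then show ?case by blast
qed simp

lemma sum_freqs_prod:
  fixes h :: "int \<Rightarrow> real"
  shows "(\<Sum>l\<in>(freqs n :: (int^'n) set). \<Prod>i\<in>UNIV. h (l $ i)) = (\<Sum>j\<in>{- int n..int n}. h j) ^ CARD('n)"
proof -
  have "(\<Sum>j\<in>{- int n..int n}. h j) ^ CARD('n) = (\<Prod>i\<in>(UNIV::'n set). \<Sum>j\<in>{- int n..int n}. h j)"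
    by simp
  also have "\<dots> = (\<Sum>g\<in>PiE UNIV (\<lambda>_. {- int n..int n}). \<Prod>i\<in>(UNIV::'n set). h (g i))"
    by (rule prod_sum_PiE) auto
  also have "\<dots> = (\<Sum>l\<in>freqs n. \<Prod>i\<in>(UNIV::'n set). h (l $ i))"
    by (rule sum.reindex_bij_witness[where i = vec_nth and j = vec_lambda])
       (auto simp: freqs_def PiE_def Pi_def)
  finally show ?thesis by simp
qed

lemma sum_powr_bound:
  assumes "s > 1"
  obtains A where "\<And>n. (\<Sum>j\<in>{- int n..int n}. (1 + \<bar>real_of_int j\<bar>) powr - s) \<le> A"
proof -
  have "summable (\<lambda>i. real i powr - s)"
    using assms summable_real_powr_iff[of "- s"] by simp
  then have s: "summable (\<lambda>i. real (Suc i) powr - s)"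
    by (subst summable_Suc_iff)
  define A where "A = 2 * (\<Sum>i. real (Suc i) powr - s)"
  show ?thesis
  proof (rule that[of A])
    fix n
    let ?h = "\<lambda>j. (1 + \<bar>real_of_int j\<bar>) powr - s"
    have "(\<Sum>j\<in>{- int n..int n}. ?h j) \<le> (\<Sum>j\<in>(\<lambda>i. - int i) ` {..n} \<union> int ` {..n}. ?h j)"
    proof (rule sum_mono2)
      show "{- int n..int n} \<subseteq> (\<lambda>i. - int i) ` {..n} \<union> int ` {..n}"
      proof
        fix j assume "j \<in> {- int n..int n}"
        then have "(j \<ge> 0 \<and> j = int (nat j) \<and> nat j \<le> n) \<or> (j = - int (nat (- j)) \<and> nat (- j) \<le> n)"
          by auto
        then show "j \<in> (\<lambda>i. - int i) ` {..n} \<union> int ` {..n}" by blast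
      qed
    qed auto
    also have "\<dots> \<le> (\<Sum>j\<in>(\<lambda>i. - int i) ` {..n}. ?h j) + (\<Sum>j\<in>int ` {..n}. ?h j)"
      by (subst sum_Un) (auto intro!: sum_nonneg)
    also have "\<dots> = 2 * (\<Sum>i\<le>n. real (Suc i) powr - s)"
      by (simp add: sum.reindex inj_on_def)
    also have "\<dots> \<le> A"
      unfolding A_def using sum_le_suminf[OF s, of "{..n}"] by auto
    finally show "(\<Sum>j\<in>{- int n..int n}. ?h j) \<le> A" .
  qed
qed

text \<open>The exponent s is chosen so that d factors of power s together have power 2 r. With m
  the largest |l_i|, at least 1, the product of the (1 + |l_i|)^s is at most (1 + m)^(2 r), hence at
  most (2 m)^(2 r), and m^(2 r) is one of the summands of the weight. The product form reduces the
  lattice sum to one dimension.\<close>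

lemma inverse_wgt_le:
  fixes l :: "int^'n"
  assumes l: "l \<noteq> 0" and s: "s = 2 * real r / real CARD('n)"
  shows "1 / wgt r l \<le> 4 ^ r * (\<Prod>i\<in>UNIV. (1 + \<bar>real_of_int (l $ i)\<bar>) powr - s)"
proof -
  define m where "m = Max (range (\<lambda>i. \<bar>real_of_int (l $ i)\<bar>))"
  have le: "\<bar>real_of_int (l $ i)\<bar> \<le> m" for i unfolding m_def by (intro Max_ge) auto
  have "m \<in> range (\<lambda>i. \<bar>real_of_int (l $ i)\<bar>)" unfolding m_def by (intro Max_in) auto
  then obtain i0 where i0: "m = \<bar>real_of_int (l $ i0)\<bar>" by auto
  obtain i where "l $ i \<noteq> 0" using l by (auto simp: vec_eq_iff)
  then have "1 \<le> \<bar>real_of_int (l $ i)\<bar>" by linarith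
  then have m1: "1 \<le> m" using le[of i] by simp
  have s0: "s \<ge> 0" by (simp add: s)
  have "(\<Prod>i\<in>UNIV. (1 + \<bar>real_of_int (l $ i)\<bar>) powr s) \<le> (\<Prod>i\<in>(UNIV::'n set). (1 + m) powr s)"
    using le s0 by (intro prod_mono conjI powr_mono2) auto
  also have "\<dots> = (1 + m) powr (s * real CARD('n))"
    using m1 by (simp add: powr_powr[symmetric] powr_realpow)
  also have "s * real CARD('n) = real (2 * r)" by (simp add: s)
  also have "(1 + m) powr real (2 * r) = (1 + m) ^ (2 * r)"
    using m1 by (intro powr_realpow) auto
  also have "\<dots> \<le> (2 * m) ^ (2 * r)" using m1 by (intro power_mono) auto
  also have "\<dots> = 4 ^ r * m ^ (2 * r)" by (simp add: power_mult_distrib power_mult)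
  also have "m ^ (2 * r) \<le> wgt r l" using wgt_ge[of l i0 r] by (simp add: i0 power_even_abs)
  finally have le': "(\<Prod>i\<in>UNIV. (1 + \<bar>real_of_int (l $ i)\<bar>) powr s) \<le> 4 ^ r * wgt r l" by simp
  have pos: "(\<Prod>i\<in>UNIV. (1 + \<bar>real_of_int (l $ i)\<bar>) powr s) > 0" by (intro prod_pos) auto
  have "(\<Prod>i\<in>UNIV. (1 + \<bar>real_of_int (l $ i)\<bar>) powr - s) = 1 / (\<Prod>i\<in>UNIV. (1 + \<bar>real_of_int (l $ i)\<bar>) powr s)"
    by (simp add: powr_minus_divide prod_dividef)
  then show ?thesis using le' pos wgt_ge_1[OF l, of r] by (simp add: field_simps)
qed

text \<open>The condition r > d/2 says exactly that the one-dimensional exponent s exceeds 1; the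
  sum over a frequency cube is then bounded by the d-th power of a convergent one-dimensional
  sum.\<close>

lemma inverse_wgt_summable:
  assumes "real r > real CARD('n) / 2"
  obtains Z where "\<And>S :: (int^'n) set. finite S \<Longrightarrow> 0 \<notin> S \<Longrightarrow> (\<Sum>l\<in>S. 1 / wgt r l) \<le> Z"
proof -
  define s where "s = 2 * real r / real CARD('n)"
  have "s > 1" using assms by (simp add: s_def field_simps)
  then obtain A where A: "\<And>n. (\<Sum>j\<in>{- int n..int n}. (1 + \<bar>real_of_int j\<bar>) powr - s) \<le> A"
    using sum_powr_bound by metis
  show ?thesis
  proof (rule that[of "4 ^ r * A ^ CARD('n)"])
    fix S :: "(int^'n) set" assume S: "finite S" "0 \<notin> S"
    obtain n where n: "S \<subseteq> freqs n" using finite_subset_freqs S by blast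
    have "(\<Sum>l\<in>S. 1 / wgt r l) \<le> (\<Sum>l\<in>S. 4 ^ r * (\<Prod>i\<in>UNIV. (1 + \<bar>real_of_int (l $ i)\<bar>) powr - s))"
      using S by (intro sum_mono inverse_wgt_le s_def) auto
    also have "\<dots> \<le> (\<Sum>l\<in>(freqs n :: (int^'n) set). 4 ^ r * (\<Prod>i\<in>UNIV. (1 + \<bar>real_of_int (l $ i)\<bar>) powr - s))"
      by (intro sum_mono2) (use n in \<open>auto simp: finite_freqs intro!: mult_nonneg_nonneg prod_nonneg\<close>)
    also have "\<dots> = 4 ^ r * (\<Sum>j\<in>{- int n..int n}. (1 + \<bar>real_of_int j\<bar>) powr - s) ^ CARD('n)"
      by (simp only: sum_distrib_left[symmetric]
          sum_freqs_prod[where h = "\<lambda>j. (1 + \<bar>real_of_int j\<bar>) powr - s"])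
    also have "\<dots> \<le> 4 ^ r * A ^ CARD('n)"
      using A by (intro mult_left_mono power_mono sum_nonneg) auto
    finally show "(\<Sum>l\<in>S. 1 / wgt r l) \<le> 4 ^ r * A ^ CARD('n)" .
  qed
qed

text \<open>Each term with k nonzero is split by the elementary inequality t \<le> w t^2 + 1 / w,
  which trades Cauchy-Schwarz for two separately bounded sums. The zero frequency is set aside
  because the bound Z excludes it.\<close>

lemma abs_summable_coeffs:
  fixes a :: "int^'n \<Rightarrow> complex"
  assumes B: "\<And>S. finite S \<Longrightarrow> (\<Sum>k\<in>S. wgt r k * (cmod (a k))\<^sup>2) \<le> B"
    and Z: "\<And>S :: (int^'n) set. finite S \<Longrightarrow> 0 \<notin> S \<Longrightarrow> (\<Sum>l\<in>S. 1 / wgt r l) \<le> Z"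
  shows "(\<lambda>k. cmod (a k)) summable_on UNIV"
proof (rule nonneg_bdd_above_summable_on)
  show "bdd_above (sum (\<lambda>k. cmod (a k)) ` {F. F \<subseteq> UNIV \<and> finite F})"
  proof (rule bdd_aboveI2)
    fix F :: "(int^'n) set" assume "F \<in> {F. F \<subseteq> UNIV \<and> finite F}"
    then have F: "finite F" by simp
    have "(\<Sum>k\<in>F. cmod (a k)) \<le> (\<Sum>k\<in>insert 0 (F - {0}). cmod (a k))"
      using F by (intro sum_mono2) auto
    also have "\<dots> = cmod (a 0) + (\<Sum>k\<in>F - {0}. cmod (a k))"
      by (rule sum.insert) (use F in auto)
    also have "(\<Sum>k\<in>F - {0}. cmod (a k)) \<le> (\<Sum>k\<in>F - {0}. wgt r k * (cmod (a k))\<^sup>2 + 1 / wgt r k)"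
    proof (rule sum_mono)
      fix k assume "k \<in> F - {0}"
      then have w: "wgt r k \<ge> 1" using wgt_ge_1 by auto
      have "0 \<le> (wgt r k * cmod (a k) - 1)\<^sup>2" by simp
      then have "2 * wgt r k * cmod (a k) \<le> (wgt r k)\<^sup>2 * (cmod (a k))\<^sup>2 + 1"
        by (simp add: power2_diff power_mult_distrib)
      moreover have "wgt r k * cmod (a k) \<ge> 0" using w by simp
      ultimately have "wgt r k * cmod (a k) \<le> (wgt r k)\<^sup>2 * (cmod (a k))\<^sup>2 + 1" by linarith
      then show "cmod (a k) \<le> wgt r k * (cmod (a k))\<^sup>2 + 1 / wgt r k"
        using w by (simp add: field_simps power2_eq_square)
    qed
    also have "\<dots> \<le> B + Z"
      unfolding sum.distrib using B[of "F - {0}"] Z[of "F - {0}"] F by (intro add_mono) auto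
    finally show "(\<Sum>k\<in>F. cmod (a k)) \<le> cmod (a 0) + (B + Z)" by simp
  qed
qed simp


subsection \<open>Aliasing\<close>

text \<open>Shifting by N before and after taking the remainder makes the residues symmetric, from
  -N to N, as the frequency cube requires.\<close>

definition red :: "nat \<Rightarrow> int^'n \<Rightarrow> int^'n" where
  "red N k = (\<chi> i. (k $ i + int N) mod (2 * int N + 1) - int N)"

definition quo :: "nat \<Rightarrow> int^'n \<Rightarrow> int^'n" where
  "quo N k = (\<chi> i. (k $ i + int N) div (2 * int N + 1))"

lemma red_quo: "k $ i = red N k $ i + (2 * int N + 1) * quo N k $ i"
  using mult_div_mod_eq[of "2 * int N + 1" "k $ i + int N"] unfolding red_def quo_def vec_lambda_beta
  by linarith

lemma red_bounds: "- int N \<le> red N k $ i" "red N k $ i \<le> int N"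
  using pos_mod_sign[of "2 * int N + 1" "k $ i + int N"] pos_mod_bound[of "2 * int N + 1" "k $ i + int N"]
  by (simp_all add: red_def)

lemma red_freqs: "red N k \<in> freqs N"
  using red_bounds by (auto simp: freqs_def)

lemma quo_freqs: "k \<in> freqs N \<Longrightarrow> quo N k = 0"
  by (auto simp: vec_eq_iff quo_def freqs_def add.commute[of _ "int N"] minus_le_iff intro!: div_pos_pos_trivial)
     (smt (verit))

lemma red_id: "k \<in> freqs N \<Longrightarrow> red N k = k"
  using quo_freqs[of k N] red_quo[of k _ N] by (simp add: vec_eq_iff)

lemma quo_0_freqs: "quo N k = 0 \<Longrightarrow> k \<in> freqs N"
proof -
  assume "quo N k = 0"
  then have "k = red N k" using red_quo[of k _ N] by (simp add: vec_eq_iff)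
  then show ?thesis using red_freqs by metis
qed

text \<open>Frequency components that differ by a multiple of 2 N + 1 produce, at points with
  coordinates 2 pi j_i / (2 N + 1), phases that differ by integer multiples of 2 pi.\<close>

lemma wave_red: "wave (red N k) (colloc N j) = wave k (colloc N j)"
  unfolding wave_prod
proof (rule prod.cong[OF refl])
  fix i
  have "real_of_int (k $ i) * colloc N j $ i
      = real_of_int (red N k $ i) * colloc N j $ i + 2 * pi * real_of_int (quo N k $ i * j $ i)"
    by (subst red_quo[of k i N]) (simp add: colloc_def field_simps)
  then have "cis (real_of_int (k $ i) * colloc N j $ i)
      = cis (real_of_int (red N k $ i) * colloc N j $ i) * cis (2 * pi * real_of_int (quo N k $ i * j $ i))"
    by (simp only: cis_mult)
  also have "cis (2 * pi * real_of_int (quo N k $ i * j $ i)) = 1"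
    by (rule cis_multiple_2pi) auto
  finally show "cis (real_of_int (red N k $ i) * colloc N j $ i) = cis (real_of_int (k $ i) * colloc N j $ i)"
    by simp
qed

text \<open>Where the quotient q is nonzero, the residue takes away at most N, so |k_i| is at least
  (2 N + 1) |q| - N and therefore at least N |q|. This extracts the rate N^(2 r) and leaves a weight
  in q alone, to be summed over quotients.\<close>

lemma wgt_quo: "real N ^ (2 * r) * wgt r (quo N k) \<le> wgt r k"
  unfolding wgt_def sum_distrib_left
proof (rule sum_mono)
  fix i
  define q where "q = quo N k $ i"
  have "int N * \<bar>q\<bar> \<le> \<bar>k $ i\<bar>"
  proof (cases "q = 0")
    case False
    have "\<bar>(2 * int N + 1) * q\<bar> - int N \<le> \<bar>k $ i\<bar>"
      using red_bounds[of N k i] red_quo[of k i N] by (auto simp: q_def)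
    moreover have "\<bar>(2 * int N + 1) * q\<bar> = (2 * int N + 1) * \<bar>q\<bar>" by (simp add: abs_mult)
    moreover have "int N * 1 \<le> int N * \<bar>q\<bar>" using False by (intro mult_left_mono) auto
    ultimately show ?thesis by (simp add: algebra_simps)
  qed simp
  then have "real_of_int (int N * \<bar>q\<bar>) \<le> real_of_int \<bar>k $ i\<bar>" by (simp only: of_int_le_iff)
  then have "(real N * \<bar>real_of_int q\<bar>) ^ (2 * r) \<le> \<bar>real_of_int (k $ i)\<bar> ^ (2 * r)"
    by (intro power_mono) auto
  then show "real N ^ (2 * r) * real_of_int (quo N k $ i) ^ (2 * r) \<le> real_of_int (k $ i) ^ (2 * r)"
    by (simp add: power_mult_distrib power_even_abs q_def)
qed

lemma sum_sq_le_wgt: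
  assumes "finite S" "\<And>k. k \<in> S \<Longrightarrow> w k > 0"
  shows "(cmod (\<Sum>k\<in>S. a k))\<^sup>2 \<le> (\<Sum>k\<in>S. 1 / w k) * (\<Sum>k\<in>S. w k * (cmod (a k))\<^sup>2)"
proof -
  have "(cmod (\<Sum>k\<in>S. a k))\<^sup>2 \<le> (\<Sum>k\<in>S. cmod (a k))\<^sup>2"
    by (intro power_mono norm_sum) auto
  also have "(\<Sum>k\<in>S. cmod (a k)) = (\<Sum>k\<in>S. (1 / sqrt (w k)) * (sqrt (w k) * cmod (a k)))"
    by (intro sum.cong refl) (use assms(2) in fastforce)
  also have "\<dots>\<^sup>2 \<le> (\<Sum>k\<in>S. (1 / sqrt (w k))\<^sup>2) * (\<Sum>k\<in>S. (sqrt (w k) * cmod (a k))\<^sup>2)"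
    by (rule Cauchy_Schwarz_ineq_sum)
  also have "\<dots> = (\<Sum>k\<in>S. 1 / w k) * (\<Sum>k\<in>S. w k * (cmod (a k))\<^sup>2)"
    using assms(2) by (simp add: power_divide power_mult_distrib less_imp_le cong: sum.cong)
  finally show ?thesis .
qed

text \<open>The terms outside the frequency cube count twice: once as they stand and once folded
  back into the cube, hence the leading factor 2 and the sum 1 + Z. The first part is small because
  every weight is at least N^(2 r). For the folded part, Parseval reduces to the coefficients
  \<open>b\<close>, each of which collects one residue class \<open>C\<close>; weighted
  Cauchy-Schwarz in that class costs the sum of the inverse weights, at most Z / N^(2 r).\<close>

lemma alias_finite:
  fixes a :: "int^'n \<Rightarrow> complex"
  assumes Z: "\<And>S :: (int^'n) set. finite S \<Longrightarrow> 0 \<notin> S \<Longrightarrow> (\<Sum>l\<in>S. 1 / wgt r l) \<le> Z"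
    and N: "N \<ge> 1" and S: "finite S" "S \<inter> freqs N = {}"
  shows "(LINT x|cubeM. (cmod (\<Sum>k\<in>S. a k * (wave k x - wave (red N k) x)))\<^sup>2)
    \<le> 2 * (2 * pi) ^ CARD('n) * (1 + Z) / real N ^ (2 * r) * (\<Sum>k\<in>S. wgt r k * (cmod (a k))\<^sup>2)"
proof -
  let ?p = "(2 * pi) ^ CARD('n)" and ?n = "real N ^ (2 * r)"
  let ?T = "\<Sum>k\<in>S. wgt r k * (cmod (a k))\<^sup>2"
  define C where "C \<kappa> = {k \<in> S. red N k = \<kappa>}" for \<kappa>
  define b where "b \<kappa> = (\<Sum>k\<in>C \<kappa>. a k)" for \<kappa>
  have n0: "?n > 0" using N by simp
  have notin: "quo N k \<noteq> 0" if "k \<in> S" for k using that S quo_0_freqs by blast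
  have w1: "wgt r k \<ge> 1" if "k \<in> S" for k
    using that S zero_freqs wgt_ge_1 by (metis IntI empty_iff)
  have wn: "?n \<le> wgt r k" if "k \<in> S" for k
  proof -
    have "?n * 1 \<le> ?n * wgt r (quo N k)" using wgt_ge_1[OF notin[OF that]] by (intro mult_left_mono) auto
    then show ?thesis using wgt_quo[of N r k] by simp
  qed
  have grp: "(\<Sum>k\<in>S. a k * wave (red N k) x) = (\<Sum>\<kappa>\<in>freqs N. b \<kappa> * wave \<kappa> x)" for x
  proof -
    have "(\<Sum>k\<in>S. a k * wave (red N k) x) = (\<Sum>\<kappa>\<in>freqs N. \<Sum>k\<in>{k \<in> S. red N k = \<kappa>}. a k * wave (red N k) x)"
      by (rule sum.group[symmetric]) (use S finite_freqs red_freqs in auto)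
    then show ?thesis by (simp add: b_def C_def sum_distrib_right)
  qed
  have i1: "integrable cubeM (\<lambda>x. (cmod (\<Sum>k\<in>S. a k * wave k x))\<^sup>2)"
    and i2: "integrable cubeM (\<lambda>x. (cmod (\<Sum>k\<in>freqs N. b k * wave k x))\<^sup>2)"
    and i3: "integrable cubeM (\<lambda>x. (cmod (\<Sum>k\<in>S. a k * (wave k x - wave (red N k) x)))\<^sup>2)"
    by (intro integrable_cube_continuous continuous_intros)+
  have "(LINT x|cubeM. (cmod (\<Sum>k\<in>S. a k * (wave k x - wave (red N k) x)))\<^sup>2)
      \<le> (LINT x|cubeM. 2 * (cmod (\<Sum>k\<in>S. a k * wave k x))\<^sup>2 + 2 * (cmod (\<Sum>k\<in>freqs N. b k * wave k x))\<^sup>2)"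
  proof (rule integral_mono)
    fix x
    have q: "(cmod (u - v))\<^sup>2 \<le> 2 * (cmod u)\<^sup>2 + 2 * (cmod v)\<^sup>2" for u v
    proof -
      have "(cmod (u - v))\<^sup>2 \<le> (cmod u + cmod v)\<^sup>2" by (intro power_mono norm_triangle_ineq4) auto
      also have "\<dots> \<le> 2 * (cmod u)\<^sup>2 + 2 * (cmod v)\<^sup>2"
        using zero_le_power2[of "cmod u - cmod v"] by (simp add: power2_sum power2_diff)
      finally show ?thesis .
    qed
    show "(cmod (\<Sum>k\<in>S. a k * (wave k x - wave (red N k) x)))\<^sup>2
       \<le> 2 * (cmod (\<Sum>k\<in>S. a k * wave k x))\<^sup>2 + 2 * (cmod (\<Sum>k\<in>freqs N. b k * wave k x))\<^sup>2"
      unfolding right_diff_distrib sum_subtractf grp by (rule q)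
  qed (use i1 i2 i3 in auto)
  also have "\<dots> = 2 * (?p * (\<Sum>k\<in>S. (cmod (a k))\<^sup>2)) + 2 * (?p * (\<Sum>\<kappa>\<in>freqs N. (cmod (b \<kappa>))\<^sup>2))"
    using i1 i2 by (simp add: parseval_finite S finite_freqs)
  also have "(\<Sum>k\<in>S. (cmod (a k))\<^sup>2) \<le> ?T / ?n"
    unfolding sum_divide_distrib
  proof (rule sum_mono)
    fix k assume "k \<in> S"
    from mult_right_mono[OF wn[OF this], of "(cmod (a k))\<^sup>2"]
    show "(cmod (a k))\<^sup>2 \<le> wgt r k * (cmod (a k))\<^sup>2 / ?n" using n0 by (simp add: field_simps)
  qed
  also have "(\<Sum>\<kappa>\<in>freqs N. (cmod (b \<kappa>))\<^sup>2) \<le> (\<Sum>\<kappa>\<in>freqs N. Z / ?n * (\<Sum>k\<in>C \<kappa>. wgt r k * (cmod (a k))\<^sup>2))"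
  proof (rule sum_mono)
    fix \<kappa>
    have fC: "finite (C \<kappa>)" using S by (simp add: C_def)
    have "(cmod (b \<kappa>))\<^sup>2 \<le> (\<Sum>k\<in>C \<kappa>. 1 / wgt r k) * (\<Sum>k\<in>C \<kappa>. wgt r k * (cmod (a k))\<^sup>2)"
      unfolding b_def by (rule sum_sq_le_wgt[OF fC]) (use w1 in \<open>force simp: C_def\<close>)
    also have "(\<Sum>k\<in>C \<kappa>. 1 / wgt r k) \<le> (\<Sum>k\<in>C \<kappa>. 1 / wgt r (quo N k) / ?n)"
    proof (rule sum_mono)
      fix k assume "k \<in> C \<kappa>"
      then have k: "k \<in> S" by (simp add: C_def)
      have "1 \<le> wgt r (quo N k)" using wgt_ge_1[OF notin[OF k]] .
      then show "1 / wgt r k \<le> 1 / wgt r (quo N k) / ?n"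
        using wgt_quo[of N r k] n0 by (simp add: frac_le mult.commute)
    qed
    also have "\<dots> = (\<Sum>l\<in>quo N ` C \<kappa>. 1 / wgt r l) / ?n"
    proof -
      \<comment> \<open>Residue and quotient together determine k, so within one residue class the
        quotients are distinct. They are also nonzero, so their inverse weights sum to at most
        Z.\<close>
      have "inj_on (quo N) (C \<kappa>)"
      proof (rule inj_onI)
        fix k l assume "k \<in> C \<kappa>" "l \<in> C \<kappa>" "quo N k = quo N l"
        then show "k = l" using red_quo[of k _ N] red_quo[of l _ N] by (simp add: C_def vec_eq_iff)
      qed
      then show ?thesis by (simp add: sum.reindex sum_divide_distrib)
    qed
    also have "\<dots> \<le> Z / ?n"
      using n0 fC notin by (intro divide_right_mono Z) (auto simp: C_def)
    finally show "(cmod (b \<kappa>))\<^sup>2 \<le> Z / ?n * (\<Sum>k\<in>C \<kappa>. wgt r k * (cmod (a k))\<^sup>2)"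
      by (simp add: mult_right_mono sum_nonneg wgt_nonneg)
  qed
  also have "\<dots> = Z / ?n * ?T"
    unfolding sum_distrib_left[symmetric] C_def
    by (subst sum.group) (use S finite_freqs red_freqs in auto)
  finally have "(LINT x|cubeM. (cmod (\<Sum>k\<in>S. a k * (wave k x - wave (red N k) x)))\<^sup>2)
      \<le> 2 * (?p * (?T / ?n)) + 2 * (?p * (Z / ?n * ?T))" by simp
  moreover have "2 * (p * (t / n)) + 2 * (p * (z / n * t)) = 2 * p * (1 + z) / n * t" for p t z n :: real
    by (cases "n = 0") (simp_all add: field_simps)
  ultimately show ?thesis by (simp only:)
qed

subsection \<open>Absolutely convergent Fourier series\<close>

definition fsum :: "(int^'n \<Rightarrow> complex) \<Rightarrow> real^'n \<Rightarrow> complex" where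
  "fsum a x = (\<Sum>\<^sub>\<infinity>k. a k * wave k x)"

text \<open>The trigonometric interpolant of the series: by \<open>wave_red\<close> both agree at the collocation points.\<close>

definition isum :: "nat \<Rightarrow> (int^'n \<Rightarrow> complex) \<Rightarrow> real^'n \<Rightarrow> complex" where
  "isum N a x = (\<Sum>\<^sub>\<infinity>k. a k * wave (red N k) x)"

text \<open>Lets unordered infinite sums be evaluated as limits along the growing frequency cubes,
  as dominated convergence needs sequences.\<close>

lemma filterlim_freqs: "filterlim freqs (finite_subsets_at_top UNIV) sequentially"
  unfolding filterlim_finite_subsets_at_top
proof (intro allI impI)
  fix S :: "(int^'n) set" assume "finite S \<and> S \<subseteq> UNIV"
  then obtain N where N: "S \<subseteq> freqs N" using finite_subset_freqs by blast
  show "\<forall>\<^sub>F n in sequentially. finite (freqs n :: (int^'n) set) \<and> S \<subseteq> freqs n \<and> freqs n \<subseteq> (UNIV :: (int^'n) set)"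
    using eventually_ge_at_top[of N]
    by eventually_elim (use N freqs_mono finite_freqs in blast)
qed

lemma has_sum_freqs: "(h has_sum s) UNIV \<Longrightarrow> (\<lambda>n. \<Sum>k\<in>freqs n. h k) \<longlonglongrightarrow> s"
  unfolding has_sum_def using filterlim_compose[OF _ filterlim_freqs, of "sum h" "nhds s"] by simp

text \<open>The source of every little o below: applied to the weighted squares it improves the
  order of the error, applied to the moduli it gives uniform convergence.\<close>

lemma infsum_tail:
  fixes h :: "int^'n \<Rightarrow> real"
  assumes "h summable_on UNIV"
  shows "(\<lambda>n. infsum h (- freqs n)) \<longlonglongrightarrow> 0"
proof -
  have s: "h summable_on X" for X using summable_on_subset_banach[OF assms] by simp
  have e: "infsum h (- freqs n) = infsum h UNIV - (\<Sum>k\<in>freqs n. h k)" for n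
  proof -
    have "infsum h (freqs n \<union> - freqs n) = infsum h (freqs n) + infsum h (- freqs n)"
      by (rule infsum_Un_disjoint) (use s in auto)
    then show ?thesis by (simp add: finite_freqs)
  qed
  have "(\<lambda>n. \<Sum>k\<in>freqs n. h k) \<longlonglongrightarrow> infsum h UNIV"
    by (intro has_sum_freqs has_sum_infsum assms)
  from tendsto_diff[OF tendsto_const[of "infsum h UNIV"] this] show ?thesis unfolding e by simp
qed

lemma has_sum_finite_sum:
  fixes f :: "'i \<Rightarrow> 'a \<Rightarrow> 'b::topological_comm_monoid_add"
  assumes "\<And>i. i \<in> I \<Longrightarrow> (f i has_sum s i) A"
  shows "((\<lambda>x. \<Sum>i\<in>I. f i x) has_sum (\<Sum>i\<in>I. s i)) A"
  using assms by (induction I rule: infinite_finite_induct) (auto intro: has_sum_add)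

context
  fixes a :: "int^'n \<Rightarrow> complex"
  assumes asum: "(\<lambda>k. cmod (a k)) summable_on UNIV"
begin

lemma asum_subset: "(\<lambda>k. cmod (a k)) summable_on X"
  using summable_on_subset_banach[OF asum] by simp

text \<open>The map \<sigma> is left arbitrary so that one statement serves both the series itself
  and, with \<open>red N\<close>, its interpolant.\<close>

lemma summable_fsum: "(\<lambda>k. a k * wave (\<sigma> k) x) summable_on X"
  by (rule abs_summable_summable) (use asum_subset in \<open>simp add: norm_mult\<close>)

lemma fsum_limit: "(\<lambda>n. \<Sum>k\<in>freqs n. a k * wave k x) \<longlonglongrightarrow> fsum a x"
  unfolding fsum_def by (intro has_sum_freqs has_sum_infsum summable_fsum)

lemma isum_limit: "(\<lambda>n. \<Sum>k\<in>freqs n. a k * wave (red N k) x) \<longlonglongrightarrow> isum N a x"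
  unfolding isum_def by (intro has_sum_freqs has_sum_infsum summable_fsum)

lemma partial_fsum_error:
  "cmod (fsum a x - (\<Sum>k\<in>freqs n. a k * wave k x)) \<le> (\<Sum>\<^sub>\<infinity>k\<in>- freqs n. cmod (a k))"
proof -
  have "infsum (\<lambda>k. a k * wave k x) (freqs n \<union> - freqs n)
      = infsum (\<lambda>k. a k * wave k x) (freqs n) + infsum (\<lambda>k. a k * wave k x) (- freqs n)"
    by (rule infsum_Un_disjoint) (auto intro: summable_fsum)
  then have "fsum a x - (\<Sum>k\<in>freqs n. a k * wave k x) = infsum (\<lambda>k. a k * wave k x) (- freqs n)"
    by (simp add: fsum_def finite_freqs)
  moreover have "cmod \<dots> \<le> (\<Sum>\<^sub>\<infinity>k\<in>- freqs n. cmod (a k * wave k x))"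
    by (rule norm_infsum_bound) (use asum_subset in \<open>simp add: norm_mult\<close>)
  ultimately show ?thesis by (simp add: norm_mult)
qed

lemma continuous_fsum: "continuous_on UNIV (fsum a)"
proof (rule uniform_limit_theorem[OF _ _ sequentially_bot])
  show "\<forall>\<^sub>F n in sequentially. continuous_on UNIV (\<lambda>x. \<Sum>k\<in>freqs n. a k * wave k x)"
    by (intro always_eventually allI continuous_intros)
  show "uniform_limit UNIV (\<lambda>n x. \<Sum>k\<in>freqs n. a k * wave k x) (fsum a) sequentially"
  proof (rule uniform_limitI)
    fix e :: real assume "e > 0"
    from order_tendstoD(2)[OF infsum_tail[OF asum] this]
    show "\<forall>\<^sub>F n in sequentially. \<forall>x\<in>UNIV. dist (\<Sum>k\<in>freqs n. a k * wave k x) (fsum a x) < e"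
    proof eventually_elim
      case (elim n)
      then show ?case using partial_fsum_error[of _ n]
        by (auto simp: dist_norm norm_minus_commute intro: le_less_trans)
    qed
  qed
qed

lemma norm_partial_fsum: "cmod (\<Sum>k\<in>freqs n. a k * wave (\<sigma> k) x) \<le> (\<Sum>\<^sub>\<infinity>k. cmod (a k))"
proof -
  have "cmod (\<Sum>k\<in>freqs n. a k * wave (\<sigma> k) x) \<le> (\<Sum>k\<in>freqs n. cmod (a k * wave (\<sigma> k) x))"
    by (rule norm_sum)
  also have "\<dots> = (\<Sum>k\<in>freqs n. cmod (a k))" by (simp add: norm_mult)
  also have "\<dots> \<le> (\<Sum>\<^sub>\<infinity>k. cmod (a k))"
    by (rule finite_sum_le_infsum[OF asum finite_freqs]) auto
  finally show ?thesis .
qed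

text \<open>Only finitely many exponentials occur in the infinite sum. Collecting the coefficients
  of each residue, selected by \<open>c\<close>, turns it into a finite combination.\<close>

lemma isum_ctrig: "isum N a \<in> ctrig N"
proof -
  define c where "c \<kappa> k = (if red N k = \<kappa> then a k else 0)" for \<kappa> k
  have cs: "c \<kappa> summable_on UNIV" for \<kappa>
    by (rule abs_summable_summable, rule Infinite_Sum.abs_summable_on_comparison_test[of a])
       (use asum in \<open>auto simp: c_def\<close>)
  show ?thesis
  proof (rule ctrigI[where c = "\<lambda>\<kappa>. infsum (c \<kappa>) UNIV"])
    fix x
    have "((\<lambda>k. \<Sum>\<kappa>\<in>freqs N. c \<kappa> k * wave \<kappa> x) has_sum (\<Sum>\<kappa>\<in>freqs N. infsum (c \<kappa>) UNIV * wave \<kappa> x)) UNIV"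
      by (intro has_sum_finite_sum has_sum_cmult_left has_sum_infsum cs)
    moreover have "(\<Sum>\<kappa>\<in>freqs N. c \<kappa> k * wave \<kappa> x) = a k * wave (red N k) x" for k
      using red_freqs[of N k]
      by (simp add: c_def finite_freqs if_distrib[of "\<lambda>u. u * _"] cong: if_cong)
    ultimately show "isum N a x = (\<Sum>\<kappa>\<in>freqs N. infsum (c \<kappa>) UNIV * wave \<kappa> x)"
      unfolding isum_def by (simp add: infsumI)
  qed
qed

lemma isum_colloc: "isum N a (colloc N j) = fsum a (colloc N j)"
  by (simp add: isum_def fsum_def wave_red)

text \<open>A uniform bound without a rate. It needs absolute summability only, which is all that is
  recorded for the products p_j F; for them convergence suffices, whereas F itself needs the rate of
  \<open>alias_error\<close>.\<close>

lemma isum_error: "cmod (fsum a x - isum N a x) \<le> 2 * (\<Sum>\<^sub>\<infinity>k\<in>- freqs N. cmod (a k))"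
proof -
  have s: "(\<lambda>k. a k * wave k x) summable_on X" "(\<lambda>k. a k * wave (red N k) x) summable_on X" for X
    using summable_fsum[of "\<lambda>k. k"] summable_fsum by auto
  have sm: "(\<lambda>k. cmod (a k)) summable_on - freqs N" by (rule asum_subset)
  have 1: "cmod (infsum (\<lambda>k. a k * wave (\<sigma> k) x) (- freqs N)) \<le> (\<Sum>\<^sub>\<infinity>k\<in>- freqs N. cmod (a k))" for \<sigma>
  proof -
    have "cmod (infsum (\<lambda>k. a k * wave (\<sigma> k) x) (- freqs N)) \<le> (\<Sum>\<^sub>\<infinity>k\<in>- freqs N. cmod (a k * wave (\<sigma> k) x))"
      by (rule norm_infsum_bound) (use sm in \<open>simp add: norm_mult\<close>)
    then show ?thesis by (simp add: norm_mult)
  qed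
  have split: "infsum h UNIV = infsum h (freqs N) + infsum h (- freqs N)"
    if "\<And>X. h summable_on X" for h :: "int^'n \<Rightarrow> complex"
    using infsum_Un_disjoint[of h "freqs N" "- freqs N"] that by simp
  have "infsum (\<lambda>k. a k * wave (red N k) x) (freqs N) = infsum (\<lambda>k. a k * wave k x) (freqs N)"
    by (rule infsum_cong) (simp add: red_id)
  then have "fsum a x - isum N a x = infsum (\<lambda>k. a k * wave k x) (- freqs N) - infsum (\<lambda>k. a k * wave (red N k) x) (- freqs N)"
    unfolding fsum_def isum_def split[OF s(1)] split[OF s(2)] by simp
  also have "cmod \<dots> \<le> (\<Sum>\<^sub>\<infinity>k\<in>- freqs N. cmod (a k)) + (\<Sum>\<^sub>\<infinity>k\<in>- freqs N. cmod (a k))"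
    by (rule order_trans[OF norm_triangle_ineq4 add_mono[OF 1 1]])
  finally show ?thesis by simp
qed

text \<open>The finite estimate passes to the limit: the partial sums \<open>D n\<close> converge
  pointwise and are dominated by the constant 2 * sum |a_k|.\<close>

lemma alias_error:
  assumes Z: "\<And>S :: (int^'n) set. finite S \<Longrightarrow> 0 \<notin> S \<Longrightarrow> (\<Sum>l\<in>S. 1 / wgt r l) \<le> Z"
    and w: "(\<lambda>k. wgt r k * (cmod (a k))\<^sup>2) summable_on UNIV" and N: "N \<ge> 1"
  shows "(LINT x|cubeM. (cmod (fsum a x - isum N a x))\<^sup>2)
    \<le> 2 * (2 * pi) ^ CARD('n) * (1 + Z) / real N ^ (2 * r) * (\<Sum>\<^sub>\<infinity>k\<in>- freqs N. wgt r k * (cmod (a k))\<^sup>2)"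
    (is "?L \<le> ?C * ?R")
proof -
  define D where "D n x = (\<Sum>k\<in>freqs n. a k * wave k x) - (\<Sum>k\<in>freqs n. a k * wave (red N k) x)" for n x
  let ?A = "\<Sum>\<^sub>\<infinity>k. cmod (a k)"
  have Z0: "Z \<ge> 0" using Z[of "{}"] by simp
  \<comment> \<open>Frequencies inside the cube are their own residues, so their contributions
    cancel and only the tail is left to estimate.\<close>
  have De: "D n x = (\<Sum>k\<in>freqs n - freqs N. a k * (wave k x - wave (red N k) x))" for n x
    unfolding D_def sum_subtractf[symmetric] right_diff_distrib[symmetric]
    by (rule sum.mono_neutral_right) (auto simp: finite_freqs red_id)
  have lim: "(\<lambda>n. LINT x|cubeM. (cmod (D n x))\<^sup>2) \<longlonglongrightarrow> ?L"
  proof (rule integral_dominated_convergence[where w = "\<lambda>_. (2 * ?A)\<^sup>2"])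
    show "AE x in cubeM. (\<lambda>n. (cmod (D n x))\<^sup>2) \<longlonglongrightarrow> (cmod (fsum a x - isum N a x))\<^sup>2"
      unfolding D_def by (intro AE_I2 tendsto_power tendsto_norm tendsto_diff fsum_limit isum_limit)
    show "AE x in cubeM. norm ((cmod (D n x))\<^sup>2) \<le> (2 * ?A)\<^sup>2" for n
    proof (rule AE_I2)
      fix x
      have "cmod (D n x) \<le> 2 * ?A"
        unfolding D_def
        using norm_triangle_ineq4[of "\<Sum>k\<in>freqs n. a k * wave k x" "\<Sum>k\<in>freqs n. a k * wave (red N k) x"]
          norm_partial_fsum[of "\<lambda>k. k" x n] norm_partial_fsum[of "red N" x n] by linarith
      then have "(cmod (D n x))\<^sup>2 \<le> (2 * ?A)\<^sup>2" by (rule power_mono) simp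
      then show "norm ((cmod (D n x))\<^sup>2) \<le> (2 * ?A)\<^sup>2" by simp
    qed
    show "(\<lambda>x. (cmod (D n x))\<^sup>2) \<in> borel_measurable cubeM" for n
      unfolding D_def by (intro meas_cubeM continuous_intros)
    show "(\<lambda>x. (cmod (fsum a x - isum N a x))\<^sup>2) \<in> borel_measurable cubeM"
      by (intro meas_cubeM continuous_intros continuous_fsum continuous_ctrig[OF isum_ctrig])
  qed simp
  have "(LINT x|cubeM. (cmod (D n x))\<^sup>2) \<le> ?C * ?R" for n
  proof -
    have "(LINT x|cubeM. (cmod (D n x))\<^sup>2) \<le> ?C * (\<Sum>k\<in>freqs n - freqs N. wgt r k * (cmod (a k))\<^sup>2)"
      unfolding De by (rule alias_finite[OF Z N]) (auto simp: finite_freqs)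
    also have "\<dots> \<le> ?C * ?R"
    proof (rule mult_left_mono)
      have "(\<lambda>k. wgt r k * (cmod (a k))\<^sup>2) summable_on - freqs N"
        using summable_on_subset_banach[OF w] by simp
      then show "(\<Sum>k\<in>freqs n - freqs N. wgt r k * (cmod (a k))\<^sup>2) \<le> ?R"
        by (rule finite_sum_le_infsum) (auto simp: finite_freqs wgt_nonneg)
    qed (use Z0 in auto)
    finally show ?thesis .
  qed
  then show ?thesis using lim by (intro LIMSEQ_le_const2[OF lim]) auto
qed

lemma fsum_mult_wave:
  shows "(\<lambda>k. cmod (a (k - l))) summable_on UNIV" "fsum (\<lambda>k. a (k - l)) x = wave l x * fsum a x"
proof -
  have b: "bij_betw (\<lambda>k. k - l) UNIV UNIV"
    by (rule bij_betw_byWitness[where f' = "\<lambda>k. k + l"]) auto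
  show "(\<lambda>k. cmod (a (k - l))) summable_on UNIV"
    using asum summable_on_reindex_bij_betw[OF b, of "\<lambda>k. cmod (a k)"] by simp
  have "a (k - l) * wave k x = wave l x * (a (k - l) * wave (k - l) x)" for k
    using wave_add[of l "k - l" x] by (simp add: algebra_simps)
  then have "fsum (\<lambda>k. a (k - l)) x = (\<Sum>\<^sub>\<infinity>k. wave l x * (a (k - l) * wave (k - l) x))"
    unfolding fsum_def by (intro infsum_cong)
  also have "\<dots> = (\<Sum>\<^sub>\<infinity>k. wave l x * (a k * wave k x))"
    by (rule infsum_reindex_bij_betw[OF b])
  also have "\<dots> = wave l x * fsum a x"
    unfolding fsum_def by (rule infsum_cmult_right')
  finally show "fsum (\<lambda>k. a (k - l)) x = wave l x * fsum a x" .
qed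

text \<open>Multiplication by one exponential shifts the coefficients; a trigonometric polynomial
  gives a finite combination of shifts, which is again absolutely summable.\<close>

lemma fsum_mult_ctrig:
  assumes "p \<in> ctrig K"
  obtains b where "(\<lambda>k. cmod (b k)) summable_on UNIV" "\<And>x. fsum b x = p x * fsum a x"
proof -
  obtain c where c: "\<And>x. p x = (\<Sum>l\<in>freqs K. c l * wave l x)" using assms by (auto simp: ctrig_def)
  define b where "b k = (\<Sum>l\<in>freqs K. c l * a (k - l))" for k
  show ?thesis
  proof (rule that[of b])
    have "((\<lambda>k. \<Sum>l\<in>freqs K. cmod (c l) * cmod (a (k - l))) has_sum
        (\<Sum>l\<in>freqs K. cmod (c l) * (\<Sum>\<^sub>\<infinity>k. cmod (a (k - l))))) UNIV"
      by (intro has_sum_finite_sum has_sum_cmult_right has_sum_infsum fsum_mult_wave(1))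
    then have s: "(\<lambda>k. \<Sum>l\<in>freqs K. cmod (c l) * cmod (a (k - l))) summable_on UNIV"
      unfolding summable_on_def by blast
    show "(\<lambda>k. cmod (b k)) summable_on UNIV"
      by (rule Infinite_Sum.abs_summable_on_comparison_test'[OF s])
         (auto simp: b_def norm_mult intro: order_trans[OF norm_sum])
    fix x
    have "((\<lambda>k. a (k - l) * wave k x) has_sum wave l x * fsum a x) UNIV" for l
    proof -
      have "(\<lambda>k. a (k - l) * wave k x) summable_on UNIV"
        by (rule abs_summable_summable) (use fsum_mult_wave(1) in \<open>simp add: norm_mult\<close>)
      then show ?thesis
        unfolding fsum_mult_wave(2)[symmetric] fsum_def[of "\<lambda>k. a (k - l)"] by (rule has_sum_infsum)
    qed
    then have "((\<lambda>k. \<Sum>l\<in>freqs K. c l * (a (k - l) * wave k x)) has_sum (\<Sum>l\<in>freqs K. c l * (wave l x * fsum a x))) UNIV"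
      by (intro has_sum_finite_sum has_sum_cmult_right)
    then have "((\<lambda>k. b k * wave k x) has_sum p x * fsum a x) UNIV"
      by (simp add: b_def c sum_distrib_right mult.assoc)
    then show "fsum b x = p x * fsum a x" unfolding fsum_def by (rule infsumI)
  qed
qed

end

subsection \<open>Representation by the Fourier series\<close>

text \<open>The sum is real as a limit of the real functions \<open>trig_proj n f\<close>, and it is
  continuous. It has the same Fourier coefficients as f, so completeness applied to the difference
  gives equality almost everywhere.\<close>

lemma fourier_series_AE:
  fixes f :: "real^'n \<Rightarrow> real"
  assumes f: "integrable cubeM f"
    and asum: "(\<lambda>k. cmod (fourier_coeff f k)) summable_on UNIV"
  shows "fsum (fourier_coeff f) x = complex_of_real (Re (fsum (fourier_coeff f) x))"
    and "AE x in cubeM. f x = Re (fsum (fourier_coeff f) x)"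
proof -
  let ?a = "fourier_coeff f"
  define F where "F x = Re (fsum ?a x)" for x
  have lim: "(\<lambda>n. complex_of_real (trig_proj n f x)) \<longlonglongrightarrow> fsum ?a x" for x
    using fsum_limit[OF asum] unfolding trig_proj_eq .
  have limR: "(\<lambda>n. trig_proj n f x) \<longlonglongrightarrow> F x" for x
    using tendsto_Re[OF lim[of x]] by (simp add: F_def)
  have "(\<lambda>n. complex_of_real (trig_proj n f x)) \<longlonglongrightarrow> complex_of_real (F x)" for x
    by (intro tendsto_of_real limR)
  then show real: "fsum ?a x = complex_of_real (Re (fsum ?a x))" for x
    using lim LIMSEQ_unique unfolding F_def by blast
  have cF: "continuous_on UNIV F" unfolding F_def[abs_def]
    by (intro continuous_on_Re continuous_fsum asum)
  have iF: "integrable cubeM F" by (rule integrable_cube_continuous[OF cF])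
  have bd: "\<bar>trig_proj n f x\<bar> \<le> (\<Sum>\<^sub>\<infinity>k. cmod (?a k))" for n x
    using norm_partial_fsum[OF asum, of "\<lambda>k. k" x n] unfolding trig_proj_eq[symmetric] by simp
  \<comment> \<open>Both sides are limits of the same sequence of integrals: dominated convergence
    gives the left one, while by orthogonality the sequence is constantly the right one as soon as
    the cube contains - k.\<close>
  have IF: "(LINT x|cubeM. complex_of_real (F x) * wave k x) = (LINT x|cubeM. complex_of_real (f x) * wave k x)" for k
  proof -
    have "(\<lambda>n. LINT x|cubeM. complex_of_real (trig_proj n f x) * wave k x) \<longlonglongrightarrow> (LINT x|cubeM. complex_of_real (F x) * wave k x)"
    proof (rule integral_dominated_convergence[where w = "\<lambda>_. \<Sum>\<^sub>\<infinity>k. cmod (?a k)"])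
      show "AE x in cubeM. (\<lambda>n. complex_of_real (trig_proj n f x) * wave k x) \<longlonglongrightarrow> complex_of_real (F x) * wave k x"
        by (intro AE_I2 tendsto_mult tendsto_of_real limR tendsto_const)
      show "AE x in cubeM. norm (complex_of_real (trig_proj n f x) * wave k x) \<le> (\<Sum>\<^sub>\<infinity>k. cmod (?a k))" for n
        using bd by (simp add: norm_mult)
      show "(\<lambda>x. complex_of_real (trig_proj n f x) * wave k x) \<in> borel_measurable cubeM" for n
        by (intro meas_cubeM continuous_intros continuous_trig_space[OF trig_proj_in_trig_space])
      show "(\<lambda>x. complex_of_real (F x) * wave k x) \<in> borel_measurable cubeM"
        by (intro meas_cubeM continuous_intros cF)
    qed simp
    moreover obtain K where K: "- k \<in> freqs K" using freqs_exists by blast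
    have "\<forall>\<^sub>F n in sequentially. (LINT x|cubeM. complex_of_real (trig_proj n f x) * wave k x) = (LINT x|cubeM. complex_of_real (f x) * wave k x)"
      using eventually_ge_at_top[of K]
    proof eventually_elim
      case (elim n)
      then have kn: "- k \<in> freqs n" using K freqs_mono by blast
      have "(LINT x|cubeM. complex_of_real (trig_proj n f x) * wave k x) = (LINT x|cubeM. (\<Sum>l\<in>freqs n. ?a l * wave (l + k) x))"
        unfolding trig_proj_eq by (simp add: sum_distrib_right wave_add mult.assoc)
      also have "\<dots> = (\<Sum>l\<in>freqs n. ?a l * (LINT x|cubeM. wave (l + k) x))"
        by (subst Bochner_Integration.integral_sum)
           (auto intro!: integrable_cube_continuous continuous_intros)
      also have "\<dots> = (\<Sum>l\<in>freqs n. if l = - k then ?a l * (2 * pi) ^ CARD('n) else 0)"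
        by (intro sum.cong refl) (auto simp: integral_wave eq_neg_iff_add_eq_0)
      also have "\<dots> = (2 * pi) ^ CARD('n) * ?a (- k)"
        using kn by (simp add: finite_freqs)
      also have "\<dots> = (LINT x|cubeM. complex_of_real (f x) * wave k x)"
        using integral_wave_coeff[of f "- k"] by simp
      finally show ?case .
    qed
    then have "(\<lambda>n. LINT x|cubeM. complex_of_real (trig_proj n f x) * wave k x) \<longlonglongrightarrow> (LINT x|cubeM. complex_of_real (f x) * wave k x)"
      by (rule tendsto_eventually)
    ultimately show ?thesis using LIMSEQ_unique by blast
  qed
  have "AE x in cubeM. f x - F x = 0"
  proof (rule AE_zero_if_fourier_zero)
    show "integrable cubeM (\<lambda>x. f x - F x)" using f iF by simp
    fix k
    have "(LINT x|cubeM. complex_of_real (f x) * wave k x - complex_of_real (F x) * wave k x) = 0"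
      by (subst Bochner_Integration.integral_diff) (auto simp: IF integrable_mult_wave f iF)
    then show "(LINT x|cubeM. complex_of_real (f x - F x) * wave k x) = 0"
      by (simp add: algebra_simps)
  qed
  then show "AE x in cubeM. f x = Re (fsum ?a x)" by (simp add: F_def)
qed


subsection \<open>The constrained least-squares problem\<close>

lemma L2_norm_sq: "(L2_norm h)\<^sup>2 = (LINT x|cubeM. (h x)\<^sup>2)"
  by (simp add: L2_norm_def)

lemma L2_diff: "f \<in> L2 \<Longrightarrow> g \<in> L2 \<Longrightarrow> (\<lambda>x. f x - g x) \<in> L2"
proof -
  assume fg: "f \<in> L2" "g \<in> L2"
  have "integrable cubeM (\<lambda>x. (f x - g x)\<^sup>2)"
  proof (rule Bochner_Integration.integrable_bound)
    show "integrable cubeM (\<lambda>x. 2 * (f x)\<^sup>2 + 2 * (g x)\<^sup>2)" using fg by (simp add: L2_def)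
    show "(\<lambda>x. (f x - g x)\<^sup>2) \<in> borel_measurable cubeM"
      using fg by (intro borel_measurable_power borel_measurable_diff) (auto simp: L2_def)
    show "AE x in cubeM. norm ((f x - g x)\<^sup>2) \<le> norm (2 * (f x)\<^sup>2 + 2 * (g x)\<^sup>2)"
    proof (rule AE_I2)
      fix x
      have "(f x - g x)\<^sup>2 \<le> 2 * (f x)\<^sup>2 + 2 * (g x)\<^sup>2"
        using zero_le_power2[of "f x + g x"] by (simp add: power2_sum power2_diff)
      then show "norm ((f x - g x)\<^sup>2) \<le> norm (2 * (f x)\<^sup>2 + 2 * (g x)\<^sup>2)" by simp
    qed
  qed
  moreover have "(\<lambda>x. f x - g x) \<in> borel_measurable cubeM"
    using fg by (intro borel_measurable_diff) (auto simp: L2_def)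
  ultimately show ?thesis by (simp add: L2_def)
qed

lemma trig_space_L2: "g \<in> trig_space N \<Longrightarrow> g \<in> L2"
  by (intro L2I_continuous continuous_trig_space)

lemma trig_space_fourier:
  fixes g :: "real^'n \<Rightarrow> real"
  assumes "g \<in> trig_space N"
  shows "complex_of_real (g x) = (\<Sum>k\<in>freqs N. fourier_coeff g k * wave k x)"
proof -
  obtain c where c: "\<And>x. complex_of_real (g x) = (\<Sum>k\<in>freqs N. c k * wave k x)"
    using assms by (auto simp: trig_space_def)
  have "fourier_coeff g k = c k" if k: "k \<in> freqs N" for k
  proof -
    have "(2 * pi) ^ CARD('n) * fourier_coeff g k = (LINT x|cubeM. complex_of_real (g x) * wave (- k) x)"
      by (simp add: integral_wave_coeff)
    also have "\<dots> = (LINT x|cubeM. (\<Sum>l\<in>freqs N. c l * wave (l + (- k)) x))"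
      unfolding c wave_add sum_distrib_right by (simp add: mult.assoc)
    also have "\<dots> = (\<Sum>l\<in>freqs N. c l * (LINT x|cubeM. wave (l + (- k)) x))"
      by (subst Bochner_Integration.integral_sum)
         (auto intro!: integrable_cube_continuous continuous_intros)
    also have "\<dots> = (\<Sum>l\<in>freqs N. if l = k then c l * (2 * pi) ^ CARD('n) else 0)"
      by (intro sum.cong refl) (auto simp: integral_wave)
    also have "\<dots> = (2 * pi) ^ CARD('n) * c k" using k by (simp add: finite_freqs)
    finally show ?thesis by simp
  qed
  then show ?thesis unfolding c by (intro sum.cong) auto
qed

lemma fourier_coeff_diff:
  assumes "integrable cubeM f" "integrable cubeM g"
  shows "fourier_coeff (\<lambda>x. f x - g x) k = fourier_coeff f k - fourier_coeff g k"
proof -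
  have "(LINT x|cubeM. complex_of_real (f x) * wave (- k) x - complex_of_real (g x) * wave (- k) x)
     = (LINT x|cubeM. complex_of_real (f x) * wave (- k) x) - (LINT x|cubeM. complex_of_real (g x) * wave (- k) x)"
    by (intro Bochner_Integration.integral_diff integrable_mult_wave assms)
  then show ?thesis by (simp add: fourier_coeff_def left_diff_distrib diff_divide_distrib)
qed

lemma fourier_coeff_le_L2:
  fixes g :: "real^'n \<Rightarrow> real"
  assumes "g \<in> L2"
  shows "cmod (fourier_coeff g k) \<le> L2_norm g"
proof -
  have "1 \<le> (2 * pi) ^ CARD('n)" using pi_ge_two by (intro one_le_power) auto
  then have "1 * (cmod (fourier_coeff g k))\<^sup>2 \<le> (2 * pi) ^ CARD('n) * (cmod (fourier_coeff g k))\<^sup>2"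
    by (intro mult_right_mono) auto
  also have "\<dots> \<le> (LINT x|cubeM. (g x)\<^sup>2)" using bessel[OF assms, of "{k}"] by simp
  finally show ?thesis unfolding L2_norm_def by (intro real_le_rsqrt) simp
qed

text \<open>Turns near-optimality of two candidates into closeness of the candidates, once their
  midpoint is known to be admissible.\<close>

lemma parallelogram:
  fixes f g h :: "real^'n \<Rightarrow> real"
  assumes "f \<in> L2" "g \<in> L2" "h \<in> L2"
  shows "(L2_norm (\<lambda>x. g x - h x))\<^sup>2
    = 2 * (L2_norm (\<lambda>x. g x - f x))\<^sup>2 + 2 * (L2_norm (\<lambda>x. h x - f x))\<^sup>2
      - 4 * (L2_norm (\<lambda>x. (g x + h x) / 2 - f x))\<^sup>2"
proof -
  have i: "integrable cubeM (\<lambda>x. (g x - f x)\<^sup>2)" "integrable cubeM (\<lambda>x. (h x - f x)\<^sup>2)"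
    "integrable cubeM (\<lambda>x. (g x - h x)\<^sup>2)"
    using L2_diff assms by (auto simp: L2_def)
  have e: "((g x + h x) / 2 - f x)\<^sup>2 = (g x - f x)\<^sup>2 / 2 + (h x - f x)\<^sup>2 / 2 - (g x - h x)\<^sup>2 / 4" for x
    by (simp add: power2_eq_square field_simps)
  show ?thesis unfolding L2_norm_sq e using i by simp
qed

text \<open>The admissible set \<open>K\<close> is convex and consists of trigonometric polynomials
  of one degree. By the parallelogram identity a minimizing sequence has Cauchy Fourier
  coefficients; finitely many of them determine the function, so the limit is again a trigonometric
  polynomial, and the sign and moment constraints survive pointwise and dominated limits. For two
  minimizers the same estimate has right-hand side zero, which is uniqueness.\<close>

lemma ex1_constrained_argmin:
  fixes m :: "real^'n \<Rightarrow> real^'m" and f :: "real^'n \<Rightarrow> real"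
  assumes m: "\<And>j. continuous_on UNIV (\<lambda>x. m x $ j)"
    and f: "f \<in> L2"
    and ne: "\<exists>g. g \<in> trig_space_nonneg N \<and> moments m g = moments m f"
  shows "\<exists>!g. is_pos_proj m N f g"
proof -
  define K where "K = {g. g \<in> trig_space_nonneg N \<and> moments m g = moments m f}"
  define \<phi> where "\<phi> g = (L2_norm (\<lambda>x. g x - f x))\<^sup>2" for g
  define I where "I = Inf (\<phi> ` K)"
  have isp: "is_pos_proj m N f g \<longleftrightarrow> g \<in> K \<and> (\<forall>h\<in>K. \<phi> g \<le> \<phi> h)" for g
    unfolding is_pos_proj_def is_arg_min_def K_def \<phi>_def by (auto simp: not_less)
  have bdd: "bdd_below (\<phi> ` K)" by (rule bdd_belowI2[where m = 0]) (simp add: \<phi>_def)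
  have I_le: "I \<le> \<phi> g" if "g \<in> K" for g unfolding I_def using that bdd by (intro cInf_lower) auto
  have KT: "g \<in> trig_space N" if "g \<in> K" for g using that by (simp add: K_def trig_space_nonneg_def)
  have KL: "g \<in> L2" if "g \<in> K" for g by (rule trig_space_L2[OF KT[OF that]])
  have mid: "(\<lambda>x. (g x + h x) / 2) \<in> K" if g: "g \<in> K" and h: "h \<in> K" for g h
  proof -
    have "(\<lambda>x. (1/2) * (g x + h x)) \<in> trig_space N"
      by (intro trig_space_cmult trig_space_add KT g h)
    moreover have "moments m (\<lambda>x. (g x + h x) / 2) = moments m f"
    proof -
      have i: "integrable cubeM (\<lambda>x. m x $ j * u x)" if "u \<in> K" for u j
        by (intro integrable_cube_continuous continuous_intros m continuous_trig_space[OF KT[OF that]])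
      have "(LINT x|cubeM. m x $ j * ((g x + h x) / 2)) = moments m f $ j" for j
      proof -
        have "(LINT x|cubeM. m x $ j * ((g x + h x) / 2)) = (LINT x|cubeM. (m x $ j * g x) / 2 + (m x $ j * h x) / 2)"
          by (simp add: algebra_simps add_divide_distrib)
        also have "\<dots> = (moments m g $ j) / 2 + (moments m h $ j) / 2"
          using i g h by (simp add: moments_def)
        finally show ?thesis using g h by (simp add: K_def)
      qed
      then show ?thesis by (subst moments_def) (simp add: vec_eq_iff)
    qed
    ultimately show ?thesis using g h by (auto simp: K_def trig_space_nonneg_def)
  qed
  \<comment> \<open>The midpoint lies in \<open>K\<close>, so its objective is at least the infimum
    \<open>I\<close>.\<close>
  have par: "(L2_norm (\<lambda>x. g x - h x))\<^sup>2 \<le> 2 * (\<phi> g - I) + 2 * (\<phi> h - I)" if "g \<in> K" "h \<in> K" for g h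
    using parallelogram[OF f KL[OF that(1)] KL[OF that(2)]] I_le[OF mid[OF that]]
    unfolding \<phi>_def by simp
  have coeff: "cmod (fourier_coeff g k - fourier_coeff h k) \<le> sqrt (2 * (\<phi> g - I) + 2 * (\<phi> h - I))"
    if "g \<in> K" "h \<in> K" for g h k
  proof -
    have "cmod (fourier_coeff g k - fourier_coeff h k) \<le> L2_norm (\<lambda>x. g x - h x)"
      using fourier_coeff_le_L2[OF L2_diff[OF KL[OF that(1)] KL[OF that(2)]]]
      by (simp add: fourier_coeff_diff L2_integrable KL that)
    also have "\<dots> \<le> sqrt (2 * (\<phi> g - I) + 2 * (\<phi> h - I))"
      by (rule real_le_rsqrt) (rule par[OF that])
    finally show ?thesis .
  qed
  have ex: "\<exists>g\<in>K. \<forall>h\<in>K. \<phi> g \<le> \<phi> h"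
  proof -
    have "\<exists>g\<in>K. \<phi> g < I + 1 / (real n + 1)" for n
    proof -
      have "\<phi> ` K \<noteq> {}" using ne by (auto simp: K_def)
      then have "\<exists>y\<in>\<phi> ` K. y < I + 1 / (real n + 1)"
        using cInf_less_iff[OF _ bdd, of "I + 1 / (real n + 1)"] unfolding I_def by auto
      then show ?thesis by blast
    qed
    then obtain G where G: "\<And>n. G n \<in> K" "\<And>n. \<phi> (G n) < I + 1 / (real n + 1)" by metis
    have \<phi>lim: "(\<lambda>n. \<phi> (G n)) \<longlonglongrightarrow> I"
    proof (rule tendsto_sandwich[of "\<lambda>_. I" _ _ "\<lambda>n. I + 1 / (real n + 1)"])
      have "(\<lambda>n. 1 / (real n + 1)) \<longlonglongrightarrow> 0" by real_asymp
      from tendsto_add[OF tendsto_const[of I] this] show "(\<lambda>n. I + 1 / (real n + 1)) \<longlonglongrightarrow> I" by simp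
      show "\<forall>\<^sub>F n in sequentially. \<phi> (G n) \<le> I + 1 / (real n + 1)"
        using G(2) by (auto intro!: always_eventually less_imp_le)
    qed (use I_le G(1) in auto)
    have "Cauchy (\<lambda>n. fourier_coeff (G n) k)" for k
    proof (rule CauchyI)
      fix e :: real assume e: "e > 0"
      have "\<forall>\<^sub>F n in sequentially. \<phi> (G n) < I + e\<^sup>2 / 8"
        using \<phi>lim by (rule order_tendstoD) (use e in simp)
      then obtain n0 where n0: "\<And>n. n \<ge> n0 \<Longrightarrow> \<phi> (G n) < I + e\<^sup>2 / 8"
        by (auto simp: eventually_sequentially)
      show "\<exists>M. \<forall>n\<ge>M. \<forall>l\<ge>M. norm (fourier_coeff (G n) k - fourier_coeff (G l) k) < e"
      proof (intro exI[of _ n0] allI impI)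
        fix n l assume nl: "n \<ge> n0" "l \<ge> n0"
        \<comment> \<open>Excesses below t / 8 add up, after doubling, to less than t / 2.\<close>
        have "2 * (a - I) + 2 * (b - I) < t" if "a < I + t / 8" "b < I + t / 8" "0 < t" for a b t :: real
          using that by (simp add: field_simps)
        from this[OF n0[OF nl(1)] n0[OF nl(2)] zero_less_power[OF e]]
        have "2 * (\<phi> (G n) - I) + 2 * (\<phi> (G l) - I) < e\<^sup>2" .
        then have "sqrt (2 * (\<phi> (G n) - I) + 2 * (\<phi> (G l) - I)) < sqrt (e\<^sup>2)"
          by (simp only: real_sqrt_less_iff)
        then show "norm (fourier_coeff (G n) k - fourier_coeff (G l) k) < e"
          using coeff[OF G(1)[of n] G(1)[of l], of k] e by simp
      qed
    qed
    then obtain c where c: "\<And>k. (\<lambda>n. fourier_coeff (G n) k) \<longlonglongrightarrow> c k"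
      unfolding Cauchy_convergent_iff convergent_def by metis
    define g where "g x = Re (\<Sum>k\<in>freqs N. c k * wave k x)" for x
    have gT: "g \<in> trig_space N"
      unfolding g_def[abs_def] by (intro Re_ctrig ctrig_sum ctrig_cmult wave_ctrig)
    have Geq: "G n x = Re (\<Sum>k\<in>freqs N. fourier_coeff (G n) k * wave k x)" for n x
      using trig_space_fourier[OF KT[OF G(1)], of n x] by (metis Re_complex_of_real)
    have Glim: "(\<lambda>n. G n x) \<longlonglongrightarrow> g x" for x
    proof -
      have eq: "(\<lambda>n. G n x) = (\<lambda>n. Re (\<Sum>k\<in>freqs N. fourier_coeff (G n) k * wave k x))"
        by (rule ext) (rule Geq)
      show ?thesis unfolding eq g_def
        by (intro tendsto_Re tendsto_sum tendsto_mult tendsto_const c)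
    qed
    have "\<exists>B. \<forall>n. cmod (fourier_coeff (G n) k) \<le> B" for k
      using c convergent_imp_Bseq[of "\<lambda>n. fourier_coeff (G n) k"]
      by (auto simp: convergent_def Bseq_def)
    then obtain b where b: "\<And>n k. cmod (fourier_coeff (G n) k) \<le> b k" by metis
    define B where "B = (\<Sum>k\<in>freqs N. b k)"
    have GB: "\<bar>G n x\<bar> \<le> B" for n x
    proof -
      have "\<bar>G n x\<bar> \<le> cmod (\<Sum>k\<in>freqs N. fourier_coeff (G n) k * wave k x)"
        by (subst Geq) (rule abs_Re_le_cmod)
      also have "\<dots> \<le> (\<Sum>k\<in>freqs N. cmod (fourier_coeff (G n) k * wave k x))" by (rule norm_sum)
      also have "\<dots> \<le> B" unfolding B_def by (intro sum_mono) (simp add: norm_mult b)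
      finally show ?thesis .
    qed
    have Gc: "continuous_on UNIV (G n)" for n by (rule continuous_trig_space[OF KT[OF G(1)]])
    have gc: "continuous_on UNIV g" by (rule continuous_trig_space[OF gT])
    have "(LINT x|cubeM. m x $ j * g x) = moments m f $ j" for j
    proof -
      obtain M where M: "M > 0" "\<And>x. x \<in> cube \<Longrightarrow> norm (m x $ j) \<le> M"
        using bounded_cube[OF m] by metis
      have "(\<lambda>n. LINT x|cubeM. m x $ j * G n x) \<longlonglongrightarrow> (LINT x|cubeM. m x $ j * g x)"
      proof (rule integral_dominated_convergence[where w = "\<lambda>_. M * B"])
        show "AE x in cubeM. norm (m x $ j * G n x) \<le> M * B" for n
        proof (rule AE_I2)
          fix x :: "real^'n" assume "x \<in> space cubeM"
          then have "\<bar>m x $ j\<bar> \<le> M" using M(2) by simp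
          then show "norm (m x $ j * G n x) \<le> M * B"
            unfolding real_norm_def abs_mult using GB M(1) by (intro mult_mono) auto
        qed
        show "AE x in cubeM. (\<lambda>n. m x $ j * G n x) \<longlonglongrightarrow> m x $ j * g x"
          by (intro AE_I2 tendsto_mult tendsto_const Glim)
      qed (auto intro!: meas_cubeM continuous_intros m Gc gc)
      moreover have "(LINT x|cubeM. m x $ j * G n x) = moments m f $ j" for n
      proof -
        have "moments m (G n) $ j = moments m f $ j" using G(1)[of n] unfolding K_def by simp
        then show ?thesis by (simp add: moments_def)
      qed
      ultimately show ?thesis by (simp add: LIMSEQ_const_iff)
    qed
    then have gm: "moments m g = moments m f" by (subst moments_def) (simp add: vec_eq_iff)
    have "g (colloc N k) \<ge> 0" if "k \<in> freqs N" for k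
      by (rule LIMSEQ_le_const[OF Glim]) (use G(1) that in \<open>auto simp: K_def trig_space_nonneg_def\<close>)
    then have gK: "g \<in> K" using gT gm by (simp add: K_def trig_space_nonneg_def)
    have fm: "f \<in> borel_measurable cubeM" "integrable cubeM (\<lambda>x. (f x)\<^sup>2)" using f by (auto simp: L2_def)
    have "(\<lambda>n. LINT x|cubeM. (G n x - f x)\<^sup>2) \<longlonglongrightarrow> (LINT x|cubeM. (g x - f x)\<^sup>2)"
    proof (rule integral_dominated_convergence[where w = "\<lambda>x. 2 * B\<^sup>2 + 2 * (f x)\<^sup>2"])
      show "AE x in cubeM. norm ((G n x - f x)\<^sup>2) \<le> 2 * B\<^sup>2 + 2 * (f x)\<^sup>2" for n
      proof (rule AE_I2)
        fix x
        have "(G n x)\<^sup>2 \<le> B\<^sup>2" using GB[of n x] by (metis abs_le_square_iff abs_ge_self order_trans)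
        then have "(G n x - f x)\<^sup>2 \<le> 2 * B\<^sup>2 + 2 * (f x)\<^sup>2"
          using zero_le_power2[of "G n x + f x"] by (simp add: power2_sum power2_diff)
        then show "norm ((G n x - f x)\<^sup>2) \<le> 2 * B\<^sup>2 + 2 * (f x)\<^sup>2" by simp
      qed
      show "AE x in cubeM. (\<lambda>n. (G n x - f x)\<^sup>2) \<longlonglongrightarrow> (g x - f x)\<^sup>2"
        by (intro AE_I2 tendsto_power tendsto_diff tendsto_const Glim)
    qed (use fm meas_cubeM[OF Gc] meas_cubeM[OF gc] in auto)
    then have "(\<lambda>n. \<phi> (G n)) \<longlonglongrightarrow> \<phi> g" unfolding \<phi>_def L2_norm_sq .
    then have "\<phi> g = I" using \<phi>lim LIMSEQ_unique by blast
    then show ?thesis using gK I_le by auto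
  qed
  show ?thesis
  proof (rule ex_ex1I)
    show "\<exists>g. is_pos_proj m N f g" using ex unfolding isp by blast
    fix g h assume "is_pos_proj m N f g" "is_pos_proj m N f h"
    then have gh: "g \<in> K" "h \<in> K" "\<forall>u\<in>K. \<phi> g \<le> \<phi> u" "\<forall>u\<in>K. \<phi> h \<le> \<phi> u" unfolding isp by auto
    have "\<phi> g \<le> I" "\<phi> h \<le> I"
      unfolding I_def using gh by (auto intro!: cInf_greatest)
    then have "\<phi> g = I" "\<phi> h = I" using I_le gh by (auto intro: antisym)
    then have "fourier_coeff g k = fourier_coeff h k" for k
      using coeff[OF gh(1,2), of k] by simp
    then have "complex_of_real (g x) = complex_of_real (h x)" for x
      using trig_space_fourier[OF KT[OF gh(1)]] trig_space_fourier[OF KT[OF gh(2)]] by simp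
    then show "g = h" by auto
  qed
qed


subsection \<open>Moments\<close>

lemma AE_cube_open:
  fixes U :: "(real^'n) set"
  assumes "AE x in cubeM. P x" "open U" "U \<noteq> {}" "U \<subseteq> cube"
  shows "\<exists>x\<in>U. P x"
proof (rule ccontr)
  assume "\<not> (\<exists>x\<in>U. P x)"
  moreover have "AE x in lebesgue. x \<in> cube \<longrightarrow> P x"
    using assms(1) by (simp add: AE_restrict_space_iff)
  ultimately have "AE x in lebesgue. x \<notin> U"
    by (rule_tac eventually_mono) (use assms(4) in blast)+
  then have "negligible U"
    unfolding negligible_iff_null_sets by (subst (asm) AE_iff_null_sets[symmetric]) (use assms(2) in auto)
  then show False using open_not_negligible assms by blast
qed

text \<open>On the open interior, relations that hold almost everywhere between continuous functions
  hold at every point, because nonempty open sets are not null.\<close>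

definition icube :: "(real^'n) set" where
  "icube = box (\<chi> i. - pi) (\<chi> i. pi)"

lemma icube: "open icube" "icube \<subseteq> cube" "icube \<noteq> {}"
proof -
  have "0 \<in> (icube :: (real^'n) set)" by (simp add: icube_def mem_box_cart)
  then show "(icube :: (real^'n) set) \<noteq> {}" by blast
qed (auto simp: icube_def cube_def box_subset_cbox)

text \<open>Strictly inside, since 2 N < 2 N + 1. This makes pointwise sign information for F
  available at every collocation point.\<close>

lemma colloc_icube: "k \<in> freqs N \<Longrightarrow> colloc N k \<in> icube"
proof -
  assume k: "k \<in> freqs N"
  have "- pi < 2 * pi * real_of_int (k $ i) / (2 * real N + 1) \<and> 2 * pi * real_of_int (k $ i) / (2 * real N + 1) < pi" for i
  proof -
    have "- int N \<le> k $ i" "k $ i \<le> int N" using k by (auto simp: freqs_def)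
    then have b: "- real N \<le> real_of_int (k $ i)" "real_of_int (k $ i) \<le> real N" by linarith+
    define t where "t = 2 * real_of_int (k $ i) / (2 * real N + 1)"
    have "- 1 < t" "t < 1" using b by (auto simp: t_def field_simps)
    then have "pi * (- 1) < pi * t" "pi * t < pi * 1" by (intro mult_strict_left_mono; simp)+
    then show ?thesis by (simp add: t_def mult_ac)
  qed
  then show ?thesis by (simp add: icube_def mem_box_cart colloc_def)
qed

lemma AE_nonneg_icube:
  fixes h :: "real^'n \<Rightarrow> real"
  assumes c: "continuous_on UNIV h" and ae: "AE x in cubeM. h x \<ge> 0" and x: "x \<in> icube"
  shows "h x \<ge> 0"
proof (rule ccontr)
  assume "\<not> h x \<ge> 0"
  then have ne: "x \<in> {x. h x < 0} \<inter> icube" using x by simp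
  have "open {x. h x < 0}" by (rule open_Collect_less[OF c]) simp
  then have "\<exists>x\<in>{x. h x < 0} \<inter> icube. h x \<ge> 0"
    by (intro AE_cube_open[OF ae]) (use icube ne in blast)+
  then show False by auto
qed

lemma AE_zero_icube:
  fixes h :: "real^'n \<Rightarrow> real"
  assumes c: "continuous_on UNIV h" and ae: "AE x in cubeM. h x = 0" and x: "x \<in> icube"
  shows "h x = 0"
proof -
  have "h x \<ge> 0" by (rule AE_nonneg_icube[OF c _ x]) (use ae in auto)
  moreover have "- h x \<ge> 0"
    by (rule AE_nonneg_icube[OF _ _ x]) (use c ae in \<open>auto intro: continuous_on_minus\<close>)
  ultimately show ?thesis by simp
qed

text \<open>Along the line through \<open>x0\<close> and y the polynomial becomes one in a single
  variable with infinitely many zeros, so it vanishes on the whole line.\<close>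

lemma real_polynomial_function_zero:
  fixes P :: "'a::euclidean_space \<Rightarrow> real"
  assumes P: "real_polynomial_function P" and U: "open U" "x0 \<in> U" "\<And>x. x \<in> U \<Longrightarrow> P x = 0"
  shows "P y = 0"
proof -
  obtain e where e: "e > 0" "ball x0 e \<subseteq> U" using U open_contains_ball by blast
  define v where "v = y - x0"
  have "polynomial_function (\<lambda>t::real. x0 + t *\<^sub>R v)"
    by (intro polynomial_function_add polynomial_function_const polynomial_function_bounded_linear
        bounded_linear_scaleR_left)
  then have "real_polynomial_function (P \<circ> (\<lambda>t::real. x0 + t *\<^sub>R v))"
    by (rule real_polynomial_function_compose[OF _ P])
  then obtain c n where c: "\<And>t. P (x0 + t *\<^sub>R v) = (\<Sum>i\<le>n. c i * t ^ i)"
    unfolding real_polynomial_function_iff_sum by (auto simp: fun_eq_iff)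
  \<comment> \<open>Keeps the segment inside the ball of radius e; the 1 in the denominator covers
    the case y = \<open>x0\<close>.\<close>
  define s where "s = e / (norm v + 1)"
  have s: "s > 0" using e by (simp add: s_def add_nonneg_pos)
  have "{0<..<s} \<subseteq> {t. (\<Sum>i\<le>n. c i * t ^ i) = 0}"
  proof
    fix t assume t: "t \<in> {0<..<s}"
    have "norm (t *\<^sub>R v) < e"
    proof -
      have "t * norm v \<le> t * (norm v + 1)" using t by (intro mult_left_mono) auto
      also have "\<dots> < s * (norm v + 1)" using t by (intro mult_strict_right_mono) (auto simp: add_nonneg_pos)
      also have "\<dots> = e" unfolding s_def using norm_ge_zero[of v] by (simp add: add_nonneg_eq_0_iff)
      finally show ?thesis using t by simp
    qed
    then have "x0 + t *\<^sub>R v \<in> U" using e by (auto simp: dist_norm)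
    then have "P (x0 + t *\<^sub>R v) = 0" by (rule U(3))
    then show "t \<in> {t. (\<Sum>i\<le>n. c i * t ^ i) = 0}" unfolding c by simp
  qed
  moreover have "infinite {0<..<s}" using s by (simp add: infinite_Ioo)
  ultimately have "infinite {t. (\<Sum>i\<le>n. c i * t ^ i) = 0}" using finite_subset by blast
  then have "\<forall>i\<le>n. c i = 0" using polyfun_finite_roots[of c n] by blast
  then have "P (x0 + 1 *\<^sub>R v) = 0" by (subst c) simp
  then show ?thesis by (simp add: v_def)
qed

text \<open>Cauchy-Schwarz against the constant 1, obtained by expanding the integral of (V |h| -
  I)^2, which is nonnegative. Dividing by V needs V > 0; the case V = 0 is settled directly instead
  of computing the volume.\<close>

lemma integral_abs_square_le:
  fixes h :: "real^'n \<Rightarrow> real"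
  assumes "continuous_on UNIV h"
  shows "(LINT x|cubeM. \<bar>h x\<bar>)\<^sup>2 \<le> measure (cubeM :: (real^'n) measure) cube * (LINT x|cubeM. (h x)\<^sup>2)"
proof -
  define I where "I = (LINT x|cubeM. \<bar>h x\<bar>)"
  define V where "V = measure (cubeM :: (real^'n) measure) cube"
  have i: "integrable cubeM (\<lambda>x. \<bar>h x\<bar>)" "integrable cubeM (\<lambda>x. (h x)\<^sup>2)"
    by (intro integrable_cube_continuous continuous_intros assms)+
  have "0 \<le> (LINT x|cubeM. (V * \<bar>h x\<bar> - I)\<^sup>2)" by simp
  also have "\<dots> = (LINT x|cubeM. V\<^sup>2 * (h x)\<^sup>2 - (2 * V * I) * \<bar>h x\<bar> + I\<^sup>2)"
    by (intro Bochner_Integration.integral_cong refl) (simp add: power2_diff power_mult_distrib mult_ac)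
  also have "\<dots> = V\<^sup>2 * (LINT x|cubeM. (h x)\<^sup>2) - (2 * V * I) * I + V * I\<^sup>2"
    using i by (simp add: I_def V_def)
  also have "\<dots> = V * (V * (LINT x|cubeM. (h x)\<^sup>2) - I\<^sup>2)"
    by (simp add: power2_eq_square algebra_simps)
  finally have *: "0 \<le> V * (V * (LINT x|cubeM. (h x)\<^sup>2) - I\<^sup>2)" .
  show ?thesis
  proof (cases "V = 0")
    case True
    then have "emeasure (cubeM :: (real^'n) measure) cube = 0"
      unfolding V_def by (simp add: cubeM.emeasure_eq_measure)
    then have "AE x in (cubeM :: (real^'n) measure). False"
      by (intro AE_I[where N = cube]) auto
    then have "I = (LINT x|(cubeM :: (real^'n) measure). 0)" unfolding I_def
      by (intro integral_cong_AE) (use i in auto)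
    then show ?thesis unfolding I_def[symmetric] by simp
  next
    case False
    then have "V > 0" by (simp add: V_def zero_less_measure_iff)
    then have "0 \<le> V * (LINT x|cubeM. (h x)\<^sup>2) - I\<^sup>2" using * by (simp add: zero_le_mult_iff)
    then show ?thesis by (simp add: I_def V_def)
  qed
qed

lemma moments_bound:
  fixes m :: "real^'n \<Rightarrow> real^'m"
  assumes m: "\<And>j. continuous_on UNIV (\<lambda>x. m x $ j)"
  obtains C where "C > 0" "\<And>h. continuous_on UNIV h \<Longrightarrow> (norm (moments m h))\<^sup>2 \<le> C * (LINT x|cubeM. (h x)\<^sup>2)"
proof -
  have "\<exists>B>0. \<forall>x\<in>cube. norm (m x $ j) \<le> B" for j
    using bounded_cube[OF m] by metis
  then obtain B where B: "\<And>j. B j > 0" "\<And>j x. x \<in> cube \<Longrightarrow> norm (m x $ j) \<le> B j" by metis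
  define S where "S = (\<Sum>j\<in>UNIV. B j)"
  define V where "V = measure (cubeM :: (real^'n) measure) cube"
  \<comment> \<open>S^2 V is the constant that Cauchy-Schwarz yields; adding 1 makes it positive
    without further knowledge of V.\<close>
  show ?thesis
  proof (rule that[of "S\<^sup>2 * V + 1"])
    show "S\<^sup>2 * V + 1 > 0" by (simp add: V_def add_nonneg_pos)
    fix h :: "real^'n \<Rightarrow> real" assume h: "continuous_on UNIV h"
    have ij: "integrable cubeM (\<lambda>x. m x $ j * h x)" for j
      by (intro integrable_cube_continuous continuous_intros m h)
    have ih: "integrable cubeM (\<lambda>x. \<bar>h x\<bar>)"
      by (intro integrable_cube_continuous continuous_intros h)
    have "norm (moments m h) \<le> (\<Sum>j\<in>UNIV. \<bar>moments m h $ j\<bar>)" by (rule norm_le_l1_cart)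
    also have "\<dots> \<le> (\<Sum>j\<in>UNIV. B j * (LINT x|cubeM. \<bar>h x\<bar>))"
    proof (rule sum_mono)
      fix j
      have "\<bar>moments m h $ j\<bar> \<le> (LINT x|cubeM. \<bar>m x $ j * h x\<bar>)"
        by (simp add: moments_def integral_abs_bound)
      also have "\<dots> \<le> (LINT x|cubeM. B j * \<bar>h x\<bar>)"
      proof (rule integral_mono)
        show "integrable cubeM (\<lambda>x. \<bar>m x $ j * h x\<bar>)" using ij by (rule integrable_abs)
      qed (use ih B in \<open>auto simp: abs_mult intro!: mult_right_mono\<close>)
      finally show "\<bar>moments m h $ j\<bar> \<le> B j * (LINT x|cubeM. \<bar>h x\<bar>)" by simp
    qed
    also have "\<dots> = S * (LINT x|cubeM. \<bar>h x\<bar>)" by (simp add: S_def sum_distrib_right)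
    finally have "(norm (moments m h))\<^sup>2 \<le> (S * (LINT x|cubeM. \<bar>h x\<bar>))\<^sup>2" by (rule power_mono) simp
    also have "\<dots> \<le> S\<^sup>2 * (V * (LINT x|cubeM. (h x)\<^sup>2))"
      unfolding power_mult_distrib V_def by (intro mult_left_mono integral_abs_square_le h) simp
    also have "\<dots> \<le> (S\<^sup>2 * V + 1) * (LINT x|cubeM. (h x)\<^sup>2)" by (simp add: algebra_simps)
    finally show "(norm (moments m h))\<^sup>2 \<le> (S\<^sup>2 * V + 1) * (LINT x|cubeM. (h x)\<^sup>2)" .
  qed
qed

lemma moments_add:
  assumes m: "\<And>j. continuous_on UNIV (\<lambda>x. m x $ j)" and g: "continuous_on UNIV g" and h: "continuous_on UNIV h"
  shows "moments m (\<lambda>x. g x + h x) = moments m g + moments m h"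
proof -
  have "integrable cubeM (\<lambda>x. m x $ j * g x)" "integrable cubeM (\<lambda>x. m x $ j * h x)" for j
    by (intro integrable_cube_continuous continuous_intros m g h)+
  then show ?thesis by (simp add: moments_def vec_eq_iff distrib_left)
qed

lemma moments_cmult: "moments m (\<lambda>x. a * g x) = a *\<^sub>R moments m g"
proof -
  have "(\<lambda>x. m x $ j * (a * g x)) = (\<lambda>x. a * (m x $ j * g x))" for j by (simp add: mult_ac)
  then show ?thesis by (simp add: moments_def vec_eq_iff)
qed

lemma moments_diff:
  assumes m: "\<And>j. continuous_on UNIV (\<lambda>x. m x $ j)" and g: "continuous_on UNIV g" and h: "continuous_on UNIV h"
  shows "moments m (\<lambda>x. g x - h x) = moments m g - moments m h"
  using moments_add[OF m g, of "\<lambda>x. - 1 * h x"] h moments_cmult[of m "- 1" h]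
  by (simp add: continuous_on_minus)

lemma moments_sum:
  assumes m: "\<And>j. continuous_on UNIV (\<lambda>x. m x $ j)" and g: "\<And>i. continuous_on UNIV (g i)" and I: "finite I"
  shows "moments m (\<lambda>x. \<Sum>i\<in>I. c i * g i x) = (\<Sum>i\<in>I. c i *\<^sub>R moments m (g i))"
  using I
proof (induction I)
  case empty
  then show ?case by (simp add: moments_def vec_eq_iff)
next
  case (insert i I)
  have "moments m (\<lambda>x. c i * g i x + (\<Sum>i\<in>I. c i * g i x))
      = moments m (\<lambda>x. c i * g i x) + moments m (\<lambda>x. \<Sum>i\<in>I. c i * g i x)"
    by (intro moments_add m continuous_intros g)
  then show ?case using insert by (simp add: moments_cmult)
qed

lemma moments_AE:
  assumes m: "\<And>j. continuous_on UNIV (\<lambda>x. m x $ j)"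
    and "AE x in cubeM. f x = g x" "f \<in> borel_measurable cubeM" "g \<in> borel_measurable cubeM"
  shows "moments m f = moments m g"
proof -
  have "(LINT x|cubeM. m x $ j * f x) = (LINT x|cubeM. m x $ j * g x)" for j
    by (rule integral_cong_AE) (use assms meas_cubeM[OF m] in auto)
  then show ?thesis by (simp add: moments_def vec_eq_iff)
qed

text \<open>The attainable moment vectors form a subspace \<open>V\<close>, so if it were proper,
  some nonzero c would be orthogonal to it. This c is the combination that makes all coefficients
  vanish; the contradiction needs a nonempty open set on which F is positive, which continuity
  supplies around \<open>x0\<close>.\<close>

lemma moments_spanning:
  fixes m :: "real^'n \<Rightarrow> real^'m" and F :: "real^'n \<Rightarrow> real"
  assumes poly: "\<And>j. real_polynomial_function (\<lambda>x. m x $ j)"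
    and indep: "lin_indep_components m"
    and F: "continuous_on UNIV F" and x0: "x0 \<in> icube" "F x0 > 0"
  obtains p K where "\<And>j. p j \<in> trig_space K" "\<And>j. moments m (\<lambda>x. p j x * F x) = axis j 1"
proof -
  have m: "continuous_on UNIV (\<lambda>x. m x $ j)" for j
    using continuous_real_polymonial_function[OF poly] continuous_at_imp_continuous_on by blast
  define V where "V = {moments m (\<lambda>x. p x * F x) | p. \<exists>K. p \<in> trig_space K}"
  have cp: "continuous_on UNIV (\<lambda>x. p x * F x)" if "p \<in> trig_space K" for p K
    by (intro continuous_intros F continuous_trig_space[OF that])
  have "subspace V"
  proof (rule subspaceI)
    have "moments m (\<lambda>x. 0 * F x) = 0" by (simp add: moments_def vec_eq_iff)
    then show "0 \<in> V" unfolding V_def using trig_space_const[of 0] by force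
    fix u v assume "u \<in> V" "v \<in> V"
    then obtain p q K L where pq: "p \<in> trig_space K" "q \<in> trig_space L"
      "u = moments m (\<lambda>x. p x * F x)" "v = moments m (\<lambda>x. q x * F x)" unfolding V_def by blast
    then have "u + v = moments m (\<lambda>x. (p x + q x) * F x)"
      unfolding distrib_right by (simp add: moments_add m cp)
    moreover have "(\<lambda>x. p x + q x) \<in> trig_space (max K L)"
      using pq trig_space_mono[of K "max K L"] trig_space_mono[of L "max K L"] by (intro trig_space_add) auto
    ultimately show "u + v \<in> V"
      unfolding V_def by (intro CollectI exI[of _ "\<lambda>x. p x + q x"]) blast
  next
    fix a :: real and u assume "u \<in> V"
    then obtain p K where p: "p \<in> trig_space K" "u = moments m (\<lambda>x. p x * F x)" unfolding V_def by blast
    then have "a *\<^sub>R u = moments m (\<lambda>x. (a * p x) * F x)" by (simp add: moments_cmult[symmetric] mult.assoc)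
    then show "a *\<^sub>R u \<in> V"
      unfolding V_def using trig_space_cmult[OF p(1)] by (intro CollectI exI[of _ "\<lambda>x. a * p x"]) blast
  qed
  have "V = UNIV"
  proof (rule ccontr)
    assume "V \<noteq> UNIV"
    then have "span V \<noteq> UNIV" using \<open>subspace V\<close> by (simp add: span_eq_iff[THEN iffD2])
    then obtain c where c: "c \<noteq> 0" "\<forall>v\<in>span V. c \<bullet> v = 0" using span_not_UNIV_orthogonal by blast
    define P where "P x = (\<Sum>j\<in>UNIV. c $ j * m x $ j)" for x
    have Pc: "continuous_on UNIV P" unfolding P_def[abs_def] by (intro continuous_intros m)
    define G where "G x = P x * F x" for x
    have Gc: "continuous_on UNIV G" unfolding G_def[abs_def] by (intro continuous_intros Pc F)
    have Gi: "integrable cubeM G" by (rule integrable_cube_continuous[OF Gc])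
    \<comment> \<open>\<open>V\<close> is built from real trigonometric polynomials, so
      orthogonality is tested with shifted cosines; the shifts 0 and pi / 2 then give both parts of
      the complex coefficient.\<close>
    have "(LINT x|cubeM. G x * phase k a x) = 0" for k a
    proof -
      obtain K where pt: "phase k a \<in> trig_space K"
        using trig_space_cos[of k a] unfolding phase_def[abs_def] by blast
      then have "moments m (\<lambda>x. phase k a x * F x) \<in> span V" unfolding V_def by (intro span_base) blast
      then have "c \<bullet> moments m (\<lambda>x. phase k a x * F x) = 0" using c by blast
      moreover have "c \<bullet> moments m (\<lambda>x. phase k a x * F x) = (LINT x|cubeM. (\<Sum>j\<in>UNIV. c $ j * (m x $ j * (phase k a x * F x))))"
      proof -
        have "integrable cubeM (\<lambda>x. m x $ j * (phase k a x * F x))" for j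
          by (intro integrable_cube_continuous continuous_on_mult m cp[OF pt])
        then show ?thesis
          by (simp add: inner_vec_def moments_def Bochner_Integration.integral_sum)
      qed
      moreover have "(\<Sum>j\<in>UNIV. c $ j * (m x $ j * (phase k a x * F x))) = G x * phase k a x" for x
        unfolding G_def P_def sum_distrib_right by (intro sum.cong refl) (simp add: mult_ac)
      ultimately show ?thesis by simp
    qed
    then have J: "Re (cis a * (LINT x|cubeM. complex_of_real (G x) * wave k x)) = 0" for a k
      unfolding integral_phase[OF Gi] .
    have "(LINT x|cubeM. complex_of_real (G x) * wave k x) = 0" for k
    proof (rule complex_eqI)
      show "Re (LINT x|cubeM. complex_of_real (G x) * wave k x) = Re 0" using J[of 0 k] by simp
      show "Im (LINT x|cubeM. complex_of_real (G x) * wave k x) = Im 0" using J[of "pi / 2" k] by simp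
    qed
    then have "AE x in cubeM. G x = 0" by (rule AE_zero_if_fourier_zero[OF Gi])
    then have G0: "G x = 0" if "x \<in> icube" for x by (rule AE_zero_icube[OF Gc _ that])
    define U where "U = {x. F x > 0} \<inter> icube"
    have "open U" unfolding U_def by (intro open_Int icube open_Collect_less F continuous_intros)
    moreover have "x0 \<in> U" using x0 by (simp add: U_def)
    moreover have "P x = 0" if "x \<in> U" for x using G0[of x] that by (auto simp: G_def U_def)
    moreover have "real_polynomial_function P" unfolding P_def[abs_def]
      by (intro real_polynomial_function_sum real_polynomial_function.intros(2,4) poly) auto
    ultimately have "P x = 0" for x using real_polynomial_function_zero by blast
    then have "\<forall>j. c $ j = 0" using indep unfolding lin_indep_components_def P_def by blast
    then show False using c by (simp add: vec_eq_iff)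
  qed
  have "\<exists>p K. p \<in> trig_space K \<and> moments m (\<lambda>x. p x * F x) = axis j 1" for j
  proof -
    have "axis j 1 \<in> V" using \<open>V = UNIV\<close> by simp
    then obtain p K where "axis j 1 = moments m (\<lambda>x. p x * F x)" "p \<in> trig_space K"
      unfolding V_def by blast
    then show ?thesis by metis
  qed
  then obtain p K where pK: "\<And>j. p j \<in> trig_space (K j)" "\<And>j. moments m (\<lambda>x. p j x * F x) = axis j 1"
    by metis
  show ?thesis
  proof (rule that[of p "Max (range K)"])
    show "p j \<in> trig_space (Max (range K))" for j
      by (rule trig_space_mono[OF _ pK(1)]) auto
  qed (rule pK(2))
qed

text \<open>The map sending l to the combination of the v_j differs from the identity by at most 1/2
  in operator norm. Hence |l| is at most twice the norm of its image, the map is injective, and in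
  finite dimension it is onto.\<close>

lemma perturbed_identity_solvable:
  fixes v :: "'m::finite \<Rightarrow> real^'m"
  assumes v: "(\<Sum>j\<in>UNIV. norm (v j - axis j 1)) \<le> 1 / 2"
  obtains l where "(\<Sum>j\<in>UNIV. (l $ j) *\<^sub>R v j) = d" "norm l \<le> 2 * norm d"
proof -
  define L where "L l = (\<Sum>j\<in>UNIV. (l $ j) *\<^sub>R v j)" for l :: "real^'m"
  have close: "norm (L l - l) \<le> norm l / 2" for l
  proof -
    have "l = (\<Sum>j\<in>UNIV. (l $ j) *\<^sub>R axis j 1)"
      by (simp add: vec_eq_iff axis_def if_distrib[of "\<lambda>a. _ * a"] cong: if_cong)
    then have "L l - l = (\<Sum>j\<in>UNIV. (l $ j) *\<^sub>R v j) - (\<Sum>j\<in>UNIV. (l $ j) *\<^sub>R axis j 1)"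
      unfolding L_def by presburger
    also have "\<dots> = (\<Sum>j\<in>UNIV. (l $ j) *\<^sub>R (v j - axis j 1))"
      by (simp add: scaleR_diff_right sum_subtractf)
    also have "norm \<dots> \<le> (\<Sum>j\<in>UNIV. norm l * norm (v j - axis j 1))"
      by (rule order_trans[OF norm_sum sum_mono]) (simp add: mult_right_mono component_le_norm_cart)
    also have "\<dots> \<le> norm l * (1 / 2)"
      unfolding sum_distrib_left[symmetric] by (intro mult_left_mono v) simp
    finally show ?thesis by simp
  qed
  have bd: "norm l \<le> 2 * norm (L l)" for l
    using close[of l] norm_triangle_ineq2[of l "L l"] by (simp add: norm_minus_commute)
  have lin: "linear L"
    by (rule linearI) (simp_all add: L_def scaleR_left_distrib sum.distrib scaleR_sum_right)
  have "inj L" unfolding linear_injective_0[OF lin]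
  proof (intro allI impI)
    fix l assume "L l = 0"
    then show "l = 0" using bd[of l] by simp
  qed
  then have "surj L" using lin linear_injective_imp_surjective by blast
  then obtain l where "L l = d" by (metis surjD)
  then show ?thesis using that[of l] bd[of l] by (simp add: L_def)
qed


subsection \<open>Positive moment-preserving approximations\<close>

text \<open>The constant in \<open>alias_error\<close> does not depend on N, so after multiplication
  by N^(2 r) only the tail of a convergent series remains. The exponent is 2 r because the error is
  squared.\<close>

lemma alias_rate:
  fixes a :: "int^'n \<Rightarrow> complex"
  assumes asum: "(\<lambda>k. cmod (a k)) summable_on UNIV"
    and Z: "\<And>S :: (int^'n) set. finite S \<Longrightarrow> 0 \<notin> S \<Longrightarrow> (\<Sum>l\<in>S. 1 / wgt r l) \<le> Z"
    and w: "(\<lambda>k. wgt r k * (cmod (a k))\<^sup>2) summable_on UNIV"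
  shows "(\<lambda>N. real N ^ (2 * r) * (LINT x|cubeM. (cmod (fsum a x - isum N a x))\<^sup>2)) \<longlonglongrightarrow> 0"
proof -
  define A where "A = 2 * (2 * pi) ^ CARD('n) * (1 + Z)"
  define \<tau> where "\<tau> N = (\<Sum>\<^sub>\<infinity>k\<in>- freqs N. wgt r k * (cmod (a k))\<^sup>2)" for N
  show ?thesis
  proof (rule tendsto_sandwich[of "\<lambda>_. 0" _ _ "\<lambda>N. A * \<tau> N"])
    show "\<forall>\<^sub>F N in sequentially. real N ^ (2 * r) * (LINT x|cubeM. (cmod (fsum a x - isum N a x))\<^sup>2) \<le> A * \<tau> N"
      using eventually_ge_at_top[of 1]
    proof eventually_elim
      case (elim N)
      then have n: "real N ^ (2 * r) > 0" by simp
      have "(LINT x|cubeM. (cmod (fsum a x - isum N a x))\<^sup>2) \<le> A / real N ^ (2 * r) * \<tau> N"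
        unfolding A_def \<tau>_def by (rule alias_error[OF asum Z w elim])
      then have "real N ^ (2 * r) * (LINT x|cubeM. (cmod (fsum a x - isum N a x))\<^sup>2)
          \<le> real N ^ (2 * r) * (A / real N ^ (2 * r) * \<tau> N)"
        using n by (intro mult_left_mono) auto
      moreover have "y * (A / y * t) = A * t" if "y > 0" for y t :: real using that by simp
      ultimately show ?case using n by (simp only:)
    qed
    have "\<tau> \<longlonglongrightarrow> 0" unfolding \<tau>_def[abs_def] by (rule infsum_tail[OF w])
    from tendsto_mult[OF tendsto_const[of A] this] show "(\<lambda>N. A * \<tau> N) \<longlonglongrightarrow> 0" by simp
  qed auto
qed

text \<open>The repair is as cheap as the interpolation: the moment defect \<open>d\<close> is
  bounded by the L2 error of the interpolant, the multipliers l by twice the defect, and the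
  correctors uniformly in N. So the total squared error is at most a fixed multiple of the aliasing
  error.\<close>

lemma corrected_interpolant:
  fixes m :: "real^'n \<Rightarrow> real^'m" and a :: "int^'n \<Rightarrow> complex" and F :: "real^'n \<Rightarrow> real"
  assumes m: "\<And>j. continuous_on UNIV (\<lambda>x. m x $ j)"
    and asum: "(\<lambda>k. cmod (a k)) summable_on UNIV"
    and aF: "\<And>x. fsum a x = complex_of_real (F x)"
    and Fpos: "\<And>x. x \<in> icube \<Longrightarrow> F x \<ge> 0"
    and p: "\<And>j. p j \<in> trig_space K" "\<And>j. moments m (\<lambda>x. p j x * F x) = axis j 1"
    and E: "(\<lambda>N. LINT x|cubeM. (cmod (fsum a x - isum N a x))\<^sup>2) \<longlonglongrightarrow> 0"
  obtains C where "\<forall>\<^sub>F N in sequentially. \<exists>g\<in>trig_space_nonneg N. moments m g = moments m F \<and>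
    (LINT x|cubeM. (g x - F x)\<^sup>2) \<le> C * (LINT x|cubeM. (cmod (fsum a x - isum N a x))\<^sup>2)"
proof -
  define En where "En N = (LINT x|cubeM. (cmod (fsum a x - isum N a x))\<^sup>2)" for N
  have En0: "En N \<ge> 0" for N by (simp add: En_def)
  have Fc: "continuous_on UNIV F"
    using continuous_on_Re[OF continuous_fsum[OF asum]] by (simp add: aF)
  have "\<exists>b. (\<lambda>k. cmod (b k)) summable_on UNIV \<and> (\<forall>x. fsum b x = complex_of_real (p j x) * fsum a x)" for j
    using fsum_mult_ctrig[OF asum, of "\<lambda>x. complex_of_real (p j x)" K] p(1) trig_space_iff_ctrig by metis
  then obtain b where b: "\<And>j. (\<lambda>k. cmod (b j k)) summable_on UNIV"
    "\<And>j x. fsum (b j) x = complex_of_real (p j x * F x)" unfolding aF by (metis of_real_mult)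
  define R where "R N x = Re (isum N a x)" for N x
  define h where "h j N x = Re (isum N (b j) x)" for j N x
  have RT: "R N \<in> trig_space N" for N unfolding R_def[abs_def] by (intro Re_ctrig isum_ctrig asum)
  have hT: "h j N \<in> trig_space N" for j N unfolding h_def[abs_def] by (intro Re_ctrig isum_ctrig b)
  have Rc: "continuous_on UNIV (R N)" for N by (rule continuous_trig_space[OF RT])
  have hc: "continuous_on UNIV (h j N)" for j N by (rule continuous_trig_space[OF hT])
  have pc: "continuous_on UNIV (p j)" for j by (rule continuous_trig_space[OF p(1)])
  have pFc: "continuous_on UNIV (\<lambda>x. p j x * F x)" for j by (intro continuous_intros pc Fc)
  have Rcol: "R N (colloc N k) = F (colloc N k)" for N k
    by (simp add: R_def isum_colloc[OF asum] aF)
  have hcol: "h j N (colloc N k) = p j (colloc N k) * F (colloc N k)" for j N k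
    by (simp add: h_def isum_colloc[OF b(1)] b(2))
  have RE: "(LINT x|cubeM. (R N x - F x)\<^sup>2) \<le> En N" for N
    unfolding En_def
  proof (rule integral_mono)
    show "integrable cubeM (\<lambda>x. (R N x - F x)\<^sup>2)"
      by (intro integrable_cube_continuous continuous_intros Rc Fc)
    show "integrable cubeM (\<lambda>x. (cmod (fsum a x - isum N a x))\<^sup>2)"
      by (intro integrable_cube_continuous continuous_intros continuous_fsum[OF asum] continuous_ctrig[OF isum_ctrig[OF asum]])
    fix x
    have "\<bar>R N x - F x\<bar> \<le> cmod (fsum a x - isum N a x)"
      using abs_Re_le_cmod[of "fsum a x - isum N a x"] by (simp add: R_def aF abs_minus_commute)
    then have "\<bar>R N x - F x\<bar>\<^sup>2 \<le> (cmod (fsum a x - isum N a x))\<^sup>2" by (rule power_mono) simp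
    then show "(R N x - F x)\<^sup>2 \<le> (cmod (fsum a x - isum N a x))\<^sup>2" by simp
  qed
  obtain Cm where Cm: "Cm > 0"
    "\<And>u. continuous_on UNIV u \<Longrightarrow> (norm (moments m u))\<^sup>2 \<le> Cm * (LINT x|cubeM. (u x)\<^sup>2)"
    using moments_bound[OF m] by metis
  define V where "V = measure (cubeM :: (real^'n) measure) cube"
  have V0: "V \<ge> 0" by (simp add: V_def)
  define t where "t j N = 2 * (\<Sum>\<^sub>\<infinity>k\<in>- freqs N. cmod (b j k))" for j N
  have t0: "t j \<longlonglongrightarrow> 0" for j
    using tendsto_mult[OF tendsto_const[of 2] infsum_tail[OF b(1)[of j]]] by (simp add: t_def[abs_def])
  have herr: "\<bar>h j N x - p j x * F x\<bar> \<le> t j N" for j N x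
    using order_trans[OF abs_Re_le_cmod isum_error[OF b(1)[of j], of x N]]
    by (simp add: h_def b(2) t_def abs_minus_commute)

  define d where "d N = moments m F - moments m (R N)" for N
  have dE: "(norm (d N))\<^sup>2 \<le> Cm * En N" for N
  proof -
    have "norm (d N) = norm (moments m (\<lambda>x. R N x - F x))"
      by (simp add: d_def moments_diff[OF m Rc Fc] norm_minus_commute)
    also have "\<dots>\<^sup>2 \<le> Cm * (LINT x|cubeM. (R N x - F x)\<^sup>2)"
      by (intro Cm continuous_intros Rc Fc)
    also have "\<dots> \<le> Cm * En N" using RE Cm(1) by (intro mult_left_mono) auto
    finally show ?thesis .
  qed
  \<comment> \<open>The interpolated correctors have moments close to, but not exactly, the unit
    vectors; for large N they are close enough for
    \<open>perturbed_identity_solvable\<close>.\<close>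
  have mom_h: "(\<lambda>N. norm (moments m (h j N) - axis j 1)) \<longlonglongrightarrow> 0" for j
  proof (rule tendsto_sandwich[of "\<lambda>_. 0" _ _ "\<lambda>N. sqrt (Cm * (V * (t j N)\<^sup>2))"])
    have "norm (moments m (h j N) - axis j 1) \<le> sqrt (Cm * (V * (t j N)\<^sup>2))" for N
    proof (rule real_le_rsqrt)
      have "moments m (h j N) - axis j 1 = moments m (\<lambda>x. h j N x - p j x * F x)"
        by (simp add: moments_diff[OF m hc pFc] p(2))
      then have "(norm (moments m (h j N) - axis j 1))\<^sup>2 \<le> Cm * (LINT x|cubeM. (h j N x - p j x * F x)\<^sup>2)"
        using Cm(2)[of "\<lambda>x. h j N x - p j x * F x"] by (simp add: continuous_on_diff hc pFc)
      also have "(LINT x|cubeM. (h j N x - p j x * F x)\<^sup>2) \<le> (LINT x|(cubeM :: (real^'n) measure). (t j N)\<^sup>2)"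
      proof (rule integral_mono)
        show "integrable cubeM (\<lambda>x. (h j N x - p j x * F x)\<^sup>2)"
          by (intro integrable_cube_continuous continuous_on_power continuous_on_diff hc pFc)
        fix x
        show "(h j N x - p j x * F x)\<^sup>2 \<le> (t j N)\<^sup>2"
          using power_mono[OF herr[of j N x], of 2] by simp
      qed simp
      also have "\<dots> = V * (t j N)\<^sup>2" by (simp add: V_def)
      finally show "(norm (moments m (h j N) - axis j 1))\<^sup>2 \<le> Cm * (V * (t j N)\<^sup>2)"
        using Cm(1) by simp
    qed
    then show "\<forall>\<^sub>F N in sequentially. norm (moments m (h j N) - axis j 1) \<le> sqrt (Cm * (V * (t j N)\<^sup>2))"
      by simp
    have "(\<lambda>N. sqrt (Cm * (V * (t j N)\<^sup>2))) \<longlonglongrightarrow> sqrt (Cm * (V * 0\<^sup>2))"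
      by (intro tendsto_real_sqrt tendsto_mult tendsto_const tendsto_power t0)
    then show "(\<lambda>N. sqrt (Cm * (V * (t j N)\<^sup>2))) \<longlonglongrightarrow> 0" by simp
  qed auto
  have "(\<lambda>N. \<Sum>j\<in>UNIV. norm (moments m (h j N) - axis j 1)) \<longlonglongrightarrow> (\<Sum>j\<in>(UNIV::'m set). 0)"
    by (intro tendsto_sum mom_h)
  then have ev1: "\<forall>\<^sub>F N in sequentially. (\<Sum>j\<in>UNIV. norm (moments m (h j N) - axis j 1)) < 1 / 2"
    by (rule order_tendstoD) simp

  have "\<exists>P>0. \<forall>x\<in>cube. norm (p j x) \<le> P" for j using bounded_cube[OF pc] by metis
  then obtain P where P: "\<And>j. P j > 0" "\<And>j x. x \<in> cube \<Longrightarrow> norm (p j x) \<le> P j" by metis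
  define Q where "Q = (\<Sum>j\<in>UNIV. P j)"
  have Q0: "Q \<ge> 0" unfolding Q_def using P(1) by (intro sum_nonneg less_imp_le)
  \<comment> \<open>\<open>Q\<close> bounds the sum of the |p_j| on the cube and 2 * sqrt (Cm * En
    N) will bound |l|. Once the product is below 1, the factor 1 + sum_j l_j p_j is positive at
    every collocation point.\<close>
  have "(\<lambda>N. 2 * sqrt (Cm * En N) * Q) \<longlonglongrightarrow> 2 * sqrt (Cm * 0) * Q"
    using E unfolding En_def by (intro tendsto_intros)
  then have ev2: "\<forall>\<^sub>F N in sequentially. 2 * sqrt (Cm * En N) * Q < 1"
    by (rule order_tendstoD) simp
  define H where "H = (\<Sum>j\<in>UNIV. (\<Sum>\<^sub>\<infinity>k. cmod (b j k)))"
  have hb: "\<bar>h j N x\<bar> \<le> (\<Sum>\<^sub>\<infinity>k. cmod (b j k))" for j N x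
  proof -
    have "\<bar>h j N x\<bar> \<le> cmod (isum N (b j) x)" unfolding h_def by (rule abs_Re_le_cmod)
    also have "\<dots> \<le> (\<Sum>\<^sub>\<infinity>k. cmod (b j k))"
      by (rule Lim_norm_ubound[OF _ isum_limit[OF b(1)]])
         (auto intro!: always_eventually norm_partial_fsum[OF b(1)])
    finally show ?thesis .
  qed
  \<comment> \<open>The 2 comes from splitting the square of interpolation error plus correction.
    The correction contributes 2 V (|l| H)^2, and |l|^2 is at most 4 Cm En.\<close>
  define C where "C = 2 + 8 * Cm * V * H\<^sup>2"
  show ?thesis
  proof (rule that[of C])
    show "\<forall>\<^sub>F N in sequentially. \<exists>g\<in>trig_space_nonneg N. moments m g = moments m F \<and>
      (LINT x|cubeM. (g x - F x)\<^sup>2) \<le> C * (LINT x|cubeM. (cmod (fsum a x - isum N a x))\<^sup>2)"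
      using ev1 ev2
    proof eventually_elim
      case (elim N)
      obtain l where l: "(\<Sum>j\<in>UNIV. (l $ j) *\<^sub>R moments m (h j N)) = d N" "norm l \<le> 2 * norm (d N)"
        by (rule perturbed_identity_solvable[OF less_imp_le[OF elim(1)]])
      define q where "q x = (\<Sum>j\<in>UNIV. l $ j * h j N x)" for x
      define g where "g x = R N x + q x" for x
      have qT: "q \<in> trig_space N" unfolding q_def[abs_def] by (intro trig_space_sum trig_space_cmult hT)
      have qc: "continuous_on UNIV q" by (rule continuous_trig_space[OF qT])
      have gT: "g \<in> trig_space N" unfolding g_def[abs_def] by (intro trig_space_add RT qT)
      have "moments m q = d N" unfolding q_def[abs_def] using l(1) by (simp add: moments_sum m hc)
      then have gm: "moments m g = moments m F"
        unfolding g_def[abs_def] by (simp add: moments_add[OF m Rc qc] d_def)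
      have ld: "norm l \<le> 2 * sqrt (Cm * En N)"
        using l(2) real_le_rsqrt[OF dE[of N]] by linarith
      have "g (colloc N k) \<ge> 0" if "k \<in> freqs N" for k
      proof -
        define y where "y = colloc N k"
        have yi: "y \<in> icube" unfolding y_def by (rule colloc_icube[OF that])
        then have yc: "y \<in> cube" using icube(2) by blast
        have "\<bar>\<Sum>j\<in>UNIV. l $ j * p j y\<bar> \<le> (\<Sum>j\<in>UNIV. norm l * P j)"
        proof (rule order_trans[OF sum_abs sum_mono])
          fix j
          have "\<bar>l $ j\<bar> * \<bar>p j y\<bar> \<le> norm l * P j"
            using P(2)[OF yc, of j] by (intro mult_mono component_le_norm_cart) auto
          then show "\<bar>l $ j * p j y\<bar> \<le> norm l * P j" by (simp add: abs_mult)
        qed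
        also have "\<dots> = norm l * Q" by (simp add: Q_def sum_distrib_left)
        also have "\<dots> \<le> 2 * sqrt (Cm * En N) * Q"
          using ld Q0 by (rule mult_right_mono)
        finally have "0 \<le> 1 + (\<Sum>j\<in>UNIV. l $ j * p j y)" using elim(2) by linarith
        \<comment> \<open>Interpolation is exact at collocation points, so there the additive
          correction of the interpolant is a multiplication of F.\<close>
        then have "0 \<le> F y * (1 + (\<Sum>j\<in>UNIV. l $ j * p j y))" using Fpos[OF yi] by (intro mult_nonneg_nonneg)
        also have "\<dots> = g y"
          by (simp add: g_def q_def y_def Rcol hcol sum_distrib_left algebra_simps)
        finally show ?thesis by (simp add: y_def)
      qed
      then have gN: "g \<in> trig_space_nonneg N" using gT by (simp add: trig_space_nonneg_def)
      have qb: "\<bar>q x\<bar> \<le> norm l * H" for x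
      proof -
        have "\<bar>q x\<bar> \<le> (\<Sum>j\<in>UNIV. norm l * (\<Sum>\<^sub>\<infinity>k. cmod (b j k)))"
          unfolding q_def
        proof (rule order_trans[OF sum_abs sum_mono])
          fix j
          have "\<bar>l $ j\<bar> * \<bar>h j N x\<bar> \<le> norm l * (\<Sum>\<^sub>\<infinity>k. cmod (b j k))"
            by (intro mult_mono component_le_norm_cart hb) auto
          then show "\<bar>l $ j * h j N x\<bar> \<le> norm l * (\<Sum>\<^sub>\<infinity>k. cmod (b j k))" by (simp add: abs_mult)
        qed
        then show ?thesis by (simp add: H_def sum_distrib_left)
      qed
      have "(norm l * H)\<^sup>2 \<le> 4 * Cm * En N * H\<^sup>2"
      proof -
        have "(norm l)\<^sup>2 \<le> (2 * sqrt (Cm * En N))\<^sup>2" using ld by (rule power_mono) simp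
        also have "\<dots> = 4 * Cm * En N" using Cm(1) En0[of N] by (simp add: power_mult_distrib)
        finally show ?thesis unfolding power_mult_distrib by (intro mult_right_mono) auto
      qed
      note lH = this
      have "(LINT x|cubeM. (g x - F x)\<^sup>2) \<le> (LINT x|cubeM. 2 * (R N x - F x)\<^sup>2 + 2 * (norm l * H)\<^sup>2)"
      proof (rule integral_mono)
        show "integrable cubeM (\<lambda>x. (g x - F x)\<^sup>2)"
          by (intro integrable_cube_continuous continuous_on_power continuous_on_diff Fc continuous_trig_space[OF gT])
        show "integrable cubeM (\<lambda>x. 2 * (R N x - F x)\<^sup>2 + 2 * (norm l * H)\<^sup>2)"
          by (intro integrable_cube_continuous continuous_intros Rc Fc)
        fix x
        have "(g x - F x)\<^sup>2 \<le> 2 * (R N x - F x)\<^sup>2 + 2 * (q x)\<^sup>2"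
          using zero_le_power2[of "(R N x - F x) - q x"] by (simp add: g_def power2_eq_square algebra_simps)
        moreover have "(q x)\<^sup>2 \<le> (norm l * H)\<^sup>2" using power_mono[OF qb[of x], of 2] by simp
        ultimately show "(g x - F x)\<^sup>2 \<le> 2 * (R N x - F x)\<^sup>2 + 2 * (norm l * H)\<^sup>2" by linarith
      qed
      also have "\<dots> = 2 * (LINT x|cubeM. (R N x - F x)\<^sup>2) + V * (2 * (norm l * H)\<^sup>2)"
      proof -
        have "integrable cubeM (\<lambda>x. (R N x - F x)\<^sup>2)"
          by (intro integrable_cube_continuous continuous_intros Rc Fc)
        then show ?thesis by (simp add: V_def)
      qed
      also have "\<dots> \<le> 2 * En N + V * (2 * (4 * Cm * En N * H\<^sup>2))"
        using RE[of N] lH V0 by (intro add_mono mult_left_mono) auto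
      also have "\<dots> = C * En N" by (simp add: C_def algebra_simps)
      finally show ?case using gN gm unfolding En_def by blast
    qed
  qed
qed

section \<open>Positivity of the Sobolev norm and comparison with the projection\<close>

text \<open>The norm sees f only through chosen weak derivatives, including the one of order zero.
  That one has coefficients of the same modulus as f, so a nonzero coefficient bounds its L2 norm
  away from zero.\<close>

lemma Hp_norm_pos:
  fixes f :: "real^'n \<Rightarrow> real"
  assumes f: "f \<in> Hp r" and k: "fourier_coeff f k \<noteq> 0"
  shows "Hp_norm r f > 0"
proof -
  have fL: "f \<in> L2" using f by (simp add: Hp_def)
  have mi0: "mi_order (0 :: nat^'n) = 0" by (simp add: mi_order_def)
  then have "\<exists>g. weak_deriv_of 0 f g" using f by (simp add: Hp_def)
  then have w: "weak_deriv_of 0 f (weak_deriv 0 f)" unfolding weak_deriv_def by (rule someI_ex)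
  \<comment> \<open>Presents the zero multi-index as a pure derivative of order 0, so that
    \<open>weak_deriv_fourier\<close> applies.\<close>
  have ax: "axis i (0::nat) = 0" for i :: 'n by (simp add: vec_eq_iff axis_def)
  have "cmod (fourier_coeff (weak_deriv 0 f) k) = cmod (fourier_coeff f k)"
    using weak_deriv_fourier[OF fL, of _ 0 "weak_deriv 0 f" k] w by (simp add: ax)
  moreover have "weak_deriv 0 f \<in> L2" using w by (simp add: weak_deriv_of_def)
  ultimately have "0 < L2_norm (weak_deriv 0 f)"
    using fourier_coeff_le_L2[of "weak_deriv 0 f" k] k by (metis zero_less_norm_iff less_le_trans)
  then have "0 < (L2_norm (weak_deriv 0 f))\<^sup>2" by simp
  also have "\<dots> \<le> (\<Sum>\<alpha> | mi_order \<alpha> \<le> r. (L2_norm (weak_deriv \<alpha> f))\<^sup>2)"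
    by (rule member_le_sum[where i = 0]) (auto simp: finite_mi_order_le mi0)
  finally show ?thesis by (simp add: Hp_norm_def)
qed

text \<open>The constant component turns total mass into a moment. If f vanished almost everywhere,
  the positive g would have mass zero, hence would vanish somewhere in the interior.\<close>

lemma positive_moments_nonzero:
  fixes f g :: "real^'n \<Rightarrow> real"
  assumes const: "c \<noteq> 0" "\<And>x. m x $ j = c"
    and g: "integrable cubeM g" "\<And>x. x \<in> cube \<Longrightarrow> g x > 0" "moments m g = moments m f"
  shows "\<not> (AE x in cubeM. f x = 0)"
proof
  assume ae: "AE x in cubeM. f x = 0"
  have mom: "moments m u $ j = c * (LINT x|cubeM. u x)" for u by (simp add: moments_def const)
  have "(LINT x|cubeM. f x) = 0" by (rule integral_eq_zero_AE[OF ae])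
  then have "(LINT x|cubeM. g x) = 0"
    using mom[of g] mom[of f] g(3) const(1) by simp
  moreover have "AE x in cubeM. 0 \<le> g x"
    by (rule AE_I2) (use g(2) in \<open>auto intro: less_imp_le\<close>)
  ultimately have "AE x in cubeM. g x = 0"
    using integral_nonneg_eq_0_iff_AE[OF g(1)] by blast
  from AE_cube_open[OF this icube(1,3,2)] show False using g(2) icube(2) by fastforce
qed

text \<open>All estimates are made for the continuous representative F and transferred to f at the
  end, since moments and L2 distances ignore null sets.\<close>

lemma positive_approximation:
  fixes m :: "real^'n \<Rightarrow> real^'m" and f :: "real^'n \<Rightarrow> real"
  assumes poly: "\<And>j. real_polynomial_function (\<lambda>x. m x $ j)"
    and indep: "lin_indep_components m"
    and r: "real r > real CARD('n) / 2" and f: "f \<in> Hp r"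
    and nonneg: "AE x in cubeM. f x \<ge> 0" and nz: "\<not> (AE x in cubeM. f x = 0)"
  shows "\<forall>\<^sub>F N in sequentially. \<exists>g\<in>trig_space_nonneg N. moments m g = moments m f \<and>
    L2_norm (\<lambda>x. g x - f x) \<le> Hp_norm r f / real N ^ r"
proof -
  have m: "continuous_on UNIV (\<lambda>x. m x $ j)" for j
    using continuous_real_polymonial_function[OF poly] continuous_at_imp_continuous_on by blast
  define a where "a = fourier_coeff f"
  have fL: "f \<in> L2" using f by (simp add: Hp_def)
  obtain Z where Z: "\<And>S :: (int^'n) set. finite S \<Longrightarrow> 0 \<notin> S \<Longrightarrow> (\<Sum>l\<in>S. 1 / wgt r l) \<le> Z"
    using inverse_wgt_summable[OF r] by metis
  obtain B where B: "\<And>S. finite S \<Longrightarrow> (\<Sum>k\<in>S. wgt r k * (cmod (a k))\<^sup>2) \<le> B"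
    using Hp_weighted_bound[OF f] unfolding a_def by metis
  have asum: "(\<lambda>k. cmod (a k)) summable_on UNIV" by (rule abs_summable_coeffs[OF B Z])
  have w: "(\<lambda>k. wgt r k * (cmod (a k))\<^sup>2) summable_on UNIV"
    by (rule nonneg_bdd_above_summable_on) (auto simp: wgt_nonneg intro!: bdd_aboveI2[where M = B] B)
  define F where "F x = Re (fsum a x)" for x
  have aF: "fsum a x = complex_of_real (F x)" for x
    unfolding F_def a_def by (rule fourier_series_AE(1)[OF L2_integrable[OF fL] asum[unfolded a_def]])
  have fF: "AE x in cubeM. f x = F x"
    unfolding F_def a_def by (rule fourier_series_AE(2)[OF L2_integrable[OF fL] asum[unfolded a_def]])
  have Fc: "continuous_on UNIV F" unfolding F_def[abs_def] by (intro continuous_on_Re continuous_fsum asum)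
  have "AE x in cubeM. F x \<ge> 0" using nonneg fF by eventually_elim simp
  then have Fpos: "F x \<ge> 0" if "x \<in> icube" for x by (rule AE_nonneg_icube[OF Fc _ that])
  have "\<exists>x0\<in>icube. F x0 \<noteq> 0"
  proof (rule ccontr)
    assume "\<not> (\<exists>x0\<in>icube. F x0 \<noteq> 0)"
    then have z: "F x = 0" if "x \<in> icube" for x using that by blast
    have "AE x in cubeM. f x = 0"
      using fF AE_interior_cube by eventually_elim (auto simp: icube_def mem_box_cart intro!: z)
    then show False using nz by simp
  qed
  then obtain x0 where x0: "x0 \<in> icube" "F x0 > 0" using Fpos by force
  have "\<exists>k. a k \<noteq> 0"
  proof (rule ccontr)
    assume "\<nexists>k. a k \<noteq> 0"
    then have "F x0 = 0" by (simp add: F_def fsum_def)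
    then show False using x0 by simp
  qed
  then have Hpos: "Hp_norm r f > 0" using Hp_norm_pos[OF f] by (auto simp: a_def)
  obtain p K where p: "\<And>j. p j \<in> trig_space K" "\<And>j. moments m (\<lambda>x. p j x * F x) = axis j 1"
    using moments_spanning[OF poly indep Fc x0] by metis
  define En where "En N = (LINT x|cubeM. (cmod (fsum a x - isum N a x))\<^sup>2)" for N
  have rate: "(\<lambda>N. real N ^ (2 * r) * En N) \<longlonglongrightarrow> 0"
    unfolding En_def by (rule alias_rate[OF asum Z w])
  have E0: "En \<longlonglongrightarrow> 0"
  proof (rule tendsto_sandwich[OF _ _ tendsto_const rate])
    show "\<forall>\<^sub>F N in sequentially. En N \<le> real N ^ (2 * r) * En N"
      using eventually_ge_at_top[of 1]
    proof eventually_elim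
      case (elim N)
      then have "1 \<le> real N ^ (2 * r)" by (intro one_le_power) simp
      then have "1 * En N \<le> real N ^ (2 * r) * En N" by (rule mult_right_mono) (simp add: En_def)
      then show ?case by simp
    qed
  qed (simp add: En_def)
  obtain C where C: "\<forall>\<^sub>F N in sequentially. \<exists>g\<in>trig_space_nonneg N. moments m g = moments m F \<and>
      (LINT x|cubeM. (g x - F x)\<^sup>2) \<le> C * En N"
    using corrected_interpolant[OF m asum aF Fpos p E0[unfolded En_def]] unfolding En_def by blast
  \<comment> \<open>Here the constant \<open>C\<close>, which depends on f, is absorbed: a null
    sequence eventually falls below the fixed positive number \<open>Hp_norm r f\<close>
    squared.\<close>
  have "(\<lambda>N. C * (real N ^ (2 * r) * En N)) \<longlonglongrightarrow> C * 0" by (intro tendsto_mult tendsto_const rate)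
  then have "\<forall>\<^sub>F N in sequentially. C * (real N ^ (2 * r) * En N) < (Hp_norm r f)\<^sup>2"
    by (rule order_tendstoD) (use Hpos in simp)
  with C show ?thesis using eventually_ge_at_top[of 1]
  proof eventually_elim
    case (elim N)
    then obtain g where g: "g \<in> trig_space_nonneg N" "moments m g = moments m F"
      "(LINT x|cubeM. (g x - F x)\<^sup>2) \<le> C * En N" by blast
    have gc: "continuous_on UNIV g"
      using g(1) by (intro continuous_trig_space) (auto simp: trig_space_nonneg_def)
    have fm: "f \<in> borel_measurable cubeM" using fL by (simp add: L2_def)
    have "moments m F = moments m f"
      by (rule moments_AE[OF m]) (use fF fm meas_cubeM[OF Fc] in auto)
    moreover have "L2_norm (\<lambda>x. g x - f x) \<le> Hp_norm r f / real N ^ r"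
    proof -
      have "(LINT x|cubeM. (g x - f x)\<^sup>2) = (LINT x|cubeM. (g x - F x)\<^sup>2)"
      proof (rule integral_cong_AE)
        show "AE x in cubeM. (g x - f x)\<^sup>2 = (g x - F x)\<^sup>2" using fF by eventually_elim simp
      qed (use fm meas_cubeM[OF Fc] meas_cubeM[OF gc] in \<open>auto intro!: borel_measurable_power borel_measurable_diff\<close>)
      also have "\<dots> \<le> C * En N" by (rule g(3))
      also have "\<dots> \<le> (Hp_norm r f / real N ^ r)\<^sup>2"
      proof -
        have "C * e \<le> u / y" if "C * (y * e) < u" "y > 0" for e u y :: real
          using that by (simp add: field_simps)
        from this[OF elim(2)] have "C * En N \<le> (Hp_norm r f)\<^sup>2 / real N ^ (2 * r)"
          using elim(3) by simp
        then show ?thesis by (simp add: power_divide power_mult[symmetric] mult.commute)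
      qed
      finally show ?thesis unfolding L2_norm_def using Hpos by (intro real_le_lsqrt) auto
    qed
    ultimately show ?case using g by auto
  qed
qed

text \<open>Unique existence of the minimizer belongs to the conclusion because
  \<open>pos_proj\<close> is a definite description: only then does the error bound speak about the
  true projection.\<close>

theorem corollary2p3:
  fixes m :: "real^'n \<Rightarrow> real^'m"
  assumes poly: "\<And>j. real_polynomial_function (\<lambda>x. m x $ j)"
    and const: "\<exists>j c. c \<noteq> 0 \<and> (\<forall>x. m x $ j = c)"
    and H1: "lin_indep_components m"
  shows "\<exists>C>0. \<forall>(r::nat) (f :: real^'n \<Rightarrow> real).
    real r > real CARD('n) / 2 \<longrightarrow>
    f \<in> Hp r \<longrightarrow>
    (AE x in lebesgue_on cube. f x \<ge> 0) \<longrightarrow>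
    (\<exists>g. integrable (lebesgue_on cube) g \<and> (\<forall>x\<in>cube. g x > 0) \<and> moments m g = moments m f) \<longrightarrow>
    (\<forall>\<^sub>F N in sequentially. \<exists>g\<in>trig_space N.
        (\<forall>k\<in>freqs N. g (colloc N k) > 0) \<and>
        (\<forall>j. (2 * pi) ^ CARD('n) / (2 * real N + 1) ^ CARD('n) *
               (\<Sum>k\<in>freqs N. g (colloc N k) * trig_proj N (\<lambda>x. m x $ j) (colloc N k))
             = moments m f $ j)) \<longrightarrow>
    (\<forall>\<^sub>F N in sequentially.
        (\<exists>!g. is_pos_proj m N f g) \<and>
        L2_norm (\<lambda>x. f x - pos_proj m N f x) \<le> C * (1 / real N ^ r) * Hp_norm r f)"
proof (intro exI[of _ 1] conjI allI impI)
  fix r :: nat and f :: "real^'n \<Rightarrow> real"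
  assume r: "real r > real CARD('n) / 2" and f: "f \<in> Hp r" and nonneg: "AE x in cubeM. f x \<ge> 0"
    and H2: "\<exists>g. integrable cubeM g \<and> (\<forall>x\<in>cube. g x > 0) \<and> moments m g = moments m f"
  have m: "continuous_on UNIV (\<lambda>x. m x $ j)" for j
    using continuous_real_polymonial_function[OF poly] continuous_at_imp_continuous_on by blast
  have fL: "f \<in> L2" using f by (simp add: Hp_def)
  have nz: "\<not> (AE x in cubeM. f x = 0)"
    using const H2 positive_moments_nonzero[of _ m _ _ f] by blast
  show "\<forall>\<^sub>F N in sequentially. (\<exists>!g. is_pos_proj m N f g) \<and>
      L2_norm (\<lambda>x. f x - pos_proj m N f x) \<le> 1 * (1 / real N ^ r) * Hp_norm r f"
    using positive_approximation[OF poly H1 r f nonneg nz]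
  proof eventually_elim
    case (elim N)
    then obtain g where g: "g \<in> trig_space_nonneg N" "moments m g = moments m f"
      "L2_norm (\<lambda>x. g x - f x) \<le> Hp_norm r f / real N ^ r" by blast
    have ex1: "\<exists>!g. is_pos_proj m N f g"
      by (rule ex1_constrained_argmin[OF m fL]) (use g in blast)
    then have "is_pos_proj m N f (pos_proj m N f)" unfolding pos_proj_def by (rule theI')
    then have "(L2_norm (\<lambda>x. pos_proj m N f x - f x))\<^sup>2 \<le> (L2_norm (\<lambda>x. g x - f x))\<^sup>2"
      unfolding is_pos_proj_def is_arg_min_def using g by (meson not_less)
    then have "L2_norm (\<lambda>x. pos_proj m N f x - f x) \<le> L2_norm (\<lambda>x. g x - f x)"
      by (rule power2_le_imp_le) (simp add: L2_norm_def)
    moreover have "L2_norm (\<lambda>x. f x - pos_proj m N f x) = L2_norm (\<lambda>x. pos_proj m N f x - f x)"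
      by (simp add: L2_norm_def power2_commute)
    ultimately show ?case using ex1 g(3) by simp
  qed
qed simp


end
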